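(* Let $(X,\mu)$ be a computable probability space and let $T:X\to X$ be an almost everywhere computable, $\mu$-preserving map such that $(X,\mu,T)$ is ergodic. Then for each $L^1(X,\mu)$-computable function $f$, the ergodic averages $A_n(x)=\frac1n\sum_{i=0}^{n-1}f(T^i(x))$ effectively converge almost surely to the constant $\int f\,\mathrm{d}\mu$.
   Context: "Algorithm" means recursive function, with the elements of countable sets (such as $\mathbb{Q}$) coded by natural numbers through fixed effective numberings. Computable metric space (CMS): a triple $(X,d,S)$ where $(X,d)$ is a separable metric space, $S=\{s_i\}_{i\in\mathbb{N}}$ is a dense numbered subset (ideal points), and the distances $d(s_i,s_j)$ are computable uniformly in $i,j$, i.e. there is an algorithm $\mathcal{A}:\mathbb{N}^3\to\mathbb{Q}$ with $|\mathcal{A}(i,j,n)-d(s_i,s_j)|<2^{-n}$. A point $x\in X$ is computable if there is an algorithm $\mathcal{A}:\mathbb{N}\to S$ with $d(\mathcal{A}(n),x)\le 2^{-n}$ for all $n$. $\mathbb{R}$ is a CMS with ideal points $\mathbb{Q}$. Ideal balls are the open balls $B(s,q)$ with $s\in S$, $0<q\in\mathbb{Q}$, effectively numbered $B_0,B_1,\dots$. An open set $U$ is effective if it is the union of an algorithmically enumerated (possibly empty) family of ideal balls; a sequence of open sets is uniformly effective if a single algorithm, given the index, enumerates such balls. An effective $G_\delta$-set is the intersection of a sequence of uniformly effective open sets. A function $T:X\to Y$ between CMS's is computable on $D\subseteq X$ if there are uniformly effective open sets $U_i\subseteq X$ with $T^{-1}(B_i^Y)\cap D=U_i\cap D$ for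 all $i$. Computable measure: $X$ is bounded and the set $PM(X)$ of Borel probability measures on $X$ has the metric $W_1(\mu_1,\mu_2)=\sup_{f\in 1\text{-Lip}(X)}|\int f\,\mathrm{d}\mu_1-\int f\,\mathrm{d}\mu_2|$ ($f$ ranging over functions with Lipschitz constant at most one); the ideal points of $PM(X)$ are the finite rational convex combinations of Dirac measures $\delta_s$, $s\in S$. A measure $\mu$ is computable if it is a computable point of this CMS. A computable probability space is a pair $(X,\mu)$ with $X$ a CMS and $\mu$ a computable Borel probability measure on $X$. A function from $(X,\mu)$ to a CMS $Y$ is almost everywhere (a.e.) computable if it is computable on some effective $G_\delta$-set of $\mu$-measure one. $L^1$-computability: $L^1(X,\mu)$ is a CMS with a dense, effectively enumerated set of bounded computable functions as ideal points; concretely one may take the smallest set $\mathcal{F}$ containing the constant $1$ and all functions $g_{s,r,\epsilon}(x)=|1-|d(x,s)-r|^+/\epsilon|^+$ ($s\in S$, $r,\epsilon\in\mathbb{Q}$, $\epsilon>0$, $|a|^+=\max\{a,0\}$) and closed under $\max$, $\min$ and rational linear combinations. An integrable function $f:X\to\overline{\mathbb{R}}$ is $L^1(X,\mu)$-computable if its class is a computable point of this CMS. Convergence: random variables $f_n$ effectively converge in probability to $f$ if there is a computable function $n(\epsilon,\delta)$ of positive rationals $\epsilon,\delta$ with values in $\mathbb{N}$ such that $\mu\{|f_n-f|\ge\epsilon\}<\delta$ for all $n\ge n(\epsilon,\delta)$. They effectively converge almost surely to $f$ if $f_n'=\sup_{k\ge n}|f_k-f|$ effectively converges in probability to $0$.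 *)

theory Defs
  imports "HOL-Probability.Probability"
begin

section \<open>Recursive functions\<close>

text \<open>
  \<^term>\<open>recursive_fn k f\<close> means that \<^term>\<open>f\<close>, restricted to lists of length \<^term>\<open>k\<close>, is a total
  recursive function of \<^term>\<open>k\<close> arguments. This is the class of general recursive functions:
  minimisation is only applied to regular functions, so every function in the class is total.
  The values of \<^term>\<open>f\<close> on lists of other lengths are irrelevant and are never used below.
\<close>

inductive recursive_fn :: "nat \<Rightarrow> (nat list \<Rightarrow> nat) \<Rightarrow> bool" where
  zero: "recursive_fn k (\<lambda>_. 0)"
| succ: "recursive_fn 1 (\<lambda>xs. Suc (xs ! 0))"
| proj: "i < k \<Longrightarrow> recursive_fn k (\<lambda>xs. xs ! i)"
| comp: "recursive_fn (length gs) f \<Longrightarrow> (\<And>g. g \<in> set gs \<Longrightarrow> recursive_fn k g)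
    \<Longrightarrow> recursive_fn k (\<lambda>xs. f (map (\<lambda>g. g xs) gs))"
| prec: "recursive_fn k f \<Longrightarrow> recursive_fn (Suc (Suc k)) g
    \<Longrightarrow> recursive_fn (Suc k) (\<lambda>xs. rec_nat (f (tl xs)) (\<lambda>n r. g (n # r # tl xs)) (hd xs))"
| mini: "recursive_fn (Suc k) f \<Longrightarrow> (\<And>xs. length xs = k \<Longrightarrow> \<exists>n. f (n # xs) = 0)
    \<Longrightarrow> recursive_fn k (\<lambda>xs. LEAST n. f (n # xs) = 0)"

text \<open>
  Effective numberings: \<^const>\<open>nat_to_rat_surj\<close> for all rationals, and \<open>pos_rat\<close> for the
  positive ones. Pairs and lists are coded by \<^const>\<open>prod_encode\<close> and \<^const>\<open>list_encode\<close>.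
\<close>

definition pos_rat :: "nat \<Rightarrow> rat" where
  "pos_rat n = (case prod_decode n of (a, b) \<Rightarrow> Fract (int (Suc a)) (int (Suc b)))"

lemma range_pos_rat: "range pos_rat = {q. 0 < q}"
proof (intro subset_antisym subsetI)
  fix q assume "q \<in> range pos_rat"
  then show "q \<in> {q. 0 < q}"
    by (auto simp: pos_rat_def zero_less_Fract_iff split: prod.splits)
next
  fix q :: rat assume "q \<in> {q. 0 < q}"
  then have q: "0 < q" by simp
  obtain a b where ab: "q = Fract a b" "0 < b" by (cases q) auto
  with q have "0 < a" by (simp add: zero_less_Fract_iff)
  then have "q = pos_rat (prod_encode (nat (a - 1), nat (b - 1)))"
    using ab by (simp add: pos_rat_def)
  then show "q \<in> range pos_rat" by blast
qed

section \<open>Computable metric spaces\<close>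

definition computable_metric_space :: "(nat \<Rightarrow> 'a::metric_space) \<Rightarrow> bool" where
  "computable_metric_space s \<longleftrightarrow>
     closure (range s) = UNIV \<and>
     (\<exists>g. recursive_fn 3 g \<and>
       (\<forall>i j n. \<bar>real_of_rat (nat_to_rat_surj (g [i, j, n])) - dist (s i) (s j)\<bar> < (1/2) ^ n))"

text \<open>
  The distance and the ideal points are explicit parameters, since the notion is also applied
  to a space of measures and to \<open>L\<^sup>1\<close>.
\<close>

definition computable_point :: "('p \<Rightarrow> 'p \<Rightarrow> real) \<Rightarrow> (nat \<Rightarrow> 'p) \<Rightarrow> 'p \<Rightarrow> bool" where
  "computable_point d s x \<longleftrightarrow> (\<exists>g. recursive_fn 1 g \<and> (\<forall>n. d (s (g [n])) x \<le> (1/2) ^ n))"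

definition ideal_ball :: "(nat \<Rightarrow> 'a::metric_space) \<Rightarrow> nat \<Rightarrow> 'a set" where
  "ideal_ball s n = (case prod_decode n of (i, j) \<Rightarrow> ball (s i) (real_of_rat (pos_rat j)))"

text \<open>
  Enumerations may be empty or finite: output \<^term>\<open>0\<close> enumerates nothing, and output
  \<^term>\<open>Suc k\<close> enumerates the ideal ball with number \<^term>\<open>k\<close>.
\<close>

definition uniformly_effective_open :: "(nat \<Rightarrow> 'a::metric_space) \<Rightarrow> (nat \<Rightarrow> 'a set) \<Rightarrow> bool" where
  "uniformly_effective_open s U \<longleftrightarrow>
     (\<exists>e. recursive_fn 2 e \<and> (\<forall>i. U i = \<Union>{ideal_ball s k | k. \<exists>n. e [i, n] = Suc k}))"

definition effective_Gdelta :: "(nat \<Rightarrow> 'a::metric_space) \<Rightarrow> 'a set \<Rightarrow> bool" where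
  "effective_Gdelta s D \<longleftrightarrow> (\<exists>U. uniformly_effective_open s U \<and> D = (\<Inter>i. U i))"

definition computable_on ::
    "(nat \<Rightarrow> 'a::metric_space) \<Rightarrow> (nat \<Rightarrow> 'b::metric_space) \<Rightarrow> 'a set \<Rightarrow> ('a \<Rightarrow> 'b) \<Rightarrow> bool" where
  "computable_on sX sY D T \<longleftrightarrow>
     (\<exists>U. uniformly_effective_open sX U \<and> (\<forall>i. T -` ideal_ball sY i \<inter> D = U i \<inter> D))"

section \<open>Computable probability spaces\<close>

definition W1 :: "'a::metric_space measure \<Rightarrow> 'a measure \<Rightarrow> real" where
  "W1 \<mu>1 \<mu>2 = (SUP f\<in>{f. 1-lipschitz_on UNIV f}. \<bar>(\<integral>x. f x \<partial>\<mu>1) - (\<integral>x. f x \<partial>\<mu>2)\<bar>)"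

text \<open>
  A number is decoded to a nonempty list of pairs \<open>(i, w)\<close>; the coefficient of the Dirac measure
  at \<open>s i\<close> is \<open>w + 1\<close> divided by the sum of all the \<open>w + 1\<close>. Every rational convex combination
  with positive coefficients has this form.
\<close>

definition weighted_points :: "nat \<Rightarrow> (nat \<times> nat) list" where
  "weighted_points n = (case prod_decode n of (h, t) \<Rightarrow> map prod_decode (h # list_decode t))"

definition ideal_measure :: "(nat \<Rightarrow> 'a::metric_space) \<Rightarrow> nat \<Rightarrow> 'a measure" where
  "ideal_measure s n =
     (let ps = weighted_points n; total = (\<Sum>(i, w)\<leftarrow>ps. Suc w)
      in measure_of UNIV (sets borel)
           (\<lambda>A. \<Sum>(i, w)\<leftarrow>ps. ennreal (real (Suc w) / real total) * emeasure (return borel (s i)) A))"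

definition computable_measure :: "(nat \<Rightarrow> 'a::metric_space) \<Rightarrow> 'a measure \<Rightarrow> bool" where
  "computable_measure s \<mu> \<longleftrightarrow>
     bounded (UNIV :: 'a set) \<and> prob_space \<mu> \<and> sets \<mu> = sets borel \<and>
     computable_point W1 (ideal_measure s) \<mu>"

definition computable_probability_space :: "(nat \<Rightarrow> 'a::metric_space) \<Rightarrow> 'a measure \<Rightarrow> bool" where
  "computable_probability_space s \<mu> \<longleftrightarrow> computable_metric_space s \<and> computable_measure s \<mu>"

definition ae_computable ::
    "(nat \<Rightarrow> 'a::metric_space) \<Rightarrow> 'a measure \<Rightarrow> (nat \<Rightarrow> 'b::metric_space) \<Rightarrow> ('a \<Rightarrow> 'b) \<Rightarrow> bool" where
  "ae_computable sX \<mu> sY T \<longleftrightarrow>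
     (\<exists>D. effective_Gdelta sX D \<and> measure \<mu> D = 1 \<and> computable_on sX sY D T)"

section \<open>Measure-preserving and ergodic maps\<close>

definition measure_preserving :: "'a measure \<Rightarrow> ('a \<Rightarrow> 'a) \<Rightarrow> bool" where
  "measure_preserving \<mu> T \<longleftrightarrow> T \<in> measurable \<mu> \<mu> \<and> distr \<mu> \<mu> T = \<mu>"

definition ergodic :: "'a measure \<Rightarrow> ('a \<Rightarrow> 'a) \<Rightarrow> bool" where
  "ergodic \<mu> T \<longleftrightarrow> measure_preserving \<mu> T \<and>
     (\<forall>A\<in>sets \<mu>. T -` A \<inter> space \<mu> = A \<longrightarrow> measure \<mu> A = 0 \<or> measure \<mu> A = 1)"

section \<open>\<open>L\<^sup>1\<close>-computable functions\<close>

definition hat :: "'a::metric_space \<Rightarrow> real \<Rightarrow> real \<Rightarrow> 'a \<Rightarrow> real" where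
  "hat p r \<epsilon> x = max 0 (1 - max 0 (dist x p - r) / \<epsilon>)"

inductive_set ideal_funs :: "(nat \<Rightarrow> 'a::metric_space) \<Rightarrow> ('a \<Rightarrow> real) set"
  for s :: "nat \<Rightarrow> 'a" where
  one: "(\<lambda>_. 1) \<in> ideal_funs s"
| hat: "0 < \<epsilon> \<Longrightarrow> hat (s i) (real_of_rat r) (real_of_rat \<epsilon>) \<in> ideal_funs s"
| max: "u \<in> ideal_funs s \<Longrightarrow> v \<in> ideal_funs s \<Longrightarrow> (\<lambda>x. max (u x) (v x)) \<in> ideal_funs s"
| min: "u \<in> ideal_funs s \<Longrightarrow> v \<in> ideal_funs s \<Longrightarrow> (\<lambda>x. min (u x) (v x)) \<in> ideal_funs s"
| lin: "u \<in> ideal_funs s \<Longrightarrow> v \<in> ideal_funs s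
    \<Longrightarrow> (\<lambda>x. real_of_rat p * u x + real_of_rat q * v x) \<in> ideal_funs s"

text \<open>
  The effective numbering of \<^const>\<open>ideal_funs\<close>: \<^term>\<open>0\<close> codes the constant \<open>1\<close>, and
  \<^term>\<open>Suc (prod_encode (k, m))\<close> codes one of the other constructors, selected by \<^term>\<open>k\<close>, with
  arguments coded by \<^term>\<open>m\<close>.
\<close>

function ideal_fun :: "(nat \<Rightarrow> 'a::metric_space) \<Rightarrow> nat \<Rightarrow> 'a \<Rightarrow> real" where
  "ideal_fun s 0 = (\<lambda>_. 1)"
| "ideal_fun s (Suc n) =
     (let k = fst (prod_decode n); m = snd (prod_decode n);
          a = fst (prod_decode m); b = snd (prod_decode m)
      in if k = 0 then
           hat (s a) (real_of_rat (nat_to_rat_surj (fst (prod_decode b))))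
             (real_of_rat (pos_rat (snd (prod_decode b))))
         else if k = 1 then (\<lambda>x. max (ideal_fun s a x) (ideal_fun s b x))
         else if k = 2 then (\<lambda>x. min (ideal_fun s a x) (ideal_fun s b x))
         else
           (let p = fst (prod_decode a); u = snd (prod_decode a);
                q = fst (prod_decode b); v = snd (prod_decode b)
            in (\<lambda>x. real_of_rat (nat_to_rat_surj p) * ideal_fun s u x
                   + real_of_rat (nat_to_rat_surj q) * ideal_fun s v x)))"
  by pat_completeness auto

lemma fst_prod_decode_le: "fst (prod_decode n) \<le> n"
  by (metis le_prod_encode_1 prod.collapse prod_decode_inverse)

lemma snd_prod_decode_le: "snd (prod_decode n) \<le> n"
  by (metis le_prod_encode_2 prod.collapse prod_decode_inverse)

termination ideal_fun
  by (relation "inv_image less_than snd")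
     (auto simp: less_Suc_eq_le intro: order_trans[OF fst_prod_decode_le] 
        order_trans[OF snd_prod_decode_le] fst_prod_decode_le snd_prod_decode_le)

lemma ideal_fun_in: "ideal_fun s n \<in> ideal_funs s"
proof (induction s n rule: ideal_fun.induct)
  case (1 s)
  then show ?case by (simp add: ideal_funs.one)
next
  case (2 s n)
  have "0 < pos_rat j" for j using range_pos_rat by auto
  with 2 show ?case
    by (auto simp: Let_def intro!: ideal_funs.intros)
qed

lemma range_ideal_fun: "range (ideal_fun s) = ideal_funs s"
proof (intro subset_antisym subsetI)
  fix u assume "u \<in> ideal_funs s"
  then show "u \<in> range (ideal_fun s)"
  proof induction
    case one
    show ?case by (rule range_eqI[of _ _ 0]) simp
  next
    case (hat \<epsilon> i r)
    then obtain j where j: "\<epsilon> = pos_rat j" using range_pos_rat by auto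
    obtain l where l: "r = nat_to_rat_surj l" using surj_nat_to_rat_surj by auto
    show ?case
      by (rule range_eqI[of _ _ "Suc (prod_encode (0, prod_encode (i, prod_encode (l, j))))"])
        (simp add: j l)
  next
    case (max u v)
    then obtain a b where "u = ideal_fun s a" "v = ideal_fun s b" by auto
    then show ?case
      by (intro range_eqI[of _ _ "Suc (prod_encode (1, prod_encode (a, b)))"]) simp
  next
    case (min u v)
    then obtain a b where "u = ideal_fun s a" "v = ideal_fun s b" by auto
    then show ?case
      by (intro range_eqI[of _ _ "Suc (prod_encode (2, prod_encode (a, b)))"]) simp
  next
    case (lin u v p q)
    then obtain a b where "u = ideal_fun s a" "v = ideal_fun s b" by auto
    moreover obtain l m where "p = nat_to_rat_surj l" "q = nat_to_rat_surj m"
      using surj_nat_to_rat_surj by (metis surjD)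
    ultimately show ?case
      by (intro range_eqI[of _ _
            "Suc (prod_encode (3, prod_encode (prod_encode (l, a), prod_encode (m, b))))"]) simp
  qed
qed (use ideal_fun_in in auto)

text \<open>
  Extended-real-valued integrable functions are finite almost everywhere, so \<^term>\<open>real_of_ereal \<circ> f\<close>
  is a real-valued representative of the \<open>L\<^sup>1\<close> class of \<^term>\<open>f\<close> with the same integral.
\<close>

definition ereal_integrable :: "'a measure \<Rightarrow> ('a \<Rightarrow> ereal) \<Rightarrow> bool" where
  "ereal_integrable \<mu> f \<longleftrightarrow> f \<in> borel_measurable \<mu> \<and> (\<integral>\<^sup>+x. e2ennreal \<bar>f x\<bar> \<partial>\<mu>) < \<infinity>"

definition ereal_integral :: "'a measure \<Rightarrow> ('a \<Rightarrow> ereal) \<Rightarrow> real" where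
  "ereal_integral \<mu> f = (\<integral>x. real_of_ereal (f x) \<partial>\<mu>)"

definition L1_dist :: "'a measure \<Rightarrow> ('a \<Rightarrow> real) \<Rightarrow> ('a \<Rightarrow> real) \<Rightarrow> real" where
  "L1_dist \<mu> u v = (\<integral>x. \<bar>u x - v x\<bar> \<partial>\<mu>)"

definition L1_computable ::
    "(nat \<Rightarrow> 'a::metric_space) \<Rightarrow> 'a measure \<Rightarrow> ('a \<Rightarrow> ereal) \<Rightarrow> bool" where
  "L1_computable s \<mu> f \<longleftrightarrow>
     ereal_integrable \<mu> f \<and>
     computable_point (L1_dist \<mu>) (ideal_fun s) (\<lambda>x. real_of_ereal (f x))"

section \<open>Effective convergence\<close>

definition computable_rate :: "(rat \<Rightarrow> rat \<Rightarrow> nat) \<Rightarrow> bool" where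
  "computable_rate N \<longleftrightarrow> (\<exists>g. recursive_fn 2 g \<and> (\<forall>i j. N (pos_rat i) (pos_rat j) = g [i, j]))"

definition effectively_converges_in_probability ::
    "'a measure \<Rightarrow> (nat \<Rightarrow> 'a \<Rightarrow> ereal) \<Rightarrow> ('a \<Rightarrow> ereal) \<Rightarrow> bool" where
  "effectively_converges_in_probability \<mu> F f \<longleftrightarrow>
     (\<forall>n. F n \<in> borel_measurable \<mu>) \<and> f \<in> borel_measurable \<mu> \<and>
     (\<exists>N. computable_rate N \<and>
       (\<forall>\<epsilon>>0. \<forall>\<delta>>0. \<forall>n\<ge>N \<epsilon> \<delta>.
          measure \<mu> {x \<in> space \<mu>. \<bar>F n x - f x\<bar> \<ge> ereal (real_of_rat \<epsilon>)} < real_of_rat \<delta>))"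

definition effectively_converges_almost_surely ::
    "'a measure \<Rightarrow> (nat \<Rightarrow> 'a \<Rightarrow> ereal) \<Rightarrow> ('a \<Rightarrow> ereal) \<Rightarrow> bool" where
  "effectively_converges_almost_surely \<mu> F f \<longleftrightarrow>
     (\<forall>n. F n \<in> borel_measurable \<mu>) \<and> f \<in> borel_measurable \<mu> \<and>
     effectively_converges_in_probability \<mu> (\<lambda>n x. SUP k\<in>{n..}. \<bar>F k x - f x\<bar>) (\<lambda>_. 0)"

text \<open>
  The average for \<^term>\<open>n = 0\<close> is \<open>0 / 0 = 0\<close>; it does not affect effective convergence, because a
  rate can always be increased so as to be at least \<open>1\<close>.
\<close>

definition ergodic_average :: "('a \<Rightarrow> 'a) \<Rightarrow> ('a \<Rightarrow> ereal) \<Rightarrow> nat \<Rightarrow> 'a \<Rightarrow> ereal" where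
  "ergodic_average T f n x = (\<Sum>i<n. f ((T ^^ i) x)) / ereal (real n)"

end

theory Submission
  imports Defs
begin

text \<open>
  Let \<open>u\<close> be a bounded function close to \<open>f\<close> in the mean, and suppose that for one length \<open>p\<close> the average
  \<open>A\<^sub>p u\<close> is close in the mean to a constant \<open>q\<close>. Then
  \<open>f = (f - u) + (A\<^sub>p u - q) + (u - A\<^sub>p u) + q\<close>. The first two summands are small in the mean, so by the
  maximal ergodic inequality all their averages are uniformly small outside a small set. The averages
  of length \<open>n\<close> of \<open>u - A\<^sub>p u\<close> telescope and are at most \<open>2 * p * C / n\<close> if \<open>\<bar>u\<bar> \<le> C\<close>. Hence all long averages
  of \<open>f\<close> are near one constant outside a small set, and every quantity in this statement is explicit.
  This is the lemma \<open>deviation_bound\<close>. A rate of convergence is computable as soon as a suitable \<open>p\<close> can be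
  found by a search, and for this the smallness of \<open>A\<^sub>p u - q\<close> in the mean must be recognized effectively.
  That some \<open>p\<close> is suitable follows from Birkhoff's theorem, for which ergodicity is needed
  (\<open>L1_birkhoff_tendsto\<close>).

  For the recognition it is enough to approximate the Birkhoff sums of an ideal function \<open>u \<ge> 0\<close> by
  ideal functions from below. If \<open>w\<close> is an ideal function below the Birkhoff sum of length \<open>p\<close>, its distance
  from that sum in the mean is \<open>p * \<integral>u - \<integral>w\<close>, because \<open>T\<close> preserves the measure. This is a number
  computed from integrals of ideal functions, and these integrals are computable because ideal
  functions are Lipschitz and the measure is a limit of ideal measures (\<open>approx_integral\<close>). Lower
  approximations are obtained step by step: the sum of length \<open>p + 1\<close> is \<open>u\<close> plus the composition with \<open>T\<close> of
  the sum of length \<open>p\<close>. A multiple \<open>c\<close> of a hat lies below \<open>w \<circ> T\<close> if the hat lives inside a ball enumerated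
  in the preimage of another ball, on which \<open>w \<ge> c\<close>. These conditions are decidable for the given codes
  (\<open>ent_code_le\<close>), and the supremum of all such functions is \<open>w \<circ> T\<close> almost everywhere
  (\<open>ent_code_dense\<close>). So the possible lower approximations are enumerated by programs which are correct
  by construction (\<open>sound_run\<close>) and arbitrarily good (\<open>program_approximates\<close>), and the algorithm searches for
  a program, a rational and a precision which together certify the hypothesis of the deviation bound
  (\<open>acceptable_rate\<close>, \<open>acceptable_exists\<close>).
\<close>

section \<open>Recursive functions of coded arguments\<close>

text \<open>
  Recursive functions are only of interest on argument lists of the right length, so a function is
  considered up to its values on other lists. This makes the class closed under extensional equality.
\<close>

definition recursive_at :: "nat \<Rightarrow> (nat list \<Rightarrow> nat) \<Rightarrow> bool" where
  "recursive_at k F \<longleftrightarrow> (\<exists>f. recursive_fn k f \<and> (\<forall>xs. length xs = k \<longrightarrow> f xs = F xs))"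

lemma recursive_at_cong:
  "(\<And>xs. length xs = k \<Longrightarrow> F xs = G xs) \<Longrightarrow> recursive_at k F \<longleftrightarrow> recursive_at k G"
  by (simp add: recursive_at_def)

lemma recursive_at_zero: "recursive_at k (\<lambda>_. 0)"
  using recursive_fn.zero recursive_at_def by blast

lemma recursive_at_proj: "i < k \<Longrightarrow> recursive_at k (\<lambda>xs. xs ! i)"
  using recursive_fn.proj recursive_at_def by blast

lemma recursive_at_comp:
  assumes "recursive_at (length Gs) H" "\<And>G. G \<in> set Gs \<Longrightarrow> recursive_at k G"
  shows "recursive_at k (\<lambda>xs. H (map (\<lambda>G. G xs) Gs))"
proof -
  obtain h where h: "recursive_fn (length Gs) h" "\<And>xs. length xs = length Gs \<Longrightarrow> h xs = H xs"
    using assms(1) by (auto simp: recursive_at_def)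
  have "\<exists>g. \<forall>G\<in>set Gs. recursive_fn k (g G) \<and> (\<forall>xs. length xs = k \<longrightarrow> g G xs = G xs)"
    using assms(2) by (intro bchoice) (auto simp: recursive_at_def)
  then obtain g where g: "\<And>G. G \<in> set Gs \<Longrightarrow> recursive_fn k (g G)"
      "\<And>G xs. G \<in> set Gs \<Longrightarrow> length xs = k \<Longrightarrow> g G xs = G xs" by blast
  have "recursive_fn k (\<lambda>xs. h (map (\<lambda>G. G xs) (map g Gs)))"
    using h(1) g(1) by (intro recursive_fn.comp) auto
  moreover have "h (map (\<lambda>G. G xs) (map g Gs)) = H (map (\<lambda>G. G xs) Gs)" if "length xs = k" for xs
    using that h(2) g(2) by (auto simp: comp_def intro!: arg_cong[where f = H])
  ultimately show ?thesis unfolding recursive_at_def by blast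
qed

lemma recursive_at_prim_rec:
  assumes "recursive_at k A" "recursive_at (Suc (Suc k)) B"
  shows "recursive_at (Suc k) (\<lambda>xs. rec_nat (A (tl xs)) (\<lambda>n r. B (n # r # tl xs)) (hd xs))"
proof -
  obtain a where a: "recursive_fn k a" "\<And>xs. length xs = k \<Longrightarrow> a xs = A xs"
    using assms(1) by (auto simp: recursive_at_def)
  obtain b where b: "recursive_fn (Suc (Suc k)) b" "\<And>xs. length xs = Suc (Suc k) \<Longrightarrow> b xs = B xs"
    using assms(2) by (auto simp: recursive_at_def)
  show ?thesis
    unfolding recursive_at_def
    by (intro exI conjI, rule recursive_fn.prec[OF a(1) b(1)]) (simp add: a(2) b(2))
qed

lemma recursive_at_Least:
  assumes "recursive_at (Suc k) F" "\<And>xs. length xs = k \<Longrightarrow> \<exists>n. F (n # xs) = 0"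
  shows "recursive_at k (\<lambda>xs. LEAST n. F (n # xs) = 0)"
proof -
  obtain f where f: "recursive_fn (Suc k) f" "\<And>xs. length xs = Suc k \<Longrightarrow> f xs = F xs"
    using assms(1) by (auto simp: recursive_at_def)
  have "recursive_fn k (\<lambda>xs. LEAST n. f (n # xs) = 0)"
    using assms(2) f by (intro recursive_fn.mini) auto
  then show ?thesis
    unfolding recursive_at_def by (intro exI conjI, assumption) (simp add: f(2))
qed

text \<open>
  Arguments are tupled into one number by the pairing function, so that closure properties can be
  stated for functions of one variable and used as introduction rules.
\<close>

definition total_recursive :: "(nat \<Rightarrow> nat) \<Rightarrow> bool" where
  "total_recursive F \<longleftrightarrow> recursive_at 1 (\<lambda>xs. F (xs ! 0))"

lemma recursive_at_apply1:
  assumes "total_recursive F" "recursive_at k G"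
  shows "recursive_at k (\<lambda>xs. F (G xs))"
  using recursive_at_comp[of "[G]" "\<lambda>xs. F (xs ! 0)" k] assms by (simp add: total_recursive_def)

lemma recursive_at_apply2:
  assumes "recursive_at 2 (\<lambda>xs. H (xs ! 0) (xs ! 1))" "recursive_at k F" "recursive_at k G"
  shows "recursive_at k (\<lambda>xs. H (F xs) (G xs))"
  using recursive_at_comp[of "[F, G]" "\<lambda>xs. H (xs ! 0) (xs ! 1)" k] assms
  by (auto simp: numeral_2_eq_2)

lemma total_recursive_apply2:
  assumes "recursive_at 2 (\<lambda>xs. H (xs ! 0) (xs ! 1))" "total_recursive F" "total_recursive G"
  shows "total_recursive (\<lambda>x. H (F x) (G x))"
  using recursive_at_apply2[OF assms(1)] assms(2,3) by (simp add: total_recursive_def)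

named_theorems recursive_intros

lemma total_recursive_comp: "total_recursive F \<Longrightarrow> total_recursive G \<Longrightarrow> total_recursive (\<lambda>x. F (G x))"
  using recursive_at_apply1[of F 1 "\<lambda>xs. G (xs ! 0)"] by (simp add: total_recursive_def)

lemma total_recursive_id [recursive_intros]: "total_recursive (\<lambda>x. x)"
  unfolding total_recursive_def by (rule recursive_at_proj) simp

lemma total_recursive_basic_Suc: "total_recursive Suc"
  unfolding total_recursive_def recursive_at_def using recursive_fn.succ by auto

lemmas total_recursive_Suc [recursive_intros] = total_recursive_comp[OF total_recursive_basic_Suc]

lemma recursive_at_const: "recursive_at k (\<lambda>_. c)"
proof (induction c)
  case (Suc c)
  show ?case by (rule recursive_at_apply1[OF total_recursive_basic_Suc Suc])
qed (rule recursive_at_zero)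

lemma total_recursive_const [recursive_intros]: "total_recursive (\<lambda>_. c)"
  unfolding total_recursive_def by (rule recursive_at_const)

lemma hd_tl_nth: "length xs = Suc k \<Longrightarrow> hd xs = xs ! 0 \<and> tl xs ! i = xs ! Suc i"
  by (cases xs) auto

lemma recursive_at_add: "recursive_at 2 (\<lambda>xs. xs ! 0 + xs ! 1)"
proof -
  have "recursive_at (Suc 1) (\<lambda>xs. rec_nat (tl xs ! 0) (\<lambda>n r. Suc ((n # r # tl xs) ! 1)) (hd xs))"
    by (intro recursive_at_prim_rec recursive_at_proj recursive_at_apply1[OF total_recursive_basic_Suc]) auto
  moreover have "rec_nat a (\<lambda>n r. Suc r) n = n + a" for a n :: nat by (induction n) auto
  ultimately show ?thesis
    by (subst recursive_at_cong) (auto simp: hd_tl_nth numeral_2_eq_2)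
qed

lemmas total_recursive_add [recursive_intros] = total_recursive_apply2[OF recursive_at_add]

lemma recursive_at_mult: "recursive_at 2 (\<lambda>xs. xs ! 0 * xs ! 1)"
proof -
  have "recursive_at (Suc 1) (\<lambda>xs. rec_nat 0
      (\<lambda>n r. (n # r # tl xs) ! 1 + (n # r # tl xs) ! 2) (hd xs))"
    by (intro recursive_at_prim_rec[where A = "\<lambda>_. 0"] recursive_at_zero recursive_at_proj
          recursive_at_apply2[OF recursive_at_add]) auto
  moreover have "rec_nat 0 (\<lambda>n r. r + a) n = n * a" for a n :: nat by (induction n) auto
  ultimately show ?thesis
    by (subst recursive_at_cong) (auto simp: hd_tl_nth numeral_2_eq_2)
qed

lemmas total_recursive_mult [recursive_intros] = total_recursive_apply2[OF recursive_at_mult]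

lemma total_recursive_basic_pred: "total_recursive (\<lambda>n. n - 1)"
proof -
  have "recursive_at (Suc 0) (\<lambda>xs. rec_nat 0 (\<lambda>n r. (n # r # tl xs) ! 0) (hd xs))"
    by (intro recursive_at_prim_rec[where A = "\<lambda>_. 0"] recursive_at_zero recursive_at_proj) auto
  moreover have "rec_nat 0 (\<lambda>n r. n) n = n - 1" for n :: nat by (cases n) auto
  ultimately show ?thesis
    unfolding total_recursive_def by (subst recursive_at_cong) (auto simp: hd_tl_nth)
qed

lemma recursive_at_diff: "recursive_at 2 (\<lambda>xs. xs ! 0 - xs ! 1)"
proof -
  have "recursive_at (Suc 1) (\<lambda>xs. rec_nat (tl xs ! 0) (\<lambda>n r. (n # r # tl xs) ! 1 - 1) (hd xs))"
    by (intro recursive_at_prim_rec recursive_at_proj recursive_at_apply1[OF total_recursive_basic_pred]) auto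
  moreover have "rec_nat a (\<lambda>n r. r - Suc 0) n = a - n" for a n :: nat by (induction n) auto
  ultimately have "recursive_at 2 (\<lambda>xs. xs ! 1 - xs ! 0)"
    by (subst recursive_at_cong) (auto simp: hd_tl_nth numeral_2_eq_2)
  then show ?thesis
    by (rule recursive_at_apply2[where H = "\<lambda>x y. y - x"]) (intro recursive_at_proj; simp)+
qed

lemmas total_recursive_diff [recursive_intros] = total_recursive_apply2[OF recursive_at_diff]

subsection \<open>Pairs\<close>

abbreviation pair :: "nat \<Rightarrow> nat \<Rightarrow> nat" where "pair a b \<equiv> prod_encode (a, b)"
abbreviation pfst :: "nat \<Rightarrow> nat" where "pfst z \<equiv> fst (prod_decode z)"
abbreviation psnd :: "nat \<Rightarrow> nat" where "psnd z \<equiv> snd (prod_decode z)"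

lemma total_recursive_basic_triangle: "total_recursive triangle"
proof -
  have "recursive_at (Suc 0)
      (\<lambda>xs. rec_nat 0 (\<lambda>n r. (n # r # tl xs) ! 1 + Suc ((n # r # tl xs) ! 0)) (hd xs))"
    by (intro recursive_at_prim_rec[where A = "\<lambda>_. 0"] recursive_at_zero recursive_at_proj
        recursive_at_apply1[OF total_recursive_basic_Suc] recursive_at_apply2[OF recursive_at_add]) auto
  moreover have "rec_nat 0 (\<lambda>n r. Suc (r + n)) n = triangle n" for n :: nat by (induction n) auto
  ultimately show ?thesis
    unfolding total_recursive_def by (subst recursive_at_cong) (auto simp: hd_tl_nth)
qed

lemmas total_recursive_triangle = total_recursive_comp[OF total_recursive_basic_triangle]

lemma total_recursive_pair [recursive_intros]:
  "total_recursive F \<Longrightarrow> total_recursive G \<Longrightarrow> total_recursive (\<lambda>x. pair (F x) (G x))"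
  by (simp add: prod_encode_def) (intro recursive_intros total_recursive_triangle)

lemma triangle_mono: "m \<le> n \<Longrightarrow> triangle m \<le> triangle n"
  by (induction rule: dec_induct) auto

text \<open>
  The pairing of \<open>a\<close> and \<open>b\<close> is the triangular number of \<open>a + b\<close> plus \<open>a\<close>, and \<open>a\<close> is too small to
  reach the next triangular number. Hence the sum of the components can be found by minimisation,
  and both components from the sum.
\<close>

lemma Least_triangle: "(LEAST s. z < triangle (Suc s)) = pfst z + psnd z"
proof -
  obtain a b where ab: "prod_decode z = (a, b)" by (cases "prod_decode z")
  have "prod_encode (a, b) = z" unfolding ab[symmetric] by simp
  then have z: "z = triangle (a + b) + a" by (simp add: prod_encode_def)
  have "(LEAST s. z < triangle (Suc s)) = a + b"
  proof (rule Least_equality)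
    fix s assume "z < triangle (Suc s)"
    moreover have "triangle (Suc s) \<le> z" if "s < a + b"
      using triangle_mono[of "Suc s" "a + b"] that z by simp
    ultimately show "a + b \<le> s" by force
  qed (simp add: z)
  with ab show ?thesis by simp
qed

lemma total_recursive_basic_psum: "total_recursive (\<lambda>z. pfst z + psnd z)"
proof -
  have "recursive_at 1 (\<lambda>xs. LEAST n. Suc ((n # xs) ! 1) - triangle (Suc ((n # xs) ! 0)) = 0)"
  proof (rule recursive_at_Least)
    fix xs :: "nat list"
    have "n \<le> triangle n" for n by (induction n) auto
    then show "\<exists>n. Suc ((n # xs) ! 1) - triangle (Suc ((n # xs) ! 0)) = 0"
      by (intro exI[of _ "xs ! 0"]) (auto intro: trans_le_add1)
  qed (intro recursive_at_proj recursive_at_apply1[OF total_recursive_basic_Suc]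
      recursive_at_apply1[OF total_recursive_basic_triangle] recursive_at_apply2[OF recursive_at_diff]; simp)
  moreover have "(LEAST n. Suc ((n # xs) ! 1) - triangle (Suc ((n # xs) ! 0)) = 0) = pfst (xs ! 0) + psnd (xs ! 0)"
    for xs
    using Least_triangle[of "xs ! 0"] by (simp only: diff_is_0_eq Suc_le_eq nth_Cons_0 One_nat_def nth_Cons_Suc)
  ultimately show ?thesis
    unfolding total_recursive_def by (simp only:)
qed

lemma total_recursive_basic_pfst: "total_recursive pfst"
proof -
  have "pfst z = z - triangle (pfst z + psnd z)" for z
  proof -
    have "z = triangle (pfst z + psnd z) + pfst z"
      using prod_decode_inverse[of z] by (simp add: prod_encode_def split_beta del: prod_decode_inverse)
    then show ?thesis by linarith
  qed
  moreover have "total_recursive (\<lambda>z. z - triangle (pfst z + psnd z))"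
    by (intro recursive_intros total_recursive_triangle total_recursive_basic_psum)
  ultimately show ?thesis by presburger
qed

lemmas total_recursive_pfst [recursive_intros] = total_recursive_comp[OF total_recursive_basic_pfst]

lemma total_recursive_basic_psnd: "total_recursive psnd"
proof -
  have "psnd z = (pfst z + psnd z) - pfst z" for z by simp
  moreover have "total_recursive (\<lambda>z. (pfst z + psnd z) - pfst z)"
    by (intro recursive_intros total_recursive_basic_psum)
  ultimately show ?thesis by presburger
qed

lemmas total_recursive_psnd [recursive_intros] = total_recursive_comp[OF total_recursive_basic_psnd]

lemma total_recursive_of_at2:
  assumes "recursive_at 2 g" "total_recursive F" "total_recursive G"
  shows "total_recursive (\<lambda>x. g [F x, G x])"
proof -
  have "recursive_at 2 (\<lambda>xs. g [xs ! 0, xs ! 1])"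
    using assms(1) by (subst recursive_at_cong[of 2 _ g])
      (auto simp: numeral_2_eq_2 length_Suc_conv)
  then show ?thesis by (rule total_recursive_apply2) fact+
qed

lemma total_recursive_of_at3:
  assumes "recursive_at 3 g" "total_recursive F" "total_recursive G" "total_recursive H"
  shows "total_recursive (\<lambda>x. g [F x, G x, H x])"
  using recursive_at_comp[of "[\<lambda>xs. F (xs ! 0), \<lambda>xs. G (xs ! 0), \<lambda>xs. H (xs ! 0)]" g 1] assms
  by (auto simp: total_recursive_def numeral_3_eq_3)

lemma recursive_at_uncurry2:
  assumes "total_recursive (\<lambda>z. F (pfst z) (psnd z))"
  shows "recursive_at 2 (\<lambda>xs. F (xs ! 0) (xs ! 1))"
proof -
  have "recursive_at 2 (\<lambda>xs. pair (xs ! 0) (xs ! 1))"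
    by (simp add: prod_encode_def) (intro recursive_at_apply2[OF recursive_at_add]
        recursive_at_apply1[OF total_recursive_basic_triangle] recursive_at_proj; simp)
  from recursive_at_apply1[OF assms this] show ?thesis by simp
qed

lemma total_recursive_rec_nat:
  assumes "total_recursive (\<lambda>z. B (pfst z) (pfst (psnd z)) (psnd (psnd z)))"
    and A: "total_recursive A" and N: "total_recursive N"
  shows "total_recursive (\<lambda>x. rec_nat (A x) (B x) (N x))"
proof -
  have pair: "recursive_at 3 (\<lambda>xs. pair (F xs) (G xs))"
    if "recursive_at 3 F" "recursive_at 3 G" for F G
    by (simp add: prod_encode_def) (intro recursive_at_apply2[OF recursive_at_add]
        recursive_at_apply1[OF total_recursive_basic_triangle] that; simp)
  have "recursive_at 3 (\<lambda>xs. pair (xs ! 2) (pair (xs ! 0) (xs ! 1)))"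
    by (intro pair recursive_at_proj) simp_all
  from recursive_at_apply1[OF assms(1) this]
  have B: "recursive_at (Suc (Suc 1)) (\<lambda>xs. B (xs ! 2) (xs ! 0) (xs ! 1))" by (simp add: numeral_3_eq_3)
  have "recursive_at (Suc 1) (\<lambda>xs. rec_nat (A (tl xs ! 0))
      (\<lambda>n r. B ((n # r # tl xs) ! 2) ((n # r # tl xs) ! 0) ((n # r # tl xs) ! 1)) (hd xs))"
    using A B by (intro recursive_at_prim_rec) (auto simp: total_recursive_def)
  then have "recursive_at 2 (\<lambda>xs. rec_nat (A (xs ! 1)) (B (xs ! 1)) (xs ! 0))"
    by (subst recursive_at_cong) (auto simp: hd_tl_nth numeral_2_eq_2)
  then show ?thesis
    by (rule total_recursive_apply2[where H = "\<lambda>n x. rec_nat (A x) (B x) n"]) (intro recursive_intros N)+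
qed

subsection \<open>Decidable predicates\<close>

definition decidable :: "(nat \<Rightarrow> bool) \<Rightarrow> bool" where
  "decidable P \<longleftrightarrow> total_recursive (\<lambda>x. of_bool (P x))"

lemma decidable_le [recursive_intros]:
  assumes "total_recursive F" "total_recursive G"
  shows "decidable (\<lambda>x. F x \<le> G x)"
proof -
  have "total_recursive (\<lambda>x. 1 - (F x - G x))" by (intro recursive_intros assms)
  moreover have "1 - (F x - G x) = of_bool (F x \<le> G x)" for x by simp
  ultimately show ?thesis by (simp add: decidable_def)
qed

lemma decidable_less [recursive_intros]:
  "total_recursive F \<Longrightarrow> total_recursive G \<Longrightarrow> decidable (\<lambda>x. F x < G x)"
  unfolding Suc_le_eq[symmetric] by (intro recursive_intros)

lemma decidable_conj [recursive_intros]: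
  "decidable P \<Longrightarrow> decidable Q \<Longrightarrow> decidable (\<lambda>x. P x \<and> Q x)"
  unfolding decidable_def of_bool_conj by (intro recursive_intros)

lemma decidable_eq [recursive_intros]:
  "total_recursive F \<Longrightarrow> total_recursive G \<Longrightarrow> decidable (\<lambda>x. F x = G x)"
  unfolding eq_iff by (intro recursive_intros)

lemma decidable_not [recursive_intros]:
  assumes "decidable P" shows "decidable (\<lambda>x. \<not> P x)"
proof -
  have "total_recursive (\<lambda>x. 1 - of_bool (P x))"
    by (intro recursive_intros) (use assms in \<open>simp add: decidable_def\<close>)
  moreover have "1 - of_bool (P x) = (of_bool (\<not> P x) :: nat)" for x by simp
  ultimately show ?thesis by (simp add: decidable_def del: of_bool_not_iff)
qed

lemma total_recursive_if [recursive_intros]: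
  assumes "decidable P" "total_recursive F" "total_recursive G"
  shows "total_recursive (\<lambda>x. if P x then F x else G x)"
proof -
  have "total_recursive (\<lambda>x. of_bool (P x) * F x + (1 - of_bool (P x)) * G x)"
    by (intro recursive_intros assms) (use assms in \<open>simp_all add: decidable_def\<close>)
  moreover have "of_bool (P x) * F x + (1 - of_bool (P x)) * G x = (if P x then F x else G x)" for x
    by simp
  ultimately show ?thesis by simp
qed

lemma total_recursive_Least:
  assumes P: "decidable (\<lambda>z. P (pfst z) (psnd z))" and ex: "\<And>x. \<exists>n. P x n"
  shows "total_recursive (\<lambda>x. LEAST n. P x n)"
proof -
  have "total_recursive (\<lambda>z. of_bool (\<not> P (pfst z) (psnd z)))"
    using decidable_not[OF P] by (simp only: decidable_def)
  from recursive_at_uncurry2[of "\<lambda>x n. of_bool (\<not> P x n)", OF this]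
  have "recursive_at 2 (\<lambda>xs. of_bool (\<not> P (xs ! 1) (xs ! 0)))"
    by (rule recursive_at_apply2) (intro recursive_at_proj; simp)+
  then have "recursive_at (Suc 1) (\<lambda>xs. of_bool (\<not> P (xs ! 1) (xs ! 0)))"
    by (simp add: numeral_2_eq_2)
  from recursive_at_Least[OF this] ex show ?thesis
    by (simp add: total_recursive_def)
qed

lemma total_recursive_basic_mod2: "total_recursive (\<lambda>n. n mod 2)"
proof -
  have "total_recursive (\<lambda>x. rec_nat 0 (\<lambda>n r. 1 - r) x)"
    by (intro total_recursive_rec_nat recursive_intros)
  moreover have "rec_nat 0 (\<lambda>n r. 1 - r) x = x mod 2" for x :: nat by (induction x) (simp_all, presburger)
  ultimately show ?thesis by simp
qed

lemmas total_recursive_mod2 [recursive_intros] = total_recursive_comp[OF total_recursive_basic_mod2]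

lemma total_recursive_basic_div2: "total_recursive (\<lambda>n. n div 2)"
proof -
  have "total_recursive (\<lambda>x. rec_nat 0 (\<lambda>n r. r + n mod 2) x)"
    by (intro total_recursive_rec_nat recursive_intros)
  moreover have "rec_nat 0 (\<lambda>n r. r + n mod 2) x = x div 2" for x :: nat by (induction x) (auto; presburger)+
  ultimately show ?thesis by simp
qed

lemmas total_recursive_div2 [recursive_intros] = total_recursive_comp[OF total_recursive_basic_div2]

lemma total_recursive_basic_two_power: "total_recursive (\<lambda>n. 2 ^ n)"
proof -
  have "total_recursive (\<lambda>x. rec_nat 1 (\<lambda>n r. r + r) x)"
    by (intro total_recursive_rec_nat recursive_intros)
  moreover have "rec_nat 1 (\<lambda>n r. r + r) x = (2 :: nat) ^ x" for x by (induction x) auto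
  ultimately show ?thesis by simp
qed

lemmas total_recursive_two_power [recursive_intros] = total_recursive_comp[OF total_recursive_basic_two_power]

subsection \<open>Recursion on smaller codes\<close>

text \<open>
  Codes of syntax trees and of lists contain the codes of their constituents as arbitrary smaller
  numbers, so that recursion along a code consults any earlier values. The values below \<^term>\<open>n\<close>
  are kept in a table, the number \<open>pair v (pair v' \<dots>)\<close>, most recent value first, and this turns
  such a recursion into a primitive one. The values may be coded: \<^term>\<open>\<delta>\<close> decodes them.
\<close>

definition lookup :: "nat \<Rightarrow> nat \<Rightarrow> nat \<Rightarrow> nat" where
  "lookup t n m = pfst ((psnd ^^ (n - Suc m)) t)"

lemma total_recursive_lookup [recursive_intros]:
  assumes "total_recursive t" "total_recursive n" "total_recursive m"
  shows "total_recursive (\<lambda>x. lookup (t x) (n x) (m x))"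
proof -
  have "total_recursive (\<lambda>x. pfst (rec_nat (t x) (\<lambda>_ r. psnd r) (n x - Suc (m x))))"
    by (intro recursive_intros total_recursive_rec_nat assms)
  moreover have "rec_nat t (\<lambda>_ r. psnd r) k = (psnd ^^ k) t" for t k by (induction k) auto
  ultimately show ?thesis by (simp add: lookup_def)
qed

text \<open>
  Natural, rational and list-coded values are treated alike: a function into a type with decoder
  \<open>\<delta>\<close> is computed by a recursive function that delivers codes of its values.
\<close>

definition computes :: "(nat \<Rightarrow> 'v) \<Rightarrow> (nat \<Rightarrow> 'v) \<Rightarrow> bool" where
  "computes \<delta> F \<longleftrightarrow> (\<exists>g. total_recursive g \<and> (\<forall>x. F x = \<delta> (g x)))"

lemma computes_comp: "computes \<delta> F \<Longrightarrow> total_recursive G \<Longrightarrow> computes \<delta> (\<lambda>x. F (G x))"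
  unfolding computes_def using total_recursive_comp by fast

text \<open>
  The body \<open>B\<close> of the recursion receives the table of the codes of the values at all arguments below
  \<open>n\<close>. The table itself arises by primitive recursion, and by induction it contains the right values.
\<close>

lemma computes_course_of_values:
  assumes B: "computes \<delta> (\<lambda>z. B (pfst z) (pfst (psnd z)) (psnd (psnd z)))"
    and F: "\<And>c n t. (\<And>m. m < n \<Longrightarrow> \<delta> (lookup t n m) = F c m) \<Longrightarrow> B c n t = F c n"
    and C: "total_recursive C" and N: "total_recursive N"
  shows "computes \<delta> (\<lambda>x. F (C x) (N x))"
proof -
  obtain g where g: "total_recursive g"
    "\<And>z. B (pfst z) (pfst (psnd z)) (psnd (psnd z)) = \<delta> (g z)" using B by (auto simp: computes_def)
  define \<beta> where "\<beta> c n t = g (pair c (pair n t))" for c n t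
  have \<beta>: "\<delta> (\<beta> c n t) = B c n t" for c n t
    using g(2)[of "pair c (pair n t)"] by (simp add: \<beta>_def)
  define tab where "tab c = rec_nat 0 (\<lambda>n t. pair (\<beta> c n t) t)" for c
  have tab: "(psnd ^^ k) (tab c (k + n)) = tab c n" for c n k
    by (induction k) (simp_all add: tab_def funpow_Suc_right del: funpow.simps)
  have look: "lookup (tab c n) n m = \<beta> c m (tab c m)" if "m < n" for c n m
  proof -
    have "(psnd ^^ (n - Suc m)) (tab c n) = tab c (Suc m)"
      using tab[of "n - Suc m" c "Suc m"] that by simp
    then show ?thesis by (simp add: lookup_def tab_def)
  qed
  have main: "\<delta> (\<beta> c n (tab c n)) = F c n" for c n
  proof (induction n rule: less_induct)
    case (less n)
    then show ?case by (simp add: \<beta>) (rule F, simp add: look less)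
  qed
  have \<beta>_rec: "total_recursive (\<lambda>x. \<beta> (a x) (b x) (d x))"
    if "total_recursive a" "total_recursive b" "total_recursive d" for a b d
    unfolding \<beta>_def by (intro total_recursive_comp[OF g(1)] recursive_intros that)
  have "total_recursive (\<lambda>x. \<beta> (C x) (N x) (tab (C x) (N x)))"
    unfolding tab_def by (intro \<beta>_rec total_recursive_rec_nat recursive_intros total_recursive_comp[OF C] C N)
  then show ?thesis unfolding computes_def using main by fastforce
qed

lemma total_recursive_iff_computes: "total_recursive F \<longleftrightarrow> computes (\<lambda>x. x) F"
proof
  assume "computes (\<lambda>x. x) F"
  then obtain g where "total_recursive g" "\<And>x. F x = g x" by (auto simp: computes_def)
  then show "total_recursive F" by (metis ext)
qed (auto simp: computes_def)

subsection \<open>Rational-valued functions\<close>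

text \<open>
  A difference of natural numbers over a positive one: with this representation the field operations
  and the comparisons are polynomials and comparisons of natural numbers, without normal forms.
\<close>

definition fraction :: "nat \<Rightarrow> real" where
  "fraction z = (real (pfst z) - real (pfst (psnd z))) / real (Suc (psnd (psnd z)))"

abbreviation rat_recursive :: "(nat \<Rightarrow> real) \<Rightarrow> bool" where "rat_recursive \<equiv> computes fraction"

lemma rat_recursiveI:
  assumes "total_recursive a" "total_recursive b" "total_recursive c"
    "\<And>x. F x = (real (a x) - real (b x)) / real (Suc (c x))"
  shows "rat_recursive F"
  unfolding computes_def
  by (rule exI[of _ "\<lambda>x. pair (a x) (pair (b x) (c x))"])
    (auto simp: fraction_def assms(4) intro!: recursive_intros assms(1-3))

lemma rat_recursiveE:
  assumes "rat_recursive F"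
  obtains a b c where "total_recursive a" "total_recursive b" "total_recursive c"
    "\<And>x. F x = (real (a x) - real (b x)) / real (Suc (c x))"
proof -
  obtain g where g: "total_recursive g" "\<And>x. F x = fraction (g x)"
    using assms by (auto simp: computes_def)
  show ?thesis
    by (rule that[of "\<lambda>x. pfst (g x)" "\<lambda>x. pfst (psnd (g x))" "\<lambda>x. psnd (psnd (g x))"])
      (auto simp: g(2) fraction_def intro!: recursive_intros g(1))
qed

lemma rat_recursive_fraction [recursive_intros]:
  "total_recursive F \<Longrightarrow> rat_recursive (\<lambda>x. fraction (F x))"
  by (auto simp: computes_def)

lemma rat_recursive_real [recursive_intros]: "total_recursive F \<Longrightarrow> rat_recursive (\<lambda>x. real (F x))"
  by (rule rat_recursiveI[of F "\<lambda>_. 0" "\<lambda>_. 0"]) (auto intro: recursive_intros)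

lemma rat_recursive_numeral [recursive_intros]:
  "rat_recursive (\<lambda>_. numeral n)" "rat_recursive (\<lambda>_. 1)" "rat_recursive (\<lambda>_. 0)"
  using rat_recursive_real[OF total_recursive_const[of "numeral n"]]
    rat_recursive_real[OF total_recursive_const[of 1]] rat_recursive_real[OF total_recursive_const[of 0]]
  by simp_all

lemma rat_recursive_add [recursive_intros]:
  assumes "rat_recursive F" "rat_recursive G"
  shows "rat_recursive (\<lambda>x. F x + G x)"
proof -
  obtain a b c where F: "total_recursive a" "total_recursive b" "total_recursive c"
    "\<And>x. F x = (real (a x) - real (b x)) / real (Suc (c x))" by (rule rat_recursiveE[OF assms(1)]) (rule that)
  obtain a' b' c' where G: "total_recursive a'" "total_recursive b'" "total_recursive c'"
    "\<And>x. G x = (real (a' x) - real (b' x)) / real (Suc (c' x))" by (rule rat_recursiveE[OF assms(2)]) (rule that)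
  have "real (Suc (c x * c' x + c x + c' x)) = real (Suc (c x)) * real (Suc (c' x))" for x
    by (simp add: algebra_simps)
  then have "F x + G x = (real (a x * Suc (c' x) + a' x * Suc (c x)) - real (b x * Suc (c' x) + b' x * Suc (c x)))
      / real (Suc (c x * c' x + c x + c' x))" for x
    by (simp add: F(4) G(4) add_frac_eq del: of_nat_Suc) (simp add: algebra_simps)
  then show ?thesis
    by (rule rat_recursiveI[rotated 3]) (intro recursive_intros F G)+
qed

lemma rat_recursive_mult [recursive_intros]:
  assumes "rat_recursive F" "rat_recursive G"
  shows "rat_recursive (\<lambda>x. F x * G x)"
proof -
  obtain a b c where F: "total_recursive a" "total_recursive b" "total_recursive c"
    "\<And>x. F x = (real (a x) - real (b x)) / real (Suc (c x))" by (rule rat_recursiveE[OF assms(1)]) (rule that)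
  obtain a' b' c' where G: "total_recursive a'" "total_recursive b'" "total_recursive c'"
    "\<And>x. G x = (real (a' x) - real (b' x)) / real (Suc (c' x))" by (rule rat_recursiveE[OF assms(2)]) (rule that)
  have "real (Suc (c x * c' x + c x + c' x)) = real (Suc (c x)) * real (Suc (c' x))" for x
    by (simp add: algebra_simps)
  then have "F x * G x = (real (a x * a' x + b x * b' x) - real (a x * b' x + a' x * b x))
      / real (Suc (c x * c' x + c x + c' x))" for x
    by (simp add: F(4) G(4) times_divide_times_eq del: of_nat_Suc) (simp add: algebra_simps)
  then show ?thesis
    by (rule rat_recursiveI[rotated 3]) (intro recursive_intros F G)+
qed

lemma rat_recursive_uminus [recursive_intros]:
  assumes "rat_recursive F" shows "rat_recursive (\<lambda>x. - F x)"
proof -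
  obtain a b c where F: "total_recursive a" "total_recursive b" "total_recursive c"
    "\<And>x. F x = (real (a x) - real (b x)) / real (Suc (c x))" by (rule rat_recursiveE[OF assms(1)]) (rule that)
  show ?thesis by (rule rat_recursiveI[OF F(2,1,3)]) (simp add: F(4) divide_simps)
qed

lemma rat_recursive_diff [recursive_intros]:
  "rat_recursive F \<Longrightarrow> rat_recursive G \<Longrightarrow> rat_recursive (\<lambda>x. F x - G x)"
  unfolding diff_conv_add_uminus by (intro recursive_intros)

lemma decidable_rat_le [recursive_intros]:
  assumes "rat_recursive F" "rat_recursive G"
  shows "decidable (\<lambda>x. F x \<le> G x)"
proof -
  obtain a b c where F: "total_recursive a" "total_recursive b" "total_recursive c"
    "\<And>x. F x - G x = (real (a x) - real (b x)) / real (Suc (c x))"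
    by (rule rat_recursiveE[OF rat_recursive_diff[OF assms]]) (rule that)
  have "F x \<le> G x \<longleftrightarrow> a x \<le> b x" for x
  proof -
    have "F x \<le> G x \<longleftrightarrow> F x - G x \<le> 0" by simp
    also have "\<dots> \<longleftrightarrow> a x \<le> b x" unfolding F(4) by (simp add: divide_le_0_iff del: of_nat_Suc)
    finally show ?thesis .
  qed
  then show ?thesis by simp (intro recursive_intros F)
qed

lemma decidable_rat_less [recursive_intros]:
  "rat_recursive F \<Longrightarrow> rat_recursive G \<Longrightarrow> decidable (\<lambda>x. F x < G x)"
  unfolding not_le[symmetric] by (intro recursive_intros)

lemma decidable_rat_eq [recursive_intros]:
  "rat_recursive F \<Longrightarrow> rat_recursive G \<Longrightarrow> decidable (\<lambda>x. F x = G x)"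
  unfolding eq_iff by (intro recursive_intros)

lemma rat_recursive_if [recursive_intros]:
  assumes "decidable P" "rat_recursive F" "rat_recursive G"
  shows "rat_recursive (\<lambda>x. if P x then F x else G x)"
proof -
  obtain f g where "total_recursive f" "\<And>x. F x = fraction (f x)"
    "total_recursive g" "\<And>x. G x = fraction (g x)" using assms(2,3) by (auto simp: computes_def)
  then show ?thesis unfolding computes_def
    by (intro exI[of _ "\<lambda>x. if P x then f x else g x"]) (auto intro!: recursive_intros assms(1))
qed

lemma rat_recursive_max [recursive_intros]:
  "rat_recursive F \<Longrightarrow> rat_recursive G \<Longrightarrow> rat_recursive (\<lambda>x. max (F x) (G x))"
  unfolding max_def by (intro recursive_intros)

lemma rat_recursive_min [recursive_intros]:
  "rat_recursive F \<Longrightarrow> rat_recursive G \<Longrightarrow> rat_recursive (\<lambda>x. min (F x) (G x))"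
  unfolding min_def by (intro recursive_intros)

lemma rat_recursive_divide_nat:
  assumes "rat_recursive F" "total_recursive G"
  shows "rat_recursive (\<lambda>x. F x / real (G x))"
proof -
  have "rat_recursive (\<lambda>x. 1 / real (Suc (G x - 1)))"
    by (rule rat_recursiveI[of "\<lambda>_. 1" "\<lambda>_. 0" "\<lambda>x. G x - 1"]) (auto intro!: recursive_intros assms)
  then have "rat_recursive (\<lambda>x. if G x = 0 then 0 else F x * (1 / real (Suc (G x - 1))))"
    by (intro recursive_intros assms)
  moreover have "F x / real (G x) = (if G x = 0 then 0 else F x * (1 / real (Suc (G x - 1))))" for x
    by simp
  ultimately show ?thesis by presburger
qed

lemma rat_recursive_divide [recursive_intros]:
  assumes "rat_recursive F" "rat_recursive G"
  shows "rat_recursive (\<lambda>x. F x / G x)"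
proof -
  obtain a b c where G: "total_recursive a" "total_recursive b" "total_recursive c"
    "\<And>x. G x = (real (a x) - real (b x)) / real (Suc (c x))" by (rule rat_recursiveE[OF assms(2)]) (rule that)
  have "rat_recursive (\<lambda>x. if b x \<le> a x then F x * real (Suc (c x)) / real (a x - b x)
      else - (F x * real (Suc (c x)) / real (b x - a x)))"
    by (intro recursive_intros rat_recursive_divide_nat assms G)
  moreover have "F x / G x = (if b x \<le> a x then F x * real (Suc (c x)) / real (a x - b x)
      else - (F x * real (Suc (c x)) / real (b x - a x)))" for x
    by (auto simp: G(4) of_nat_diff divide_simps algebra_simps)
  ultimately show ?thesis by simp
qed

lemma rat_recursive_half_power [recursive_intros]:
  assumes "total_recursive F" shows "rat_recursive (\<lambda>x. (1/2) ^ F x)"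
proof -
  have "rat_recursive (\<lambda>x. 1 / real (2 ^ F x))" by (intro recursive_intros assms)
  then show ?thesis by (simp add: power_one_over)
qed

lemma int_decode_nat:
  "real_of_int (int_decode n) = (if n mod 2 = 0 then real (n div 2) else - real (Suc (n div 2)))"
  by (auto simp: int_decode_def sum_decode_def elim!: evenE oddE)

lemma real_of_rat_Fract: "real_of_rat (Fract a b) = real_of_int a / real_of_int b"
  by (cases "b = 0") (auto simp: of_rat_rat rat_number_collapse)

lemma real_nat_to_rat_surj:
  "real_of_rat (nat_to_rat_surj z) = real_of_int (int_decode (pfst z)) / real_of_int (int_decode (psnd z))"
  by (simp add: nat_to_rat_surj_def Let_def split_beta real_of_rat_Fract)

lemma real_pos_rat: "real_of_rat (pos_rat z) = real (Suc (pfst z)) / real (Suc (psnd z))"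
  by (simp add: pos_rat_def split_beta real_of_rat_Fract)

lemma rat_recursive_nat_to_rat_surj [recursive_intros]:
  assumes "total_recursive F"
  shows "rat_recursive (\<lambda>x. real_of_rat (nat_to_rat_surj (F x)))"
proof -
  have int: "rat_recursive (\<lambda>x. real_of_int (int_decode (G x)))" if "total_recursive G" for G
    unfolding int_decode_nat by (intro recursive_intros that)
  show ?thesis unfolding real_nat_to_rat_surj by (intro recursive_intros int assms)
qed

lemma rat_recursive_pos_rat [recursive_intros]:
  assumes "total_recursive F"
  shows "rat_recursive (\<lambda>x. real_of_rat (pos_rat (F x)))"
  unfolding real_pos_rat by (intro recursive_intros assms)

section \<open>The ergodic theorem for averages\<close>

definition birkhoff_sum :: "('a \<Rightarrow> 'a) \<Rightarrow> ('a \<Rightarrow> real) \<Rightarrow> nat \<Rightarrow> 'a \<Rightarrow> real" where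
  "birkhoff_sum T h n x = (\<Sum>i<n. h ((T ^^ i) x))"

lemma birkhoff_sum_0 [simp]: "birkhoff_sum T h 0 x = 0"
  by (simp add: birkhoff_sum_def)

lemma birkhoff_sum_Suc: "birkhoff_sum T h (Suc n) x = h x + birkhoff_sum T h n (T x)"
  by (simp add: birkhoff_sum_def sum.lessThan_Suc_shift funpow_swap1 del: sum.lessThan_Suc)

text \<open>
  The maximum of the Birkhoff sums of length at most \<open>n\<close>, the empty sum included. Splitting off the
  first point of the orbit gives the recursion, and this is the form in which the maximum enters the
  maximal ergodic lemma.
\<close>

primrec max_birkhoff :: "('a \<Rightarrow> 'a) \<Rightarrow> ('a \<Rightarrow> real) \<Rightarrow> nat \<Rightarrow> 'a \<Rightarrow> real" where
  "max_birkhoff T h 0 x = 0"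
| "max_birkhoff T h (Suc n) x = max 0 (h x + max_birkhoff T h n (T x))"

lemma max_birkhoff_nonneg: "0 \<le> max_birkhoff T h n x"
  by (cases n) auto

lemma birkhoff_sum_le_max: "birkhoff_sum T h n x \<le> max_birkhoff T h n x"
proof (induction n arbitrary: x)
  case (Suc n)
  from Suc[of "T x"] show ?case by (simp add: birkhoff_sum_Suc le_max_iff_disj)
qed simp

lemma max_birkhoff_mono: "max_birkhoff T h n x \<le> max_birkhoff T h (Suc n) x"
proof (induction n arbitrary: x)
  case (Suc n)
  from Suc[of "T x"] show ?case by (simp add: max.coboundedI2)
qed simp

lemma incseq_max_birkhoff: "incseq (\<lambda>n. max_birkhoff T h n x)"
  by (rule incseq_SucI) (rule max_birkhoff_mono)

locale measure_preserving_map = prob_space M for M :: "'a measure" +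
  fixes T :: "'a \<Rightarrow> 'a"
  assumes T_measurable [measurable]: "T \<in> measurable M M"
    and T_preserves: "distr M M T = M"
begin

lemma funpow_measurable [measurable]: "(T ^^ n) \<in> measurable M M"
  by (induction n) (auto intro: measurable_comp simp: id_def)

lemma funpow_preserves: "distr M M (T ^^ n) = M"
proof (induction n)
  case (Suc n)
  have "distr M M (T ^^ Suc n) = distr (distr M M (T ^^ n)) M T"
    by (subst distr_distr) auto
  then show ?case using Suc T_preserves by (simp add: comp_def)
qed (simp add: distr_id id_def)

lemma integral_T: "h \<in> borel_measurable M \<Longrightarrow> (\<integral>x. h (T x) \<partial>M) = (\<integral>x. h x \<partial>M)" for h :: "'a \<Rightarrow> real"
  using integral_distr[of T M M h] T_preserves by simp

lemma integral_funpow: "h \<in> borel_measurable M \<Longrightarrow> (\<integral>x. h ((T ^^ n) x) \<partial>M) = (\<integral>x. h x \<partial>M)" for h :: "'a \<Rightarrow> real"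
  using integral_distr[of "T ^^ n" M M h] funpow_preserves by simp

lemma integrable_T: "integrable M h \<Longrightarrow> integrable M (\<lambda>x. h (T x))" for h :: "'a \<Rightarrow> real"
  using integrable_distr_eq[of T M M h] T_preserves by simp

lemma integrable_funpow: "integrable M h \<Longrightarrow> integrable M (\<lambda>x. h ((T ^^ n) x))" for h :: "'a \<Rightarrow> real"
  using integrable_distr_eq[of "T ^^ n" M M h] funpow_preserves by simp

lemma AE_funpow: "AE x in M. P x \<Longrightarrow> AE x in M. P ((T ^^ n) x)"
  by (metis AE_distrD funpow_measurable funpow_preserves)

lemma AE_T: "AE x in M. P x \<Longrightarrow> AE x in M. P (T x)"
  using AE_funpow[of P 1] by simp

lemma birkhoff_measurable [measurable]:
  "h \<in> borel_measurable M \<Longrightarrow> birkhoff_sum T h n \<in> borel_measurable M"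
  unfolding birkhoff_sum_def[abs_def]
  by (intro borel_measurable_sum measurable_compose[OF funpow_measurable])

lemma integrable_birkhoff: "integrable M h \<Longrightarrow> integrable M (birkhoff_sum T h n)"
  unfolding birkhoff_sum_def[abs_def] by (intro Bochner_Integration.integrable_sum integrable_funpow)

lemma integral_birkhoff: "integrable M h \<Longrightarrow> (\<integral>x. birkhoff_sum T h n x \<partial>M) = real n * (\<integral>x. h x \<partial>M)"
  unfolding birkhoff_sum_def
  by (subst Bochner_Integration.integral_sum) (auto simp: integrable_funpow integral_funpow)

lemma integrable_max_birkhoff: "integrable M h \<Longrightarrow> integrable M (max_birkhoff T h n)"
proof (induction n)
  case 0
  have "max_birkhoff T h 0 = (\<lambda>_. 0)" by auto
  then show ?case by simp
next
  case (Suc n)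
  have "max_birkhoff T h (Suc n) = (\<lambda>x. max 0 (h x + max_birkhoff T h n (T x)))" by auto
  with Suc show ?case by (auto intro!: integrable_T)
qed

lemma integral_max_birkhoff_step:
  assumes "integrable M h"
  shows "0 \<le> (\<integral>x. max_birkhoff T h (Suc n) x - max_birkhoff T h n (T x) \<partial>M)"
proof -
  note [simp] = integrable_max_birkhoff[OF assms]
  have "(\<integral>x. max_birkhoff T h (Suc n) x - max_birkhoff T h n (T x) \<partial>M)
      = (\<integral>x. max_birkhoff T h (Suc n) x \<partial>M) - (\<integral>x. max_birkhoff T h n x \<partial>M)"
    by (subst Bochner_Integration.integral_diff)
      (auto intro: integrable_T simp del: max_birkhoff.simps
        simp: integral_T[OF borel_measurable_integrable[OF integrable_max_birkhoff[OF assms]]])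
  also have "\<dots> \<ge> 0"
    unfolding diff_ge_0_iff_ge by (rule integral_mono) (simp_all add: max_birkhoff_mono del: max_birkhoff.simps)
  finally show ?thesis .
qed

text \<open>
  Hopf's maximal inequality, by Garsia's argument: where the maximum \<open>M\<^sub>n\<^sub>+\<^sub>1\<close> is positive
  it equals \<open>h + M\<^sub>n \<circ> T\<close>, elsewhere \<open>M\<^sub>n\<^sub>+\<^sub>1 - M\<^sub>n \<circ> T\<close> is at most \<open>0\<close>, and the integral of this
  difference is nonnegative because \<open>T\<close> preserves the measure.
\<close>

lemma maximal_ergodic_lemma:
  assumes h: "integrable M h"
  shows "0 \<le> (\<integral>x. indicator {x. 0 < max_birkhoff T h (Suc n) x} x * h x \<partial>M)"
proof -
  note [simp] = integrable_max_birkhoff[OF h]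
  have [measurable]: "max_birkhoff T h k \<in> borel_measurable M" for k
    by (rule borel_measurable_integrable) simp
  have "0 \<le> (\<integral>x. max_birkhoff T h (Suc n) x - max_birkhoff T h n (T x) \<partial>M)"
    by (rule integral_max_birkhoff_step[OF h])
  also have "\<dots> \<le> (\<integral>x. indicator {x\<in>space M. 0 < max_birkhoff T h (Suc n) x} x * h x \<partial>M)"
  proof (rule integral_mono)
    show "integrable M (\<lambda>x. indicator {x\<in>space M. 0 < max_birkhoff T h (Suc n) x} x * h x)"
      by (subst mult.commute) (rule integrable_real_mult_indicator[OF _ h], measurable)
    fix x assume "x \<in> space M"
    then show "max_birkhoff T h (Suc n) x - max_birkhoff T h n (T x)
        \<le> indicator {x\<in>space M. 0 < max_birkhoff T h (Suc n) x} x * h x"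
      using max_birkhoff_nonneg[of T h n "T x"] by (auto simp: indicator_def)
  qed (auto intro!: integrable_T simp del: max_birkhoff.simps)
  also have "\<dots> = (\<integral>x. indicator {x. 0 < max_birkhoff T h (Suc n) x} x * h x \<partial>M)"
    by (rule Bochner_Integration.integral_cong) (auto simp: indicator_def)
  finally show ?thesis .
qed

text \<open>The weak type inequality: the maximal ergodic lemma for \<open>\<bar>h\<bar> - c\<close>.\<close>

lemma maximal_inequality:
  assumes h: "integrable M h" and c: "0 < c"
  shows "{x\<in>space M. \<exists>n. real n * c < \<bar>birkhoff_sum T h n x\<bar>} \<in> sets M"
    and "c * measure M {x\<in>space M. \<exists>n. real n * c < \<bar>birkhoff_sum T h n x\<bar>} \<le> (\<integral>x. \<bar>h x\<bar> \<partial>M)"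
proof -
  have [measurable]: "h \<in> borel_measurable M" using h by auto
  show sets: "{x\<in>space M. \<exists>n. real n * c < \<bar>birkhoff_sum T h n x\<bar>} \<in> sets M" (is "?E \<in> _")
    by measurable
  define g where "g x = \<bar>h x\<bar> - c" for x
  have g: "integrable M g" unfolding g_def using h by auto
  note [simp] = integrable_max_birkhoff[OF g]
  have [measurable]: "max_birkhoff T g k \<in> borel_measurable M" for k
    by (rule borel_measurable_integrable) simp
  define E where "E n = {x\<in>space M. 0 < max_birkhoff T g (Suc n) x}" for n
  have E_sets [measurable]: "E n \<in> sets M" for n unfolding E_def by measurable
  have bound: "c * measure M (E n) \<le> (\<integral>x. \<bar>h x\<bar> \<partial>M)" for n
  proof -
    have "0 \<le> (\<integral>x. indicator {x. 0 < max_birkhoff T g (Suc n) x} x * g x \<partial>M)"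
      by (rule maximal_ergodic_lemma[OF g])
    also have "\<dots> = (\<integral>x. indicator (E n) x * \<bar>h x\<bar> - c * indicator (E n) x \<partial>M)"
      by (rule Bochner_Integration.integral_cong) (auto simp: indicator_def E_def g_def)
    also have "\<dots> \<le> (\<integral>x. \<bar>h x\<bar> - c * indicator (E n) x \<partial>M)"
      using h by (intro integral_mono Bochner_Integration.integrable_diff integrable_real_indicator
          integrable_mult_right integrable_mult_indicator[where 'b=real, simplified])
        (auto simp: indicator_def less_top[symmetric])
    also have "\<dots> = (\<integral>x. \<bar>h x\<bar> \<partial>M) - c * measure M (E n)"
      using h by (subst Bochner_Integration.integral_diff) (auto simp: less_top[symmetric])
    finally show ?thesis by simp
  qed
  have subset: "?E \<subseteq> (\<Union>n. E n)"
  proof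
    fix x assume x: "x \<in> ?E"
    then obtain n where n: "real n * c < \<bar>birkhoff_sum T h n x\<bar>" by blast
    then have "n \<noteq> 0" by (cases n) auto
    then obtain m where m: "n = Suc m" by (cases n) auto
    have "birkhoff_sum T g n x = (\<Sum>i<n. \<bar>h ((T ^^ i) x)\<bar>) - real n * c"
      by (simp add: birkhoff_sum_def g_def sum_subtractf)
    also have "\<dots> \<ge> \<bar>birkhoff_sum T h n x\<bar> - real n * c"
      by (simp add: birkhoff_sum_def sum_abs)
    finally have "0 < birkhoff_sum T g n x" using n by linarith
    then have "x \<in> E m"
      using birkhoff_sum_le_max[of T g n x] x unfolding E_def m by (auto simp del: max_birkhoff.simps)
    then show "x \<in> (\<Union>n. E n)" by blast
  qed
  have "c * measure M (\<Union>n. E n) \<le> (\<integral>x. \<bar>h x\<bar> \<partial>M)"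
  proof (rule LIMSEQ_le_const2)
    have "incseq E"
    proof (rule incseq_SucI, rule subsetI)
      fix n x assume "x \<in> E n"
      then show "x \<in> E (Suc n)"
        using max_birkhoff_mono[of T g "Suc n" x] unfolding E_def by (auto simp del: max_birkhoff.simps)
    qed
    then show "(\<lambda>n. c * measure M (E n)) \<longlonglongrightarrow> c * measure M (\<Union>n. E n)"
      by (intro tendsto_mult_left finite_Lim_measure_incseq) (auto intro: E_sets)
  qed (use bound in auto)
  moreover have "c * measure M ?E \<le> c * measure M (\<Union>n. E n)"
    using c by (intro mult_left_mono finite_measure_mono[OF subset]) auto
  ultimately show "c * measure M ?E \<le> (\<integral>x. \<bar>h x\<bar> \<partial>M)"
    by linarith
qed

end

locale ergodic_map = measure_preserving_map +
  assumes trivial_invariant: "A \<in> sets M \<Longrightarrow> T -` A \<inter> space M = A \<Longrightarrow> prob A = 0 \<or> prob A = 1"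
begin

text \<open>
  The set where the Birkhoff sums are unbounded above is invariant. If it had full measure, then
  \<open>M\<^sub>n\<^sub>+\<^sub>1 - M\<^sub>n \<circ> T = max (- (M\<^sub>n \<circ> T)) h\<close> would tend to \<open>h\<close> almost everywhere, dominated by \<open>\<bar>h\<bar>\<close>,
  and the integral of \<open>h\<close> would be a limit of nonnegative numbers.
\<close>

lemma AE_birkhoff_bounded_above:
  assumes h: "integrable M h" and neg: "(\<integral>x. h x \<partial>M) < 0"
  shows "AE x in M. \<exists>K. \<forall>n. birkhoff_sum T h n x \<le> K"
proof -
  note [simp] = integrable_max_birkhoff[OF h]
  have [measurable]: "max_birkhoff T h k \<in> borel_measurable M" for k
    by (rule borel_measurable_integrable) simp
  have [measurable]: "h \<in> borel_measurable M" using h by auto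
  define A where "A = {x\<in>space M. \<forall>K::nat. \<exists>n. real K < max_birkhoff T h n x}"
  have A_sets [measurable]: "A \<in> sets M" unfolding A_def by measurable
  have unbounded_T: "(\<forall>K::nat. \<exists>n. real K < max_birkhoff T h n (T x)) \<longleftrightarrow> (\<forall>K::nat. \<exists>n. real K < max_birkhoff T h n x)" for x
  proof (intro iffI allI)
    fix K assume *: "\<forall>K::nat. \<exists>n. real K < max_birkhoff T h n (T x)"
    obtain K' :: nat where K': "real K - h x \<le> real K'" using real_arch_simple by blast
    obtain n where "real K' < max_birkhoff T h n (T x)" using * by blast
    then have "real K < max_birkhoff T h (Suc n) x" using K' by simp
    then show "\<exists>n. real K < max_birkhoff T h n x" by blast
  next
    fix K assume *: "\<forall>K::nat. \<exists>n. real K < max_birkhoff T h n x"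
    obtain K' :: nat where K': "max 0 (real K + h x) \<le> real K'" using real_arch_simple by blast
    obtain n where n: "real K' < max_birkhoff T h n x" using * by blast
    then obtain m where "n = Suc m" by (cases n) auto
    then have "real K < max_birkhoff T h m (T x)" using n K' by (auto simp: less_max_iff_disj)
    then show "\<exists>n. real K < max_birkhoff T h n (T x)" by blast
  qed
  have inv: "T -` A \<inter> space M = A"
    using measurable_space[OF T_measurable] by (auto simp: A_def unbounded_T)
  have "prob A \<noteq> 1"
  proof
    assume "prob A = 1"
    then have AE_A: "AE x in M. x \<in> A" by (simp add: prob_eq_1)
    have "(\<lambda>n. \<integral>x. max_birkhoff T h (Suc n) x - max_birkhoff T h n (T x) \<partial>M) \<longlonglongrightarrow> (\<integral>x. h x \<partial>M)"
    proof (rule integral_dominated_convergence)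
      show "integrable M (\<lambda>x. \<bar>h x\<bar>)" using h by simp
      show "AE x in M. (\<lambda>n. max_birkhoff T h (Suc n) x - max_birkhoff T h n (T x)) \<longlonglongrightarrow> h x"
        using AE_A
      proof eventually_elim
        fix x assume "x \<in> A"
        then have "\<forall>K::nat. \<exists>n. real K < max_birkhoff T h n (T x)" unfolding unbounded_T by (simp add: A_def)
        then obtain n where n: "real (nat \<lceil>- h x\<rceil>) < max_birkhoff T h n (T x)" by blast
        have "max_birkhoff T h (Suc m) x - max_birkhoff T h m (T x) = h x" if "n \<le> m" for m
        proof -
          have "max_birkhoff T h n (T x) \<le> max_birkhoff T h m (T x)"
            by (rule incseqD[OF incseq_max_birkhoff that])
          then have "0 \<le> h x + max_birkhoff T h m (T x)" using n by linarith
          then show ?thesis by simp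
        qed
        then have "eventually (\<lambda>m. h x = max_birkhoff T h (Suc m) x - max_birkhoff T h m (T x)) sequentially"
          unfolding eventually_sequentially by (intro exI[of _ n]) simp
        then show "(\<lambda>n. max_birkhoff T h (Suc n) x - max_birkhoff T h n (T x)) \<longlonglongrightarrow> h x"
          by (rule Lim_transform_eventually[OF tendsto_const])
      qed
      fix n
      show "AE x in M. norm (max_birkhoff T h (Suc n) x - max_birkhoff T h n (T x)) \<le> \<bar>h x\<bar>"
      proof (rule AE_I2)
        fix x
        show "norm (max_birkhoff T h (Suc n) x - max_birkhoff T h n (T x)) \<le> \<bar>h x\<bar>"
          using max_birkhoff_nonneg[of T h n "T x"] by (auto simp: max_def abs_if)
      qed
    qed (measurable)
    then have "0 \<le> (\<integral>x. h x \<partial>M)"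
      by (rule LIMSEQ_le_const) (use integral_max_birkhoff_step[OF h] in auto)
    with neg show False by simp
  qed
  then have "prob A = 0" using trivial_invariant[OF A_sets inv] by blast
  then have "AE x in M. x \<notin> A" by (subst AE_iff_measurable[OF A_sets]) (auto simp: A_def emeasure_eq_measure)
  with AE_space show ?thesis
  proof eventually_elim
    fix x assume "x \<in> space M" "x \<notin> A"
    then obtain K :: nat where "\<And>n. max_birkhoff T h n x \<le> real K" by (auto simp: A_def not_less)
    then have "\<forall>n. birkhoff_sum T h n x \<le> real K"
      by (intro allI order_trans[OF birkhoff_sum_le_max])
    then show "\<exists>K. \<forall>n. birkhoff_sum T h n x \<le> K" by blast
  qed
qed

lemma AE_birkhoff_upper:
  assumes h: "integrable M h" and c: "(\<integral>x. h x \<partial>M) < c"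
  shows "AE x in M. \<exists>K. \<forall>n. birkhoff_sum T h n x \<le> K + real n * c"
proof -
  have "integrable M (\<lambda>x. h x - c)" using h by simp
  moreover have "(\<integral>x. h x - c \<partial>M) < 0" using h c by (simp add: prob_space)
  ultimately have "AE x in M. \<exists>K. \<forall>n. birkhoff_sum T (\<lambda>x. h x - c) n x \<le> K"
    by (rule AE_birkhoff_bounded_above)
  moreover have "birkhoff_sum T (\<lambda>x. h x - c) n x = birkhoff_sum T h n x - real n * c" for n x
    by (simp add: birkhoff_sum_def sum_subtractf)
  ultimately show ?thesis by (simp add: diff_le_eq)
qed

text \<open>Birkhoff's theorem, from the bounds for \<open>h\<close> and \<open>- h\<close> with \<open>c\<close> at distance \<open>1/(m+1)\<close> from the mean.\<close>

lemma AE_birkhoff_tendsto: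
  assumes h: "integrable M h"
  shows "AE x in M. (\<lambda>n. birkhoff_sum T h n x / real n) \<longlonglongrightarrow> (\<integral>x. h x \<partial>M)"
proof -
  define c where "c = (\<integral>x. h x \<partial>M)"
  have "AE x in M. \<forall>m::nat. \<exists>K. \<forall>n. birkhoff_sum T h n x \<le> K + real n * (c + inverse (real (Suc m)))"
    unfolding AE_all_countable c_def by (intro allI AE_birkhoff_upper[OF h]) simp
  moreover have "AE x in M. \<forall>m::nat. \<exists>K. \<forall>n. birkhoff_sum T (\<lambda>x. - h x) n x \<le> K + real n * (- c + inverse (real (Suc m)))"
    unfolding AE_all_countable c_def using h by (intro allI AE_birkhoff_upper) simp_all
  ultimately show ?thesis
  proof eventually_elim
    fix x
    assume up: "\<forall>m::nat. \<exists>K. \<forall>n. birkhoff_sum T h n x \<le> K + real n * (c + inverse (real (Suc m)))"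
      and lo: "\<forall>m::nat. \<exists>K. \<forall>n. birkhoff_sum T (\<lambda>x. - h x) n x \<le> K + real n * (- c + inverse (real (Suc m)))"
    have "\<exists>N. \<forall>n\<ge>N. norm (birkhoff_sum T h n x / real n - c) < e" if "0 < e" for e
    proof -
      obtain m where m: "inverse (real (Suc m)) < e / 2"
        using reals_Archimedean[of "e / 2"] \<open>0 < e\<close> half_gt_zero by blast
      obtain K where K: "\<And>n. birkhoff_sum T h n x \<le> K + real n * (c + inverse (real (Suc m)))"
        using up by blast
      obtain L where L: "\<And>n. birkhoff_sum T (\<lambda>x. - h x) n x \<le> L + real n * (- c + inverse (real (Suc m)))"
        using lo by blast
      obtain N :: nat where N: "max 1 (2 * max \<bar>K\<bar> \<bar>L\<bar> / e) < real N" using reals_Archimedean2 by blast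
      have "norm (birkhoff_sum T h n x / real n - c) < e" if "N \<le> n" for n
      proof -
        have n: "1 < real n" "2 * max \<bar>K\<bar> \<bar>L\<bar> / e < real n" using N that by auto
        then have "max \<bar>K\<bar> \<bar>L\<bar> * 2 < real n * e"
          using \<open>0 < e\<close> by (simp add: divide_less_eq mult.commute)
        then have KL: "K \<le> real n * (e / 2)" "L \<le> real n * (e / 2)" by auto
        have ne: "real n * inverse (real (Suc m)) < real n * (e / 2)"
          using m n by (intro mult_strict_left_mono) auto
        have neg: "birkhoff_sum T (\<lambda>x. - h x) n x = - birkhoff_sum T h n x"
          by (simp add: birkhoff_sum_def sum_negf)
        have "birkhoff_sum T h n x - real n * c < real n * e"
          using K[of n] KL ne unfolding distrib_left by linarith
        moreover have "- (real n * e) < birkhoff_sum T h n x - real n * c"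
          using L[of n] KL ne unfolding distrib_left neg mult_minus_right by linarith
        ultimately have "\<bar>birkhoff_sum T h n x - real n * c\<bar> < real n * e" by linarith
        moreover have "birkhoff_sum T h n x / real n - c = (birkhoff_sum T h n x - real n * c) / real n"
          using n by (simp add: diff_divide_distrib)
        ultimately show ?thesis using n by (simp add: divide_less_eq mult.commute)
      qed
      then show ?thesis by blast
    qed
    then have "(\<lambda>n. birkhoff_sum T h n x / real n) \<longlonglongrightarrow> c" by (intro LIMSEQ_I)
    then show "(\<lambda>n. birkhoff_sum T h n x / real n) \<longlonglongrightarrow> (\<integral>x. h x \<partial>M)" by (simp only: c_def)
  qed
qed

text \<open>
  For bounded functions the averages are uniformly bounded, so convergence almost everywhere gives
  convergence in the mean. No rate is known here: the algorithm below searches for a length at which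
  the average is close to a constant, and this lemma guarantees that the search ends.
\<close>

lemma L1_birkhoff_tendsto:
  assumes h [measurable]: "h \<in> borel_measurable M" and C: "\<And>x. x \<in> space M \<Longrightarrow> \<bar>h x\<bar> \<le> C"
  shows "(\<lambda>n. \<integral>x. \<bar>birkhoff_sum T h n x / real n - (\<integral>x. h x \<partial>M)\<bar> \<partial>M) \<longlonglongrightarrow> 0"
proof -
  define c where "c = (\<integral>x. h x \<partial>M)"
  have int: "integrable M h" by (rule integrable_const_bound[of _ C]) (auto simp: C)
  have bound: "\<bar>birkhoff_sum T h n x / real n\<bar> \<le> C" if "x \<in> space M" for n x
  proof -
    have "(T ^^ i) x \<in> space M" for i using measurable_space[OF funpow_measurable that] .
    then have "(\<Sum>i<n. \<bar>h ((T ^^ i) x)\<bar>) \<le> (\<Sum>i<n. C)" by (intro sum_mono C)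
    then have "\<bar>birkhoff_sum T h n x\<bar> \<le> real n * C"
      unfolding birkhoff_sum_def by (intro order_trans[OF sum_abs]) simp
    moreover have "0 \<le> C" using C[OF that] by linarith
    ultimately show ?thesis by (cases "n = 0") (auto simp: field_simps)
  qed
  have "(\<lambda>n. \<integral>x. \<bar>birkhoff_sum T h n x / real n - c\<bar> \<partial>M) \<longlonglongrightarrow> (\<integral>x. 0 \<partial>M)"
  proof (rule integral_dominated_convergence)
    show "AE x in M. (\<lambda>n. \<bar>birkhoff_sum T h n x / real n - c\<bar>) \<longlonglongrightarrow> 0"
      using AE_birkhoff_tendsto[OF int]
      unfolding c_def by eventually_elim (rule tendsto_rabs_zero[OF LIM_zero])
    show "AE x in M. norm \<bar>birkhoff_sum T h n x / real n - c\<bar> \<le> C + \<bar>c\<bar>" for n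
    proof (rule AE_I2)
      fix x assume "x \<in> space M"
      then show "norm \<bar>birkhoff_sum T h n x / real n - c\<bar> \<le> C + \<bar>c\<bar>"
        using bound[of x n] abs_triangle_ineq4[of "birkhoff_sum T h n x / real n" c] by simp
    qed
  qed (auto)
  then show ?thesis by (simp add: c_def)
qed

end

text \<open>
  Averaging an average changes little: the sums of a bounded function along an orbit and along a
  shifted orbit differ only in the first and last terms.
\<close>

lemma birkhoff_sum_shift:
  assumes "\<And>x. \<bar>u x\<bar> \<le> C"
  shows "\<bar>birkhoff_sum T u k x - birkhoff_sum T u k ((T ^^ j) x)\<bar> \<le> 2 * real j * C"
proof (induction j)
  case (Suc j)
  let ?y = "(T ^^ j) x"
  have "birkhoff_sum T u k ?y + u ((T ^^ k) ?y) = u ?y + birkhoff_sum T u k (T ?y)"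
    unfolding birkhoff_sum_Suc[symmetric] by (simp add: birkhoff_sum_def)
  moreover have "2 * real (Suc j) * C = 2 * real j * C + 2 * C" by (simp add: algebra_simps)
  ultimately have "\<bar>birkhoff_sum T u k x - birkhoff_sum T u k (T ?y)\<bar> \<le> 2 * real (Suc j) * C"
    using Suc assms[of ?y] assms[of "(T ^^ k) ?y"] by linarith
  then show ?case by simp
qed simp

lemma birkhoff_sum_birkhoff_sum:
  "birkhoff_sum T (birkhoff_sum T u p) k x = (\<Sum>j<p. birkhoff_sum T u k ((T ^^ j) x))"
proof -
  have "birkhoff_sum T (birkhoff_sum T u p) k x = (\<Sum>i<k. \<Sum>j<p. u ((T ^^ (j + i)) x))"
    by (simp add: birkhoff_sum_def funpow_add)
  also have "\<dots> = (\<Sum>j<p. \<Sum>i<k. u ((T ^^ (i + j)) x))"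
    by (subst sum.swap) (simp add: add.commute)
  finally show ?thesis by (simp add: birkhoff_sum_def funpow_add)
qed

lemma average_of_average:
  assumes u: "\<And>x. \<bar>u x\<bar> \<le> C" and p: "0 < p"
  shows "\<bar>birkhoff_sum T u k x - birkhoff_sum T (\<lambda>x. birkhoff_sum T u p x / real p) k x\<bar> \<le> 2 * real p * C"
proof -
  have C: "0 \<le> C" using u[of x] by linarith
  have "real p * (birkhoff_sum T u k x - birkhoff_sum T (\<lambda>x. birkhoff_sum T u p x / real p) k x)
      = real p * birkhoff_sum T u k x - birkhoff_sum T (birkhoff_sum T u p) k x"
    using p by (simp add: birkhoff_sum_def sum_divide_distrib[symmetric] right_diff_distrib)
  also have "\<dots> = (\<Sum>j<p. birkhoff_sum T u k x - birkhoff_sum T u k ((T ^^ j) x))"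
    by (simp add: birkhoff_sum_birkhoff_sum sum_subtractf)
  also have "\<bar>\<dots>\<bar> \<le> (\<Sum>j<p. 2 * real p * C)"
  proof (rule order_trans[OF sum_abs], rule sum_mono, rule order_trans[OF birkhoff_sum_shift[OF u]])
    fix j assume "j \<in> {..<p}"
    then show "2 * real j * C \<le> 2 * real p * C" using C by (intro mult_right_mono) auto
  qed
  finally have "real p * \<bar>birkhoff_sum T u k x - birkhoff_sum T (\<lambda>x. birkhoff_sum T u p x / real p) k x\<bar>
      \<le> real p * (2 * real p * C)"
    by (simp add: abs_mult)
  then show ?thesis using p by simp
qed

section \<open>Ideal functions and their integrals\<close>

text \<open>
  The value of an ideal function at a point depends on the point only through its distances to the
  ideal points. Taking the list of distances as the argument allows approximate distances, and the
  estimate for a perturbation of the distances gives at once the Lipschitz constant of the function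
  and the error of its approximate evaluation.
\<close>

function ideal_value :: "(nat \<Rightarrow> real) \<Rightarrow> nat \<Rightarrow> real" where
  "ideal_value D 0 = 1"
| "ideal_value D (Suc n) =
     (let k = pfst n; m = psnd n; a = pfst m; b = psnd m
      in if k = 0 then
           max 0 (1 - max 0 (D a - real_of_rat (nat_to_rat_surj (pfst b))) / real_of_rat (pos_rat (psnd b)))
         else if k = 1 then max (ideal_value D a) (ideal_value D b)
         else if k = 2 then min (ideal_value D a) (ideal_value D b)
         else real_of_rat (nat_to_rat_surj (pfst a)) * ideal_value D (psnd a)
            + real_of_rat (nat_to_rat_surj (pfst b)) * ideal_value D (psnd b))"
  by pat_completeness auto

lemma component_le:
  "pfst (psnd n) \<le> n" "psnd (psnd n) \<le> n" "psnd (pfst (psnd n)) \<le> n" "psnd (psnd (psnd n)) \<le> n"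
  by (meson fst_prod_decode_le snd_prod_decode_le order_trans)+

termination ideal_value
  by (relation "inv_image less_than snd") (auto simp: less_Suc_eq_le component_le)

lemma ideal_fun_eq_value: "ideal_fun s k x = ideal_value (\<lambda>a. dist x (s a)) k"
proof (induction k rule: less_induct)
  case (less k)
  show ?case
    using less[of "pfst (psnd (k - 1))"] less[of "psnd (psnd (k - 1))"]
      less[of "psnd (pfst (psnd (k - 1)))"] less[of "psnd (psnd (psnd (k - 1)))"]
    by (cases k) (simp_all add: Let_def hat_def less_Suc_eq_le component_le)
qed

text \<open>A bound for an ideal function which is also a Lipschitz constant.\<close>

function ideal_bound :: "nat \<Rightarrow> nat" where
  "ideal_bound 0 = 1"
| "ideal_bound (Suc n) =
     (let k = pfst n; m = psnd n; a = pfst m; b = psnd m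
      in if k = 0 then Suc (psnd (psnd b))
         else if k = 1 \<or> k = 2 then ideal_bound a + ideal_bound b
         else Suc (pfst (pfst a) * ideal_bound (psnd a) + pfst (pfst b) * ideal_bound (psnd b)))"
  by pat_completeness auto

termination ideal_bound
  by (relation "less_than") (auto simp: less_Suc_eq_le component_le)

lemma ideal_bound_pos: "0 < ideal_bound k"
proof (induction k rule: less_induct)
  case (less k)
  show ?case
    using less[of "pfst (psnd (k - 1))"]
    by (cases k) (auto simp: Let_def less_Suc_eq_le component_le)
qed

lemma abs_nat_to_rat_surj_le: "\<bar>real_of_rat (nat_to_rat_surj z)\<bar> \<le> real (pfst z)"
proof -
  have num: "\<bar>real_of_int (int_decode n)\<bar> \<le> real n" for n
  proof (cases "n mod 2 = 0")
    case False
    then have "real (Suc (n div 2)) \<le> real n" unfolding of_nat_le_iff by presburger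
    then show ?thesis using False by (simp add: int_decode_nat)
  qed (simp add: int_decode_nat)
  have den: "\<bar>real_of_int d\<bar> = 0 \<or> 1 \<le> \<bar>real_of_int d\<bar>" for d :: int
    by (cases "d = 0") (simp_all flip: of_int_abs)
  have "\<bar>a / b\<bar> \<le> \<bar>a\<bar>" if "\<bar>b\<bar> = 0 \<or> 1 \<le> \<bar>b\<bar>" for a b :: real
    using that mult_left_mono[of 1 "\<bar>b\<bar>" "\<bar>a\<bar>"] by (auto simp: divide_le_eq)
  from this[OF den] show ?thesis unfolding real_nat_to_rat_surj using num order_trans by blast
qed

lemma inverse_pos_rat_le: "1 / real_of_rat (pos_rat z) \<le> real (Suc (psnd z))"
  unfolding real_pos_rat by (simp add: divide_le_eq algebra_simps)

lemma pos_rat_pos: "0 < real_of_rat (pos_rat z)"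
  unfolding real_pos_rat by simp

lemma abs_ideal_value_le: "\<bar>ideal_value D k\<bar> \<le> real (ideal_bound k)"
proof (induction k rule: less_induct)
  case (less k)
  show ?case
  proof (cases k)
    case (Suc n)
    define a b where "a = pfst (psnd n)" and "b = psnd (psnd n)"
    have IH: "\<bar>ideal_value D j\<bar> \<le> real (ideal_bound j)" if "j \<in> {a, b, psnd a, psnd b}" for j
      using less[of j] that unfolding a_def b_def Suc by (auto simp: less_Suc_eq_le component_le)
    have lin: "\<bar>real_of_rat (nat_to_rat_surj p) * ideal_value D j\<bar> \<le> real (pfst p) * real (ideal_bound j)"
      if "j \<in> {psnd a, psnd b}" for p j
      unfolding abs_mult using IH[of j] that by (intro mult_mono abs_nat_to_rat_surj_le) auto
    have hat: "\<bar>max 0 (1 - max 0 y / e)\<bar> \<le> 1" if "0 < e" for y e :: real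
      using that by (simp add: max_def)
    consider "pfst n = 0" | "pfst n = 1" | "pfst n = 2" | "2 < pfst n" by linarith
    then show ?thesis
    proof cases
      case 1
      then show ?thesis
        using order_trans[OF hat[OF pos_rat_pos], of "real (Suc (psnd (psnd b)))"]
        by (simp add: Suc Let_def a_def[symmetric] b_def[symmetric])
    next
      case 2
      then show ?thesis using IH[of a] IH[of b]
        by (simp add: Suc Let_def a_def[symmetric] b_def[symmetric]; linarith)
    next
      case 3
      then show ?thesis using IH[of a] IH[of b]
        by (simp add: Suc Let_def a_def[symmetric] b_def[symmetric]; linarith)
    next
      case 4
      then show ?thesis using lin[of "psnd a" "pfst a"] lin[of "psnd b" "pfst b"]
        by (simp add: Suc Let_def a_def[symmetric] b_def[symmetric]; linarith)
    qed
  qed simp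
qed

lemma ideal_value_perturb:
  assumes D: "\<And>a. \<bar>D a - D' a\<bar> \<le> e"
  shows "\<bar>ideal_value D k - ideal_value D' k\<bar> \<le> real (ideal_bound k) * e"
proof (induction k rule: less_induct)
  case (less k)
  have e: "0 \<le> e" using D[of 0] by linarith
  show ?case
  proof (cases k)
    case 0
    with e show ?thesis by simp
  next
    case (Suc n)
    define a b where "a = pfst (psnd n)" and "b = psnd (psnd n)"
    have IH: "\<bar>ideal_value D j - ideal_value D' j\<bar> \<le> real (ideal_bound j) * e"
      and nonneg: "0 \<le> real (ideal_bound j) * e" if "j \<in> {a, b, psnd a, psnd b}" for j
      using less[of j] that e unfolding a_def b_def Suc by (auto simp: less_Suc_eq_le component_le)
    have lin: "\<bar>real_of_rat (nat_to_rat_surj p) * ideal_value D j - real_of_rat (nat_to_rat_surj p) * ideal_value D' j\<bar>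
        \<le> real (pfst p) * (real (ideal_bound j) * e)" if "j \<in> {psnd a, psnd b}" for p j
      unfolding right_diff_distrib[symmetric] abs_mult
      using IH[of j] that by (intro mult_mono abs_nat_to_rat_surj_le) auto
    consider "pfst n = 0" | "pfst n = 1" | "pfst n = 2" | "2 < pfst n" by linarith
    then show ?thesis
    proof cases
      case 1
      define r q where "r = real_of_rat (nat_to_rat_surj (pfst b))" and "q = real_of_rat (pos_rat (psnd b))"
      have q: "0 < q" "1 / q \<le> real (Suc (psnd (psnd b)))"
        unfolding q_def by (rule pos_rat_pos, rule inverse_pos_rat_le)
      have "\<bar>max 0 (1 - max 0 (D a - r) / q) - max 0 (1 - max 0 (D' a - r) / q)\<bar>
          \<le> \<bar>max 0 (D a - r) / q - max 0 (D' a - r) / q\<bar>" by linarith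
      also have "\<dots> = \<bar>max 0 (D a - r) - max 0 (D' a - r)\<bar> * (1 / q)"
        using q by (simp add: diff_divide_distrib[symmetric])
      also have "\<dots> \<le> e * real (Suc (psnd (psnd b)))"
        using q D[of a] e by (intro mult_mono) auto
      finally show ?thesis
        using 1 by (simp add: Suc Let_def a_def[symmetric] b_def[symmetric] r_def[symmetric] q_def[symmetric] mult.commute)
    next
      case 2
      then show ?thesis using IH[of a] IH[of b] nonneg[of a] nonneg[of b]
        by (simp add: Suc Let_def a_def[symmetric] b_def[symmetric] distrib_right; linarith)
    next
      case 3
      then show ?thesis using IH[of a] IH[of b] nonneg[of a] nonneg[of b]
        by (simp add: Suc Let_def a_def[symmetric] b_def[symmetric] distrib_right; linarith)
    next
      case 4
      then show ?thesis using lin[of "psnd a" "pfst a"] lin[of "psnd b" "pfst b"] e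
        by (simp add: Suc Let_def a_def[symmetric] b_def[symmetric] distrib_right mult.assoc; linarith)
    qed
  qed
qed

lemma abs_ideal_fun_le: "\<bar>ideal_fun s k x\<bar> \<le> real (ideal_bound k)"
  unfolding ideal_fun_eq_value by (rule abs_ideal_value_le)

lemma ideal_fun_lipschitz: "\<bar>ideal_fun s k x - ideal_fun s k y\<bar> \<le> real (ideal_bound k) * dist x y"
  unfolding ideal_fun_eq_value
  by (rule ideal_value_perturb) (metis abs_dist_diff_le dist_commute)

lemma continuous_ideal_fun: "continuous_on UNIV (ideal_fun s k)"
proof -
  have "lipschitz_on (real (ideal_bound k)) UNIV (ideal_fun s k)"
    by (rule lipschitz_onI) (auto simp: dist_real_def ideal_fun_lipschitz)
  then show ?thesis by (rule lipschitz_on_continuous_on)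
qed

lemma borel_measurable_ideal_fun [measurable]: "ideal_fun s k \<in> borel_measurable borel"
  by (rule borel_measurable_continuous_onI) (rule continuous_ideal_fun)

lemma total_recursive_ideal_bound [recursive_intros]:
  assumes "total_recursive F" shows "total_recursive (\<lambda>x. ideal_bound (F x))"
proof -
  define B where "B t n = (if n = 0 then 1 else
     if pfst (n - 1) = 0 then Suc (psnd (psnd (psnd (psnd (n - 1)))))
     else if \<not> (pfst (n - 1) \<noteq> 1 \<and> pfst (n - 1) \<noteq> 2)
     then lookup t n (pfst (psnd (n - 1))) + lookup t n (psnd (psnd (n - 1)))
     else Suc (pfst (pfst (pfst (psnd (n - 1)))) * lookup t n (psnd (pfst (psnd (n - 1))))
       + pfst (pfst (psnd (psnd (n - 1)))) * lookup t n (psnd (psnd (psnd (n - 1))))))" for t n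
  have "total_recursive (\<lambda>z. B (psnd (psnd z)) (pfst (psnd z)))"
    unfolding B_def by (intro recursive_intros)
  then have "computes (\<lambda>x. x) (\<lambda>x. ideal_bound (F x))"
    unfolding total_recursive_iff_computes
  proof (rule computes_course_of_values[where F = "\<lambda>_. ideal_bound" and B = "\<lambda>c n t. B t n" and C = "\<lambda>_. 0" and N = F])
    fix n t assume t: "\<And>m. m < n \<Longrightarrow> lookup t n m = ideal_bound m"
    show "B t n = ideal_bound n"
    proof (cases n)
      case (Suc k)
      then show ?thesis
        using t[of "pfst (psnd k)"] t[of "psnd (psnd k)"] t[of "psnd (pfst (psnd k))"] t[of "psnd (psnd (psnd k))"]
        by (simp add: B_def Let_def less_Suc_eq_le component_le)
    qed (simp add: B_def)
  qed (intro recursive_intros assms)+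
  then show ?thesis by (simp add: total_recursive_iff_computes)
qed

text \<open>
  The code of an ideal function is evaluated by recursion on the code, with the distances \<open>D c\<close> to the
  ideal points given by an algorithm with parameter \<open>c\<close>.
\<close>

lemma rat_recursive_ideal_value:
  assumes D: "rat_recursive (\<lambda>z. D (pfst z) (psnd z))"
    and C: "total_recursive C" and N: "total_recursive N"
  shows "rat_recursive (\<lambda>x. ideal_value (D (C x)) (N x))"
proof -
  define B where "B c n t = (if n = 0 then 1 else
     if pfst (n - 1) = 0 then
       max 0 (1 - max 0 (D c (pfst (psnd (n - 1))) - real_of_rat (nat_to_rat_surj (pfst (psnd (psnd (n - 1)))))) / real_of_rat (pos_rat (psnd (psnd (psnd (n - 1))))))
     else if pfst (n - 1) = 1
     then max (fraction (lookup t n (pfst (psnd (n - 1))))) (fraction (lookup t n (psnd (psnd (n - 1)))))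
     else if pfst (n - 1) = 2
     then min (fraction (lookup t n (pfst (psnd (n - 1))))) (fraction (lookup t n (psnd (psnd (n - 1)))))
     else real_of_rat (nat_to_rat_surj (pfst (pfst (psnd (n - 1))))) * fraction (lookup t n (psnd (pfst (psnd (n - 1)))))
       + real_of_rat (nat_to_rat_surj (pfst (psnd (psnd (n - 1))))) * fraction (lookup t n (psnd (psnd (psnd (n - 1))))))" for c n t
  have D': "rat_recursive (\<lambda>x. D (F x) (G x))" if "total_recursive F" "total_recursive G" for F G
    using computes_comp[OF D total_recursive_pair[OF that]] by simp
  have "rat_recursive (\<lambda>z. B (pfst z) (pfst (psnd z)) (psnd (psnd z)))"
    unfolding B_def by (intro recursive_intros D')
  then show ?thesis
  proof (rule computes_course_of_values[OF _ _ C N])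
    fix c n t assume t: "\<And>m. m < n \<Longrightarrow> fraction (lookup t n m) = ideal_value (D c) m"
    show "B c n t = ideal_value (D c) n"
    proof (cases n)
      case (Suc k)
      then show ?thesis
        using t[of "pfst (psnd k)"] t[of "psnd (psnd k)"] t[of "psnd (pfst (psnd k))"] t[of "psnd (psnd (psnd k))"]
        by (simp add: B_def Let_def less_Suc_eq_le component_le)
    qed (simp add: B_def)
  qed
qed

lemma rat_recursive_sum_list:
  assumes f: "rat_recursive (\<lambda>z. f (pfst z) (psnd z))"
    and C: "total_recursive C" and N: "total_recursive N"
  shows "rat_recursive (\<lambda>x. \<Sum>y\<leftarrow>list_decode (N x). f (C x) y)"
proof -
  define B where "B c n t = (if n = 0 then 0 else f c (pfst (n - 1)) + fraction (lookup t n (psnd (n - 1))))" for c n t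
  have f': "rat_recursive (\<lambda>x. f (F x) (G x))" if "total_recursive F" "total_recursive G" for F G
    using computes_comp[OF f total_recursive_pair[OF that]] by simp
  have "rat_recursive (\<lambda>z. B (pfst z) (pfst (psnd z)) (psnd (psnd z)))"
    unfolding B_def by (intro recursive_intros f')
  then show ?thesis
  proof (rule computes_course_of_values[OF _ _ C N])
    fix c n t assume t: "\<And>m. m < n \<Longrightarrow> fraction (lookup t n m) = (\<Sum>y\<leftarrow>list_decode m. f c y)"
    show "B c n t = (\<Sum>y\<leftarrow>list_decode n. f c y)"
    proof (cases n)
      case (Suc k)
      then show ?thesis
        using t[of "psnd k"] by (simp add: B_def less_Suc_eq_le snd_prod_decode_le split_beta)
    qed (simp add: B_def)
  qed
qed

subsection \<open>Integrals\<close>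

text \<open>
  The integral with respect to an ideal measure is a weighted mean of values at ideal points, hence
  computable up to the error of the values.
\<close>

definition total_weight :: "nat \<Rightarrow> nat" where
  "total_weight n = (\<Sum>(i, w)\<leftarrow>weighted_points n. Suc w)"

definition weighted_mean :: "(nat \<Rightarrow> real) \<Rightarrow> nat \<Rightarrow> real" where
  "weighted_mean v n = (\<Sum>(i, w)\<leftarrow>weighted_points n. real (Suc w) * v i) / real (total_weight n)"

lemma total_weight_pos: "0 < total_weight n"
  by (simp add: total_weight_def weighted_points_def split_beta)

lemma weighted_mean_const: "weighted_mean (\<lambda>_. c) n = c"
proof -
  have "(\<Sum>(i, w)\<leftarrow>ps. real (Suc w) * c) = real (\<Sum>(i, w)\<leftarrow>ps. Suc w) * c" for ps :: "(nat \<times> nat) list"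
    by (induction ps) (auto simp: algebra_simps)
  then have "weighted_mean (\<lambda>_. c) n = real (total_weight n) * c / real (total_weight n)"
    unfolding weighted_mean_def total_weight_def by (simp only:)
  then show ?thesis using total_weight_pos[of n] by simp
qed

lemma weighted_mean_diff: "weighted_mean u n - weighted_mean v n = weighted_mean (\<lambda>i. u i - v i) n"
proof -
  have "(\<Sum>(i, w)\<leftarrow>ps. real (Suc w) * u i) - (\<Sum>(i, w)\<leftarrow>ps. real (Suc w) * v i)
      = (\<Sum>(i, w)\<leftarrow>ps. real (Suc w) * (u i - v i))" for ps :: "(nat \<times> nat) list"
    by (induction ps) (auto simp: algebra_simps)
  then show ?thesis by (simp add: weighted_mean_def diff_divide_distrib[symmetric] del: of_nat_Suc)
qed

lemma weighted_mean_mono: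
  assumes "\<And>i. u i \<le> v i" shows "weighted_mean u n \<le> weighted_mean v n"
  unfolding weighted_mean_def
  by (intro divide_right_mono sum_list_mono) (auto intro!: mult_left_mono assms)

lemma weighted_mean_perturb:
  assumes "\<And>i. \<bar>u i - v i\<bar> \<le> e"
  shows "\<bar>weighted_mean u n - weighted_mean v n\<bar> \<le> e"
  using weighted_mean_mono[of "\<lambda>i. u i - v i" "\<lambda>_. e" n] weighted_mean_mono[of "\<lambda>_. - e" "\<lambda>i. u i - v i" n]
    assms unfolding weighted_mean_diff weighted_mean_const by (simp add: abs_le_iff) (smt (verit))

lemma rat_recursive_weighted_mean:
  assumes v: "rat_recursive (\<lambda>z. v (pfst z) (psnd z))"
    and C: "total_recursive C" and N: "total_recursive N"
  shows "rat_recursive (\<lambda>x. weighted_mean (v (C x)) (N x))"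
proof -
  have v': "rat_recursive (\<lambda>x. v (F x) (G x))" if "total_recursive F" "total_recursive G" for F G
    using computes_comp[OF v total_recursive_pair[OF that]] by simp
  have sum: "rat_recursive (\<lambda>x. \<Sum>(i, w)\<leftarrow>weighted_points (N x). f (C x) i w)"
    if f: "\<And>F G H. total_recursive F \<Longrightarrow> total_recursive G \<Longrightarrow> total_recursive H
      \<Longrightarrow> rat_recursive (\<lambda>x. f (F x) (G x) (H x))" for f :: "nat \<Rightarrow> nat \<Rightarrow> nat \<Rightarrow> real"
  proof -
    have "rat_recursive (\<lambda>x. f (C x) (pfst (pfst (N x))) (psnd (pfst (N x)))
        + (\<Sum>y\<leftarrow>list_decode (psnd (N x)). f (C x) (pfst y) (psnd y)))"
      by (intro recursive_intros f C N rat_recursive_sum_list)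
    then show ?thesis by (simp add: weighted_points_def split_beta comp_def)
  qed
  have "real (\<Sum>(i, w)\<leftarrow>ps. Suc w) = (\<Sum>(i, w)\<leftarrow>ps. real (Suc w))" for ps :: "(nat \<times> nat) list"
    by (induction ps) auto
  then have weight: "real (total_weight n) = (\<Sum>(i, w)\<leftarrow>weighted_points n. real (Suc w))" for n
    by (simp only: total_weight_def)
  show ?thesis unfolding weighted_mean_def weight by (intro recursive_intros sum v')
qed

text \<open>
  An ideal measure is the image of a weighted point measure on the positions of its list. This
  represents it as a measure whose integrals are known to be finite sums.
\<close>

lemma integral_ideal_measure:
  fixes s :: "nat \<Rightarrow> 'a::metric_space" and u :: "'a \<Rightarrow> real"
  assumes u: "u \<in> borel_measurable borel"
  shows "(\<integral>x. u x \<partial>ideal_measure s n) = weighted_mean (\<lambda>i. u (s i)) n"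
    and "prob_space (ideal_measure s n)" and "sets (ideal_measure s n) = sets borel"
proof -
  define ps where "ps = weighted_points n"
  define l where "l = length ps"
  define W where "W = real (total_weight n)"
  have W: "0 < W" by (simp add: W_def total_weight_pos)
  define wt where "wt j = real (Suc (snd (ps ! j))) / W" for j
  define pt where "pt j = s (fst (ps ! j))" for j
  have nonneg: "0 \<le> wt j" for j using W by (simp add: wt_def)
  define P where "P = point_measure {..<l} (\<lambda>j. ennreal (wt j))"
  define N where "N = distr P borel pt"
  have sum_nth: "(\<Sum>p\<leftarrow>ps. g p) = (\<Sum>j<l. g (ps ! j))" for g :: "nat \<times> nat \<Rightarrow> 'z::comm_monoid_add"
    by (simp add: sum_list_sum_nth l_def atLeast0LessThan)
  have pt: "pt \<in> measurable P borel" by (simp add: P_def)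
  have N: "emeasure N A = (\<Sum>(i, w)\<leftarrow>ps. ennreal (real (Suc w) / W) * emeasure (return borel (s i)) A)"
    if A: "A \<in> sets borel" for A
  proof -
    have "emeasure N A = emeasure P (pt -` A \<inter> {..<l})"
      using A pt by (simp add: N_def emeasure_distr P_def space_point_measure)
    also have "\<dots> = (\<Sum>j\<in>pt -` A \<inter> {..<l}. ennreal (wt j))"
      unfolding P_def by (rule emeasure_point_measure_finite2) auto
    also have "\<dots> = (\<Sum>j<l. ennreal (wt j) * indicator A (pt j))"
      by (intro sum.mono_neutral_cong_left) (auto simp: indicator_def)
    also have "\<dots> = (\<Sum>p\<leftarrow>ps. ennreal (real (Suc (snd p)) / W) * emeasure (return borel (s (fst p))) A)"
      using A by (simp add: sum_nth wt_def pt_def del: of_nat_Suc)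
    finally show ?thesis by (simp only: case_prod_unfold)
  qed
  have "ideal_measure s n = measure_of UNIV (sets borel) (emeasure N)"
    unfolding ideal_measure_def Let_def ps_def[symmetric]
    by (rule measure_of_eq) (auto simp: N W_def total_weight_def ps_def[symmetric] sets.sigma_sets_eq[of borel, simplified])
  also have "\<dots> = N"
    using measure_of_of_measure[of N] by (simp add: N_def)
  finally have eq: "ideal_measure s n = N" .
  show "sets (ideal_measure s n) = sets borel" by (simp add: eq N_def)
  have sum_wt: "(\<Sum>j<l. wt j) = 1"
  proof -
    have "(\<Sum>j<l. wt j) = (\<Sum>p\<leftarrow>ps. real (Suc (snd p)) * 1) / W"
      by (simp add: wt_def sum_nth sum_divide_distrib del: of_nat_Suc)
    also have "\<dots> = weighted_mean (\<lambda>_. 1) n"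
      unfolding weighted_mean_def ps_def W_def by (simp only: case_prod_unfold)
    finally show ?thesis by (simp only: weighted_mean_const)
  qed
  have "emeasure P (space P) = (\<Sum>j<l. ennreal (wt j))"
    by (simp add: P_def space_point_measure emeasure_point_measure_finite2)
  also have "\<dots> = 1" using nonneg by (simp add: sum_ennreal sum_wt)
  finally have "prob_space P" by (rule prob_spaceI)
  then show "prob_space (ideal_measure s n)"
    unfolding eq N_def by (rule prob_space.prob_space_distr[OF _ pt])
  have "(\<integral>x. u x \<partial>N) = (\<integral>j. u (pt j) \<partial>P)"
    unfolding N_def by (rule integral_distr[OF pt u])
  also have "\<dots> = (\<Sum>j<l. wt j * u (pt j))"
    unfolding P_def using nonneg by (subst lebesgue_integral_point_measure_finite) auto
  also have "\<dots> = (\<Sum>p\<leftarrow>ps. real (Suc (snd p)) * u (s (fst p))) / W"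
    by (simp add: wt_def pt_def sum_nth sum_divide_distrib del: of_nat_Suc)
  finally show "(\<integral>x. u x \<partial>ideal_measure s n) = weighted_mean (\<lambda>i. u (s i)) n"
    unfolding eq weighted_mean_def ps_def W_def by (simp only: case_prod_unfold)
qed

lemma integral_near_value:
  fixes u :: "'a::metric_space \<Rightarrow> real"
  assumes "prob_space N" and sets: "sets N = sets borel"
    and u: "u \<in> borel_measurable borel" and near: "\<And>x. \<bar>u x - c\<bar> \<le> e"
  shows "\<bar>(\<integral>x. u x \<partial>N) - c\<bar> \<le> e"
proof -
  interpret prob_space N by fact
  have [measurable]: "u \<in> borel_measurable N" using u by (simp add: measurable_cong_sets[OF sets refl])
  have bound: "norm (u x) \<le> \<bar>c\<bar> + e" for x using near[of x] by simp
  have int: "integrable N u" by (rule integrable_const_bound[of _ "\<bar>c\<bar> + e"]) (use bound in auto)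
  have "(\<integral>x. u x \<partial>N) \<le> (\<integral>x. c + e \<partial>N)" "(\<integral>x. c - e \<partial>N) \<le> (\<integral>x. u x \<partial>N)"
    using near int by (intro integral_mono; force simp: abs_le_iff algebra_simps)+
  then show ?thesis by (simp add: prob_space abs_le_iff)
qed

text \<open>
  A positive multiple of \<open>u\<close> competes in the supremum that defines the distance. Boundedness of the
  space makes the supremum finite, since a \<open>1\<close>-Lipschitz function is then close to its value at
  a fixed point.
\<close>

lemma integral_diff_le_W1:
  fixes u :: "'a::metric_space \<Rightarrow> real"
  assumes bdd: "bounded (UNIV :: 'a set)"
    and M: "prob_space M" "sets M = sets borel" and N: "prob_space N" "sets N = sets borel"
    and L: "0 < L" and lip: "\<And>x y. \<bar>u x - u y\<bar> \<le> L * dist x y"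
  shows "\<bar>(\<integral>x. u x \<partial>M) - (\<integral>x. u x \<partial>N)\<bar> \<le> L * W1 M N"
proof -
  obtain x0 :: 'a and e where e: "\<And>y. dist x0 y \<le> e" using bdd by (auto simp: bounded_def)
  define F where "F f = \<bar>(\<integral>x. f x \<partial>M) - (\<integral>x. f x \<partial>N)\<bar>" for f :: "'a \<Rightarrow> real"
  have bound: "F f \<le> 2 * e" if f: "1-lipschitz_on UNIV f" for f
  proof -
    have "f \<in> borel_measurable borel"
      using f by (intro borel_measurable_continuous_onI lipschitz_on_continuous_on)
    moreover have "\<bar>f x - f x0\<bar> \<le> e" for x
      using lipschitz_onD[OF f, of x x0] e[of x] by (simp add: dist_real_def dist_commute)
    ultimately have "\<bar>(\<integral>x. f x \<partial>M) - f x0\<bar> \<le> e" "\<bar>(\<integral>x. f x \<partial>N) - f x0\<bar> \<le> e"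
      using M N by (intro integral_near_value; blast)+
    then show ?thesis unfolding F_def by linarith
  qed
  have "1-lipschitz_on UNIV (\<lambda>x. u x / L)"
  proof (rule lipschitz_onI)
    fix x y
    have "dist (u x / L) (u y / L) = \<bar>u x - u y\<bar> / L"
      using L by (simp add: dist_real_def diff_divide_distrib[symmetric])
    then show "dist (u x / L) (u y / L) \<le> 1 * dist x y"
      using lip[of x y] L by (simp add: divide_le_eq mult.commute)
  qed simp
  then have "F (\<lambda>x. u x / L) \<le> W1 M N"
    unfolding W1_def F_def[symmetric] using bound by (intro cSUP_upper) (auto intro!: bdd_aboveI2)
  moreover have "F u = L * F (\<lambda>x. u x / L)"
    using L by (simp add: F_def diff_divide_distrib[symmetric])
  ultimately show ?thesis using L unfolding F_def[symmetric] by simp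
qed

text \<open>
  A computable probability space with its algorithms fixed: \<open>d i j n\<close> approximates the distance of two
  ideal points, and \<open>\<nu> n\<close> is the number of an ideal measure near \<open>\<mu>\<close>, both up to \<open>(1/2) ^ n\<close>.
\<close>

locale computable_space =
  fixes s :: "nat \<Rightarrow> 'a::{metric_space, second_countable_topology}"
    and \<mu> :: "'a measure"
    and d :: "nat \<Rightarrow> nat \<Rightarrow> nat \<Rightarrow> real"
    and \<nu> :: "nat \<Rightarrow> nat"
  assumes dense: "closure (range s) = UNIV"
    and d_recursive: "total_recursive F \<Longrightarrow> total_recursive G \<Longrightarrow> total_recursive H
      \<Longrightarrow> rat_recursive (\<lambda>x. d (F x) (G x) (H x))"
    and d_approx: "\<bar>d i j n - dist (s i) (s j)\<bar> \<le> (1/2) ^ n"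
    and bounded: "bounded (UNIV :: 'a set)"
    and prob: "prob_space \<mu>" and sets_\<mu>: "sets \<mu> = sets borel"
    and \<nu>_recursive: "total_recursive \<nu>"
    and \<nu>_approx: "W1 (ideal_measure s (\<nu> n)) \<mu> \<le> (1/2) ^ n"
begin

lemma space_\<mu> [simp]: "space \<mu> = UNIV"
  using sets_eq_imp_space_eq[OF sets_\<mu>] by simp

lemma measurable_\<mu>: "f \<in> borel_measurable borel \<Longrightarrow> f \<in> borel_measurable \<mu>"
  by (simp add: measurable_cong_sets[OF sets_\<mu> refl])

lemma ideal_fun_measurable [measurable]: "ideal_fun s k \<in> borel_measurable \<mu>"
  by (rule measurable_\<mu>) simp

lemma integrable_ideal_fun: "integrable \<mu> (ideal_fun s k)"
proof -
  interpret prob_space \<mu> by (rule prob)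
  show ?thesis by (rule integrable_const_bound[of _ "real (ideal_bound k)"]) (auto simp: abs_ideal_fun_le)
qed

definition approx_value :: "nat \<Rightarrow> nat \<Rightarrow> nat \<Rightarrow> real" where
  "approx_value k i n = ideal_value (\<lambda>a. d i a n) k"

lemma approx_value: "\<bar>approx_value k i n - ideal_fun s k (s i)\<bar> \<le> real (ideal_bound k) * (1/2) ^ n"
  unfolding approx_value_def ideal_fun_eq_value by (rule ideal_value_perturb) (rule d_approx)

lemma rat_recursive_approx_value [recursive_intros]:
  assumes "total_recursive F" "total_recursive G" "total_recursive H"
  shows "rat_recursive (\<lambda>x. approx_value (F x) (G x) (H x))"
proof -
  have "rat_recursive (\<lambda>x. ideal_value (\<lambda>a. d (pfst (pair (G x) (H x))) a (psnd (pair (G x) (H x)))) (F x))"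
    by (rule rat_recursive_ideal_value[where D = "\<lambda>c a. d (pfst c) a (psnd c)"])
      (intro d_recursive recursive_intros assms)+
  then show ?thesis by (simp add: approx_value_def)
qed

definition approx_integral :: "nat \<Rightarrow> nat \<Rightarrow> real" where
  "approx_integral k n = weighted_mean (\<lambda>i. approx_value k i n) (\<nu> n)"

definition integral_error :: "nat \<Rightarrow> nat \<Rightarrow> real" where
  "integral_error k n = 2 * real (ideal_bound k) * (1/2) ^ n"

text \<open>
  One half of the error comes from replacing \<open>\<mu>\<close> by an ideal measure, the other from the approximate
  values at ideal points; the Lipschitz constant controls both.
\<close>

lemma approx_integral: "\<bar>approx_integral k n - (\<integral>x. ideal_fun s k x \<partial>\<mu>)\<bar> \<le> integral_error k n"
proof -
  let ?N = "ideal_measure s (\<nu> n)"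
  have "\<bar>(\<integral>x. ideal_fun s k x \<partial>?N) - (\<integral>x. ideal_fun s k x \<partial>\<mu>)\<bar> \<le> real (ideal_bound k) * W1 ?N \<mu>"
    by (intro integral_diff_le_W1 bounded prob sets_\<mu> ideal_fun_lipschitz
        integral_ideal_measure(2,3)[OF borel_measurable_ideal_fun]) (simp add: ideal_bound_pos)
  also have "\<dots> \<le> real (ideal_bound k) * (1/2) ^ n" by (intro mult_left_mono \<nu>_approx) simp
  finally have "\<bar>(\<integral>x. ideal_fun s k x \<partial>?N) - (\<integral>x. ideal_fun s k x \<partial>\<mu>)\<bar> \<le> real (ideal_bound k) * (1/2) ^ n" .
  moreover have "\<bar>approx_integral k n - (\<integral>x. ideal_fun s k x \<partial>?N)\<bar> \<le> real (ideal_bound k) * (1/2) ^ n"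
    unfolding approx_integral_def integral_ideal_measure(1)[OF borel_measurable_ideal_fun]
    by (rule weighted_mean_perturb) (rule approx_value)
  ultimately show ?thesis unfolding integral_error_def by linarith
qed

lemma integral_error_tendsto: "(\<lambda>n. integral_error k n) \<longlonglongrightarrow> 0"
  unfolding integral_error_def by (intro tendsto_mult_right_zero LIMSEQ_power_zero) simp

lemma rat_recursive_approx_integral [recursive_intros]:
  assumes "total_recursive F" "total_recursive H"
  shows "rat_recursive (\<lambda>x. approx_integral (F x) (H x))"
proof -
  have "rat_recursive (\<lambda>x. weighted_mean (\<lambda>i. approx_value (pfst (pair (F x) (H x))) i (psnd (pair (F x) (H x)))) (\<nu> (H x)))"
    by (rule rat_recursive_weighted_mean[where v = "\<lambda>c i. approx_value (pfst c) i (psnd c)"])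
      (intro recursive_intros total_recursive_comp[OF \<nu>_recursive] assms)+
  then show ?thesis by (simp add: approx_integral_def)
qed

lemma rat_recursive_integral_error [recursive_intros]:
  "total_recursive F \<Longrightarrow> total_recursive H \<Longrightarrow> rat_recursive (\<lambda>x. integral_error (F x) (H x))"
  unfolding integral_error_def by (intro recursive_intros)

end

section \<open>Lower approximations of Birkhoff sums by ideal functions\<close>

definition lin_code :: "nat \<Rightarrow> nat \<Rightarrow> nat \<Rightarrow> nat \<Rightarrow> nat" where
  "lin_code p u q v = Suc (pair 3 (pair (pair p u) (pair q v)))"

definition max_code :: "nat \<Rightarrow> nat \<Rightarrow> nat" where
  "max_code u v = Suc (pair 1 (pair u v))"

definition hat_code :: "nat \<Rightarrow> nat \<Rightarrow> nat \<Rightarrow> nat" where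
  "hat_code a r q = Suc (pair 0 (pair a (pair r q)))"

text \<open>
  In the numbering of the rationals by numerator and denominator the even number \<open>2 * n\<close> codes the
  integer \<open>n\<close>, so \<open>2\<close> is the denominator \<open>1\<close>, while the odd number \<open>1\<close> codes \<open>-1\<close>.
\<close>

definition rat_code :: "nat \<Rightarrow> nat" where
  "rat_code n = pair (2 * n) 2"

definition minus_one_code :: nat where
  "minus_one_code = pair 1 2"

definition zero_code :: nat where
  "zero_code = lin_code (rat_code 0) 0 (rat_code 0) 0"

lemma rat_code [simp]: "real_of_rat (nat_to_rat_surj (rat_code n)) = real n"
  by (simp add: rat_code_def real_nat_to_rat_surj int_decode_nat)

lemma minus_one_code [simp]: "real_of_rat (nat_to_rat_surj minus_one_code) = - 1"
  by (simp add: minus_one_code_def real_nat_to_rat_surj int_decode_nat)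

lemma ideal_fun_lin_code [simp]: "ideal_fun s (lin_code p u q v) x =
    real_of_rat (nat_to_rat_surj p) * ideal_fun s u x + real_of_rat (nat_to_rat_surj q) * ideal_fun s v x"
  by (simp add: lin_code_def)

lemma ideal_fun_max_code [simp]: "ideal_fun s (max_code u v) x = max (ideal_fun s u x) (ideal_fun s v x)"
  by (simp add: max_code_def)

lemma ideal_fun_hat_code [simp]:
  "ideal_fun s (hat_code a r q) x = hat (s a) (real_of_rat (nat_to_rat_surj r)) (real_of_rat (pos_rat q)) x"
  by (simp add: hat_code_def)

lemma ideal_fun_zero_code [simp]: "ideal_fun s zero_code x = 0"
  by (simp add: zero_code_def)

lemma total_recursive_lin_code [recursive_intros]:
  "total_recursive P \<Longrightarrow> total_recursive U \<Longrightarrow> total_recursive Q \<Longrightarrow> total_recursive V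
    \<Longrightarrow> total_recursive (\<lambda>x. lin_code (P x) (U x) (Q x) (V x))"
  unfolding lin_code_def by (intro recursive_intros)

lemma total_recursive_max_code [recursive_intros]:
  "total_recursive U \<Longrightarrow> total_recursive V \<Longrightarrow> total_recursive (\<lambda>x. max_code (U x) (V x))"
  unfolding max_code_def by (intro recursive_intros)

lemma total_recursive_hat_code [recursive_intros]:
  "total_recursive U \<Longrightarrow> total_recursive V \<Longrightarrow> total_recursive W
    \<Longrightarrow> total_recursive (\<lambda>x. hat_code (U x) (V x) (W x))"
  unfolding hat_code_def by (intro recursive_intros)

lemma total_recursive_rat_code [recursive_intros]:
  "total_recursive U \<Longrightarrow> total_recursive (\<lambda>x. rat_code (U x))"
  unfolding rat_code_def by (intro recursive_intros)

lemma hat_le_1: "0 < q \<Longrightarrow> hat p r q x \<le> 1" and hat_nonneg: "0 \<le> hat p r q x"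
  by (auto simp: hat_def)

lemma hat_eq_0: "0 < q \<Longrightarrow> r + q \<le> dist x p \<Longrightarrow> hat p r q x = 0"
  by (simp add: hat_def le_divide_eq)

lemma hat_eq_1: "dist x p \<le> r \<Longrightarrow> hat p r q x = 1"
  by (simp add: hat_def)

lemma rat_between:
  assumes "x < y" obtains n where "x < real_of_rat (nat_to_rat_surj n)" "real_of_rat (nat_to_rat_surj n) < y"
  using of_rat_dense[OF assms] surj_nat_to_rat_surj by (metis surjD)

lemma pos_rat_below:
  assumes "0 < x" obtains n where "real_of_rat (pos_rat n) < x"
proof -
  obtain q :: rat where q: "0 < real_of_rat q" "real_of_rat q < x" using of_rat_dense[OF assms] by blast
  then have "q \<in> range pos_rat" unfolding range_pos_rat by simp
  then show ?thesis using q that by auto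
qed

text \<open>
  The ergodic map together with the set \<open>D\<close> of full measure on which it is computable: \<open>e i\<close> enumerates
  ideal balls which on \<open>D\<close> exhaust the preimage of the ideal ball \<open>i\<close>.
\<close>

locale computable_map = computable_space s \<mu> d \<nu> + ergodic_map \<mu> T
  for s :: "nat \<Rightarrow> 'a::{metric_space, second_countable_topology}" and \<mu> d \<nu> T +
  fixes D :: "'a set" and e :: "nat \<Rightarrow> nat \<Rightarrow> nat"
  assumes e_recursive: "total_recursive F \<Longrightarrow> total_recursive G \<Longrightarrow> total_recursive (\<lambda>x. e (F x) (G x))"
    and preimage: "T -` ideal_ball s i \<inter> D = \<Union>{ideal_ball s k | k. \<exists>n. e i n = Suc k} \<inter> D"
    and AE_D: "AE x in \<mu>. x \<in> D"
begin

text \<open>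
  An entry is a number coding six others: a height \<open>c\<close>, the radius \<open>r\<close> and the width \<open>q\<close> of a hat,
  a ball \<open>i\<close>, a stage \<open>n\<close> at which a ball inside its preimage is enumerated, and a precision \<open>m\<close>.
  It is valid for \<open>w\<close> if the hat around the center of the enumerated ball vanishes outside that ball,
  and if \<open>c\<close> is seen, with precision \<open>m\<close>, to be a lower bound of \<open>w\<close> on the ball \<open>i\<close>. The
  multiple by \<open>c\<close> of the hat then lies below \<open>w \<circ> T\<close> if \<open>w\<close> is nonnegative.
\<close>

abbreviation "ent_c z \<equiv> pfst z"
abbreviation "ent_r z \<equiv> pfst (psnd z)"
abbreviation "ent_q z \<equiv> pfst (psnd (psnd z))"
abbreviation "ent_i z \<equiv> pfst (psnd (psnd (psnd z)))"
abbreviation "ent_n z \<equiv> pfst (psnd (psnd (psnd (psnd z))))"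
abbreviation "ent_m z \<equiv> psnd (psnd (psnd (psnd (psnd z))))"

definition ent_ball :: "nat \<Rightarrow> nat" where
  "ent_ball z = e (ent_i z) (ent_n z) - 1"

definition valid :: "nat \<Rightarrow> nat \<Rightarrow> bool" where
  "valid w z \<longleftrightarrow> 0 < e (ent_i z) (ent_n z)
     \<and> real_of_rat (nat_to_rat_surj (ent_r z)) + real_of_rat (pos_rat (ent_q z))
         \<le> real_of_rat (pos_rat (psnd (ent_ball z)))
     \<and> real_of_rat (nat_to_rat_surj (ent_c z))
         \<le> approx_value w (pfst (ent_i z)) (ent_m z)
           - real (ideal_bound w) * ((1/2) ^ ent_m z + real_of_rat (pos_rat (psnd (ent_i z))))"

definition ent_code :: "nat \<Rightarrow> nat" where
  "ent_code z = lin_code (ent_c z) (hat_code (pfst (ent_ball z)) (ent_r z) (ent_q z)) (rat_code 0) 0"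

lemma total_recursive_ent_code [recursive_intros]:
  "total_recursive F \<Longrightarrow> total_recursive (\<lambda>x. ent_code (F x))"
  unfolding ent_code_def ent_ball_def by (intro recursive_intros e_recursive)

lemma decidable_valid [recursive_intros]:
  "total_recursive G \<Longrightarrow> total_recursive F \<Longrightarrow> decidable (\<lambda>x. valid (G x) (F x))"
  unfolding valid_def ent_ball_def by (intro recursive_intros e_recursive)

lemma mem_ideal_ball: "x \<in> ideal_ball s k \<longleftrightarrow> dist x (s (pfst k)) < real_of_rat (pos_rat (psnd k))"
  by (simp add: ideal_ball_def split_beta dist_commute)

lemma ent_code_le:
  assumes z: "valid w z" and x: "x \<in> D" and w: "\<And>y. 0 \<le> ideal_fun s w y"
  shows "ideal_fun s (ent_code z) x \<le> ideal_fun s w (T x)"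
proof -
  define c h where "c = real_of_rat (nat_to_rat_surj (ent_c z))"
    and "h = hat (s (pfst (ent_ball z))) (real_of_rat (nat_to_rat_surj (ent_r z))) (real_of_rat (pos_rat (ent_q z))) x"
  have h: "0 \<le> h" "h \<le> 1" unfolding h_def by (rule hat_nonneg, rule hat_le_1[OF pos_rat_pos])
  have "c * h \<le> ideal_fun s w (T x)"
  proof (cases "x \<in> ideal_ball s (ent_ball z)")
    case True
    have "e (ent_i z) (ent_n z) = Suc (ent_ball z)" using z by (simp add: valid_def ent_ball_def)
    then have "T x \<in> ideal_ball s (ent_i z)" using True x preimage[of "ent_i z"] by blast
    then have dist: "dist (T x) (s (pfst (ent_i z))) < real_of_rat (pos_rat (psnd (ent_i z)))"
      by (simp add: mem_ideal_ball)
    have "c \<le> approx_value w (pfst (ent_i z)) (ent_m z)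
           - real (ideal_bound w) * ((1/2) ^ ent_m z + real_of_rat (pos_rat (psnd (ent_i z))))"
      using z by (simp add: valid_def c_def)
    moreover have "real (ideal_bound w) * dist (T x) (s (pfst (ent_i z)))
        \<le> real (ideal_bound w) * real_of_rat (pos_rat (psnd (ent_i z)))"
      using dist by (intro mult_left_mono) auto
    ultimately have "c \<le> ideal_fun s w (T x)"
      using approx_value[of w "pfst (ent_i z)" "ent_m z"] ideal_fun_lipschitz[of s w "T x" "s (pfst (ent_i z))"]
      by (simp add: distrib_left abs_le_iff)
    moreover have "c * h \<le> max 0 c"
      using h mult_left_mono[of h 1 c] mult_nonpos_nonneg[of c h] by (cases "0 \<le> c") auto
    ultimately show ?thesis using w[of "T x"] by linarith
  next
    case False
    then have "real_of_rat (nat_to_rat_surj (ent_r z)) + real_of_rat (pos_rat (ent_q z)) \<le> dist x (s (pfst (ent_ball z)))"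
      using z by (simp add: valid_def mem_ideal_ball)
    then have "h = 0" unfolding h_def by (intro hat_eq_0 pos_rat_pos)
    then show ?thesis using w[of "T x"] by simp
  qed
  then show ?thesis by (simp add: ent_code_def c_def h_def)
qed

text \<open>
  Conversely the valid entries come arbitrarily close to \<open>w \<circ> T\<close> at every point \<open>x\<close> of \<open>D\<close>: take a
  ball around \<open>T x\<close> so small that \<open>w\<close> hardly varies on it, and a hat that is \<open>1\<close> at \<open>x\<close> inside
  an enumerated ball containing \<open>x\<close>.
\<close>

lemma ent_code_dense:
  assumes x: "x \<in> D" and \<gamma>: "0 < \<gamma>"
  shows "\<exists>z. valid w z \<and> ideal_fun s w (T x) - \<gamma> < ideal_fun s (ent_code z) x"
proof -
  define K where "K = real (ideal_bound w)"
  have K: "0 < K" by (simp add: K_def ideal_bound_pos)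
  \<comment> \<open>Two errors of the approximate value and two of the radius, each below a quarter of \<open>\<gamma>\<close>.\<close>
  obtain m where m: "(1/2) ^ m < \<gamma> / (4 * K)"
    using real_arch_pow_inv[of "\<gamma> / (4 * K)" "1/2"] \<gamma> K by auto
  obtain j where j: "real_of_rat (pos_rat j) < \<gamma> / (4 * K)"
    using pos_rat_below[of "\<gamma> / (4 * K)"] \<gamma> K by auto
  have "T x \<in> closure (range s)" using dense by simp
  then obtain a where a: "dist (s a) (T x) < real_of_rat (pos_rat j)"
    using pos_rat_pos[of j] unfolding closure_approachable by blast
  define i where "i = pair a j"
  have "T x \<in> ideal_ball s i" using a by (simp add: mem_ideal_ball i_def dist_commute)
  then obtain k n where k: "x \<in> ideal_ball s k" and n: "e i n = Suc k" using preimage[of i] x by blast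
  obtain r where r: "dist x (s (pfst k)) < real_of_rat (nat_to_rat_surj r)"
      "real_of_rat (nat_to_rat_surj r) < real_of_rat (pos_rat (psnd k))"
    using k rat_between unfolding mem_ideal_ball by blast
  obtain q where q: "real_of_rat (pos_rat q) < real_of_rat (pos_rat (psnd k)) - real_of_rat (nat_to_rat_surj r)"
    using pos_rat_below[of "real_of_rat (pos_rat (psnd k)) - real_of_rat (nat_to_rat_surj r)"] r(2) by auto
  define B where "B = approx_value w a m - K * ((1/2) ^ m + real_of_rat (pos_rat j))"
  have "ideal_fun s w (T x) - \<gamma> < B"
  proof -
    have "K * dist (T x) (s a) \<le> K * real_of_rat (pos_rat j)"
      using K a by (simp add: dist_commute)
    moreover have "K * (1/2) ^ m < \<gamma> / 4" "K * real_of_rat (pos_rat j) < \<gamma> / 4"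
      using m j K by (simp_all add: field_simps)
    ultimately show ?thesis
      using approx_value[of w a m] ideal_fun_lipschitz[of s w "T x" "s a"]
      unfolding B_def K_def[symmetric] distrib_left abs_le_iff by linarith
  qed
  then obtain c where c: "ideal_fun s w (T x) - \<gamma> < real_of_rat (nat_to_rat_surj c)" "real_of_rat (nat_to_rat_surj c) < B"
    by (rule rat_between)
  define z where "z = pair c (pair r (pair q (pair i (pair n m))))"
  have "valid w z"
    using q c(2) n by (simp add: valid_def z_def ent_ball_def i_def B_def K_def)
  moreover have "ideal_fun s (ent_code z) x = real_of_rat (nat_to_rat_surj c)"
    using r(1) n by (simp add: ent_code_def z_def ent_ball_def hat_eq_1)
  ultimately show ?thesis using c(1) by auto
qed

text \<open>
  A program is a coded list of instructions for a state \<open>(p, w, v)\<close>. The instruction \<open>Suc z\<close> raises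
  \<open>v\<close> to the maximum with the entry \<open>z\<close>, provided that the entry is valid for \<open>w\<close>; the instruction
  \<open>0\<close> replaces the state by \<open>(p + 1, u + v, 0)\<close>. No program can violate the invariant that
  \<open>v \<le> w \<circ> T\<close> and that \<open>w\<close> is at most the Birkhoff sum of \<open>u\<close> of length \<open>p\<close>, and since \<open>T\<close>
  preserves the measure the quality of the approximation is visible from integrals of ideal functions.
\<close>

definition step :: "nat \<Rightarrow> nat \<Rightarrow> nat \<Rightarrow> nat" where
  "step u instr st =
     (if instr = 0
      then pair (Suc (pfst st)) (pair (lin_code (rat_code 1) u (rat_code 1) (psnd (psnd st))) zero_code)
      else if valid (pfst (psnd st)) (instr - 1)
      then pair (pfst st) (pair (pfst (psnd st)) (max_code (ent_code (instr - 1)) (psnd (psnd st))))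
      else st)"

function run :: "nat \<Rightarrow> nat \<Rightarrow> nat" where
  "run u 0 = pair 0 (pair zero_code zero_code)"
| "run u (Suc n) = step u (pfst n) (run u (psnd n))"
  by pat_completeness auto

termination run
  by (relation "inv_image less_than snd") (auto simp: less_Suc_eq_le snd_prod_decode_le)

lemma total_recursive_run [recursive_intros]:
  assumes U: "total_recursive U" and N: "total_recursive N"
  shows "total_recursive (\<lambda>x. run (U x) (N x))"
proof -
  define B where "B u n t = (if n = 0 then pair 0 (pair zero_code zero_code)
     else step u (pfst (n - 1)) (lookup t n (psnd (n - 1))))" for u n t
  have "total_recursive (\<lambda>z. B (pfst z) (pfst (psnd z)) (psnd (psnd z)))"
    unfolding B_def step_def by (intro recursive_intros)
  then show ?thesis
    unfolding total_recursive_iff_computes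
  proof (rule computes_course_of_values[OF _ _ U N])
    fix u n t assume t: "\<And>m. m < n \<Longrightarrow> lookup t n m = run u m"
    show "B u n t = run u n"
      using t[of "psnd (n - 1)"] by (cases n) (simp_all add: B_def less_Suc_eq_le snd_prod_decode_le)
  qed
qed

text \<open>
  The nonnegativity conditions belong to the invariant because a hat vanishes outside its ball: there
  it lies below \<open>w \<circ> T\<close> only if \<open>w\<close> is nonnegative.
\<close>

definition sound :: "nat \<Rightarrow> nat \<Rightarrow> bool" where
  "sound u st \<longleftrightarrow> (let p = pfst st; w = pfst (psnd st); v = psnd (psnd st) in
     (\<forall>x. 0 \<le> ideal_fun s w x) \<and> (\<forall>x. 0 \<le> ideal_fun s v x)
     \<and> (AE x in \<mu>. ideal_fun s v x \<le> ideal_fun s w (T x))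
     \<and> (AE x in \<mu>. ideal_fun s w x \<le> birkhoff_sum T (ideal_fun s u) p x))"

lemma sound_step:
  assumes u: "\<And>x. 0 \<le> ideal_fun s u x" and st: "sound u st"
  shows "sound u (step u instr st)"
proof -
  obtain p w v where st_def: "st = pair p (pair w v)" by (metis prod_decode_inverse surj_pair)
  have w: "\<And>x. 0 \<le> ideal_fun s w x" and v: "\<And>x. 0 \<le> ideal_fun s v x"
    and vw: "AE x in \<mu>. ideal_fun s v x \<le> ideal_fun s w (T x)"
    and wS: "AE x in \<mu>. ideal_fun s w x \<le> birkhoff_sum T (ideal_fun s u) p x"
    using st by (auto simp: sound_def st_def)
  consider "instr = 0" | "instr \<noteq> 0" "valid w (instr - 1)" | "instr \<noteq> 0" "\<not> valid w (instr - 1)" by blast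
  then show ?thesis
  proof cases
    case 1
    have "AE x in \<mu>. ideal_fun s u x + ideal_fun s v x \<le> birkhoff_sum T (ideal_fun s u) (Suc p) x"
      using vw AE_T[OF wS] by eventually_elim (simp add: birkhoff_sum_Suc)
    then show ?thesis using 1 u v by (simp add: step_def st_def sound_def)
  next
    case 2
    have "AE x in \<mu>. ideal_fun s (ent_code (instr - 1)) x \<le> ideal_fun s w (T x)"
      using AE_D by eventually_elim (rule ent_code_le[OF 2(2) _ w])
    then show ?thesis using 2 w v vw wS by (simp add: step_def st_def sound_def le_max_iff_disj)
  next
    case 3
    then show ?thesis using st by (simp add: step_def st_def)
  qed
qed

lemma sound_run:
  assumes "\<And>x. 0 \<le> ideal_fun s u x"
  shows "sound u (run u n)"
proof (induction n rule: less_induct)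
  case (less n)
  show ?case
  proof (cases n)
    case 0
    then show ?thesis by (simp add: sound_def)
  next
    case (Suc k)
    then show ?thesis
      using less[of "psnd k"] sound_step[OF assms] by (simp add: less_Suc_eq_le snd_prod_decode_le)
  qed
qed

subsection \<open>Completeness of programs\<close>

text \<open>
  For fixed \<open>w\<close> the maxima of the first valid entries increase to \<open>w \<circ> T\<close> on \<open>D\<close>, so their integrals
  tend to the integral of \<open>w \<circ> T\<close>, which is that of \<open>w\<close>. A program can therefore perform each
  step with an arbitrarily small loss.
\<close>

primrec max_entries :: "nat \<Rightarrow> nat \<Rightarrow> nat" where
  "max_entries w 0 = zero_code"
| "max_entries w (Suc N) = (if valid w N then max_code (ent_code N) (max_entries w N) else max_entries w N)"

lemma run_max_entries:
  assumes "run u n = pair p (pair w zero_code)"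
  shows "\<exists>n'. run u n' = pair p (pair w (max_entries w N))"
proof (induction N)
  case (Suc N)
  then obtain n' where "run u n' = pair p (pair w (max_entries w N))" by blast
  then have "run u (Suc (pair (Suc N) n')) = pair p (pair w (max_entries w (Suc N)))"
    by (simp add: step_def)
  then show ?case by blast
qed (use assms in auto)

lemma max_entries_tendsto:
  assumes w: "\<And>y. 0 \<le> ideal_fun s w y"
  shows "(\<lambda>N. \<integral>x. ideal_fun s (max_entries w N) x \<partial>\<mu>) \<longlonglongrightarrow> (\<integral>x. ideal_fun s w x \<partial>\<mu>)"
proof -
  have nonneg: "0 \<le> ideal_fun s (max_entries w N) x" for N x
    by (induction N) (auto simp: le_max_iff_disj)
  have upper: "ideal_fun s (max_entries w N) x \<le> ideal_fun s w (T x)" if "x \<in> D" for N x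
    by (induction N) (auto simp: w ent_code_le[OF _ that w])
  have mono: "ideal_fun s (max_entries w N) x \<le> ideal_fun s (max_entries w N') x" if "N \<le> N'" for N N' x
    using that by (induction rule: dec_induct) (auto simp: le_max_iff_disj)
  have lim: "(\<lambda>N. ideal_fun s (max_entries w N) x) \<longlonglongrightarrow> ideal_fun s w (T x)" if x: "x \<in> D" for x
  proof (rule LIMSEQ_I)
    fix \<gamma> :: real assume "0 < \<gamma>"
    then obtain z where z: "valid w z" "ideal_fun s w (T x) - \<gamma> < ideal_fun s (ent_code z) x"
      using ent_code_dense[OF x] by blast
    have "norm (ideal_fun s (max_entries w N) x - ideal_fun s w (T x)) < \<gamma>" if "Suc z \<le> N" for N
      using mono[OF that, of x] z upper[OF x, of N] by simp
    then show "\<exists>no. \<forall>N\<ge>no. norm (ideal_fun s (max_entries w N) x - ideal_fun s w (T x)) < \<gamma>" by blast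
  qed
  have "(\<lambda>N. \<integral>x. ideal_fun s (max_entries w N) x \<partial>\<mu>) \<longlonglongrightarrow> (\<integral>x. ideal_fun s w (T x) \<partial>\<mu>)"
  proof (rule integral_dominated_convergence)
    show "integrable \<mu> (\<lambda>_. real (ideal_bound w))" by simp
    show "AE x in \<mu>. (\<lambda>N. ideal_fun s (max_entries w N) x) \<longlonglongrightarrow> ideal_fun s w (T x)"
      using AE_D by eventually_elim (rule lim)
    show "AE x in \<mu>. norm (ideal_fun s (max_entries w N) x) \<le> real (ideal_bound w)" for N
      using AE_D
    proof eventually_elim
      fix x assume "x \<in> D"
      then show "norm (ideal_fun s (max_entries w N) x) \<le> real (ideal_bound w)"
        using upper[of x N] nonneg[of N x] abs_ideal_fun_le[of s w "T x"] by simp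
    qed
  qed measurable
  then show ?thesis by (simp add: integral_T)
qed

text \<open>
  The losses of the single steps add up: half of the admissible error is spent on the sum of length
  \<open>p\<close>, the other half on approximating its composition with \<open>T\<close>.
\<close>

lemma program_approximates:
  assumes u: "\<And>x. 0 \<le> ideal_fun s u x" and "0 < \<gamma>"
  shows "\<exists>n w. run u n = pair p (pair w zero_code)
    \<and> real p * (\<integral>x. ideal_fun s u x \<partial>\<mu>) - (\<integral>x. ideal_fun s w x \<partial>\<mu>) < \<gamma>"
  using \<open>0 < \<gamma>\<close>
proof (induction p arbitrary: \<gamma>)
  case 0
  then show ?case by (intro exI[of _ 0] exI[of _ zero_code]) simp
next
  case (Suc p)
  then obtain n w where n: "run u n = pair p (pair w zero_code)"
    and w: "real p * (\<integral>x. ideal_fun s u x \<partial>\<mu>) - (\<integral>x. ideal_fun s w x \<partial>\<mu>) < \<gamma> / 2"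
    using half_gt_zero by blast
  have "0 \<le> ideal_fun s w x" for x using sound_run[OF u, of n] by (simp add: n sound_def)
  from order_tendstoD(1)[OF max_entries_tendsto[OF this], of "(\<integral>x. ideal_fun s w x \<partial>\<mu>) - \<gamma> / 2"] Suc.prems
  obtain N where N: "(\<integral>x. ideal_fun s w x \<partial>\<mu>) - \<gamma> / 2 < (\<integral>x. ideal_fun s (max_entries w N) x \<partial>\<mu>)"
    by (auto simp: eventually_sequentially)
  obtain n' where n': "run u n' = pair p (pair w (max_entries w N))"
    using run_max_entries[OF n] by blast
  define w' where "w' = lin_code (rat_code 1) u (rat_code 1) (max_entries w N)"
  have "run u (Suc (pair 0 n')) = pair (Suc p) (pair w' zero_code)"
    by (simp add: n' step_def w'_def)
  moreover have "(\<integral>x. ideal_fun s w' x \<partial>\<mu>) = (\<integral>x. ideal_fun s u x \<partial>\<mu>) + (\<integral>x. ideal_fun s (max_entries w N) x \<partial>\<mu>)"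
    by (simp add: w'_def integrable_ideal_fun)
  then have "real (Suc p) * (\<integral>x. ideal_fun s u x \<partial>\<mu>) - (\<integral>x. ideal_fun s w' x \<partial>\<mu>) < \<gamma>"
    using w N by (simp add: distrib_right)
  ultimately show ?case by blast
qed

end

section \<open>A computable rate of convergence\<close>

context measure_preserving_map
begin

text \<open>
  Subtracting means removes the constant \<open>a\<close>: the deviation of an average of \<open>f\<close> from the mean of \<open>f\<close> is
  the average of \<open>h\<close>, minus the mean of \<open>h\<close>, plus the average of \<open>u - birkhoff_sum T u p / p\<close>. The
  averages of \<open>h\<close> are controlled by the maximal inequality, since \<open>h\<close> is small in the mean, and the
  last averages tend to \<open>0\<close> uniformly at a known speed. Each of the three terms is allowed a quarter
  of \<open>\<epsilon>\<close>, and the remaining quarter is kept for the passage from single averages to their supremum.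
\<close>

lemma deviation_bound:
  assumes f: "integrable M f" and u [measurable]: "u \<in> borel_measurable M"
    and C: "\<And>x. \<bar>u x\<bar> \<le> C" and p: "0 < p"
    and h_def: "h = (\<lambda>x. f x + a - u x + birkhoff_sum T u p x / real p)"
    and \<epsilon>: "0 < \<epsilon>" and \<delta>: "0 < \<delta>" and small: "(\<integral>x. \<bar>h x\<bar> \<partial>M) < \<epsilon> * min 1 \<delta> / 4"
    and N: "0 < N" "8 * real p * C \<le> real N * \<epsilon>"
  shows "{x\<in>space M. \<exists>n\<ge>N. 3/4 * \<epsilon> < \<bar>birkhoff_sum T f n x / real n - (\<integral>x. f x \<partial>M)\<bar>} \<in> sets M"
    and "measure M {x\<in>space M. \<exists>n\<ge>N. 3/4 * \<epsilon> < \<bar>birkhoff_sum T f n x / real n - (\<integral>x. f x \<partial>M)\<bar>} < \<delta>"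
proof -
  let ?B = "{x\<in>space M. \<exists>n\<ge>N. 3/4 * \<epsilon> < \<bar>birkhoff_sum T f n x / real n - (\<integral>x. f x \<partial>M)\<bar>}"
  let ?E = "{x\<in>space M. \<exists>n. real n * (\<epsilon> / 4) < \<bar>birkhoff_sum T h n x\<bar>}"
  have [measurable]: "f \<in> borel_measurable M" using f by auto
  show sets: "?B \<in> sets M" by measurable
  have u_int: "integrable M u" by (rule integrable_const_bound[of _ C]) (auto simp: C)
  have h: "integrable M h" unfolding h_def using f u_int by (auto intro!: integrable_birkhoff)
  have mean_h: "(\<integral>x. h x \<partial>M) = (\<integral>x. f x \<partial>M) + a"
    unfolding h_def using f u_int p integrable_birkhoff[OF u_int, of p]
    by (simp add: integral_birkhoff prob_space)
  have "\<epsilon> * min 1 \<delta> / 4 \<le> \<epsilon> / 4" "\<epsilon> * min 1 \<delta> / 4 \<le> \<epsilon> / 4 * \<delta>"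
    using \<epsilon> \<delta> by (auto simp: min_def)
  then have abs_h: "(\<integral>x. \<bar>h x\<bar> \<partial>M) < \<epsilon> / 4" "(\<integral>x. \<bar>h x\<bar> \<partial>M) < \<epsilon> / 4 * \<delta>"
    using small by linarith+
  have mean_small: "\<bar>\<integral>x. h x \<partial>M\<bar> < \<epsilon> / 4"
    using abs_h(1) integral_abs_bound[of M h] by linarith
  have "?B \<subseteq> ?E"
  proof safe
    fix x n assume "x \<in> space M" and n: "N \<le> n"
      and dev: "3/4 * \<epsilon> < \<bar>birkhoff_sum T f n x / real n - (\<integral>x. f x \<partial>M)\<bar>"
    have n0: "0 < real n" using n N(1) by simp
    define b where "b = birkhoff_sum T u n x - birkhoff_sum T (\<lambda>x. birkhoff_sum T u p x / real p) n x"
    have "birkhoff_sum T h n x = birkhoff_sum T f n x + real n * a - b"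
      by (simp add: b_def h_def birkhoff_sum_def sum.distrib sum_subtractf)
    then have "birkhoff_sum T f n x / real n - (\<integral>x. f x \<partial>M)
        = birkhoff_sum T h n x / real n - (\<integral>x. h x \<partial>M) + b / real n"
      using n0 by (simp add: mean_h field_simps)
    moreover have "\<bar>b / real n\<bar> \<le> \<epsilon> / 4"
    proof -
      have "\<bar>b\<bar> \<le> 2 * real p * C" unfolding b_def by (rule average_of_average[OF C p])
      also have "\<dots> \<le> real N * (\<epsilon> / 4)" using N(2) by simp
      also have "\<dots> \<le> real n * (\<epsilon> / 4)" using n \<epsilon> by (intro mult_right_mono) auto
      finally show ?thesis using n0 by (simp add: divide_le_eq mult.commute)
    qed
    ultimately have "\<epsilon> / 4 < \<bar>birkhoff_sum T h n x / real n\<bar>" using dev mean_small by linarith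
    then have "real n * (\<epsilon> / 4) < \<bar>birkhoff_sum T h n x\<bar>"
      using n0 by (simp add: less_divide_eq mult.commute)
    then show "\<exists>n. real n * (\<epsilon> / 4) < \<bar>birkhoff_sum T h n x\<bar>" by blast
  qed
  then have "measure M ?B \<le> measure M ?E"
    using maximal_inequality(1)[OF h, of "\<epsilon> / 4"] \<epsilon> by (intro finite_measure_mono) auto
  then have "\<epsilon> / 4 * measure M ?B \<le> \<epsilon> / 4 * measure M ?E" using \<epsilon> by (intro mult_left_mono) auto
  also have "\<dots> \<le> (\<integral>x. \<bar>h x\<bar> \<partial>M)" using \<epsilon> by (intro maximal_inequality(2)[OF h]) simp
  also have "\<dots> < \<epsilon> / 4 * \<delta>" by (rule abs_h(2))
  finally show "measure M ?B < \<delta>" using \<epsilon> by simp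
qed

end

context computable_map
begin

text \<open>
  Programs need a nonnegative function; adding a constant does not change the deviation of averages
  from the mean.
\<close>

definition shift_code :: "nat \<Rightarrow> nat" where
  "shift_code k = lin_code (rat_code 1) k (rat_code (ideal_bound k)) 0"

lemma ideal_fun_shift: "ideal_fun s (shift_code k) x = ideal_fun s k x + real (ideal_bound k)"
  by (simp add: shift_code_def)

lemma shift_nonneg: "0 \<le> ideal_fun s (shift_code k) x"
  and shift_le: "\<bar>ideal_fun s (shift_code k) x\<bar> \<le> 2 * real (ideal_bound k)"
  using abs_ideal_fun_le[of s k x] by (auto simp: ideal_fun_shift)

text \<open>
  The code of \<open>\<bar>w + r\<bar> + (p * u - w)\<close>. If \<open>w\<close> lies below the Birkhoff sum of \<open>u\<close> of length \<open>p\<close>, the integral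
  of this function bounds the distance in the mean of the Birkhoff sum from the constant \<open>- r\<close>.
\<close>

definition defect_code :: "nat \<Rightarrow> nat \<Rightarrow> nat \<Rightarrow> nat \<Rightarrow> nat" where
  "defect_code u p w r =
     lin_code (rat_code 1)
       (max_code (lin_code (rat_code 1) w r 0) (lin_code minus_one_code (lin_code (rat_code 1) w r 0) (rat_code 0) 0))
       (rat_code 1) (lin_code (rat_code p) u minus_one_code w)"

lemma ideal_fun_defect: "ideal_fun s (defect_code u p w r) x =
    \<bar>ideal_fun s w x + real_of_rat (nat_to_rat_surj r)\<bar> + (real p * ideal_fun s u x - ideal_fun s w x)"
  by (simp add: defect_code_def abs_if max_def)

lemma integral_defect: "(\<integral>x. ideal_fun s (defect_code u p w r) x \<partial>\<mu>) =
    (\<integral>x. \<bar>ideal_fun s w x + real_of_rat (nat_to_rat_surj r)\<bar> \<partial>\<mu>)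
    + (real p * (\<integral>x. ideal_fun s u x \<partial>\<mu>) - (\<integral>x. ideal_fun s w x \<partial>\<mu>))"
  unfolding ideal_fun_defect by (simp add: integrable_ideal_fun)

lemma birkhoff_error:
  assumes u: "\<And>x. 0 \<le> ideal_fun s u x" and run: "run u n = pair p (pair w v)"
  shows "(\<integral>x. \<bar>birkhoff_sum T (ideal_fun s u) p x - ideal_fun s w x\<bar> \<partial>\<mu>)
    = real p * (\<integral>x. ideal_fun s u x \<partial>\<mu>) - (\<integral>x. ideal_fun s w x \<partial>\<mu>)"
proof -
  have "AE x in \<mu>. ideal_fun s w x \<le> birkhoff_sum T (ideal_fun s u) p x"
    using sound_run[OF u, of n] by (simp add: run sound_def)
  then have "(\<integral>x. \<bar>birkhoff_sum T (ideal_fun s u) p x - ideal_fun s w x\<bar> \<partial>\<mu>)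
      = (\<integral>x. birkhoff_sum T (ideal_fun s u) p x - ideal_fun s w x \<partial>\<mu>)"
    by (intro integral_cong_AE) auto
  then show ?thesis
    by (simp add: integrable_ideal_fun integrable_birkhoff integral_birkhoff)
qed

text \<open>
  The search space: \<open>z\<close> codes the index \<open>n\<close> of an approximation \<open>F n\<close> of the given function, a program,
  a rational \<open>r\<close> and a precision \<open>m\<close>. It is acceptable for the tolerances numbered \<open>i\<close> and \<open>j\<close> if the
  hypothesis of the deviation bound has been verified with these data, multiplied by \<open>p\<close>.
\<close>

definition acceptable :: "(nat \<Rightarrow> nat) \<Rightarrow> nat \<Rightarrow> nat \<Rightarrow> nat \<Rightarrow> bool" where
  "acceptable F i j z \<longleftrightarrow> (let n = pfst z; prog = pfst (psnd z); r = pfst (psnd (psnd z)); m = psnd (psnd (psnd z));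
     u = shift_code (F n); p = pfst (run u prog); w = pfst (psnd (run u prog)); H = defect_code u p w r
   in 0 < p \<and> real p * (1/2) ^ n + (approx_integral H m + integral_error H m)
      < real p * (real_of_rat (pos_rat i) * min 1 (real_of_rat (pos_rat j)) / 4))"

text \<open>
  The bound on \<open>u\<close> in the deviation bound is twice the bound of the unshifted function, and
  the denominator of \<open>\<epsilon>\<close> is an upper bound of \<open>1 / \<epsilon>\<close>.
\<close>

definition rate :: "(nat \<Rightarrow> nat) \<Rightarrow> nat \<Rightarrow> nat \<Rightarrow> nat" where
  "rate F i z = Suc (16 * pfst (run (shift_code (F (pfst z))) (pfst (psnd z))) * ideal_bound (F (pfst z)) * Suc (psnd i))"

lemma total_recursive_shift_code [recursive_intros]:
  "total_recursive K \<Longrightarrow> total_recursive (\<lambda>x. shift_code (K x))"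
  unfolding shift_code_def by (intro recursive_intros)

lemma total_recursive_defect_code [recursive_intros]:
  "total_recursive U \<Longrightarrow> total_recursive P \<Longrightarrow> total_recursive W \<Longrightarrow> total_recursive R
    \<Longrightarrow> total_recursive (\<lambda>x. defect_code (U x) (P x) (W x) (R x))"
  unfolding defect_code_def by (intro recursive_intros)

lemma decidable_acceptable:
  assumes "total_recursive F" "total_recursive I" "total_recursive J" "total_recursive Z"
  shows "decidable (\<lambda>x. acceptable F (I x) (J x) (Z x))"
  unfolding acceptable_def Let_def by (intro recursive_intros total_recursive_comp[OF assms(1)] assms(2-4))

lemma total_recursive_rate:
  assumes "total_recursive F" "total_recursive I" "total_recursive Z"
  shows "total_recursive (\<lambda>x. rate F (I x) (Z x))"
  unfolding rate_def by (intro recursive_intros total_recursive_comp[OF assms(1)] assms(2,3))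

lemma acceptable_rate:
  fixes f :: "'a \<Rightarrow> real"
  assumes f: "integrable \<mu> f" and F: "\<And>n. L1_dist \<mu> (ideal_fun s (F n)) f \<le> (1/2) ^ n"
    and z: "acceptable F i j z"
  shows "{x\<in>space \<mu>. \<exists>n\<ge>rate F i z. 3/4 * real_of_rat (pos_rat i) < \<bar>birkhoff_sum T f n x / real n - (\<integral>x. f x \<partial>\<mu>)\<bar>} \<in> sets \<mu>"
    and "measure \<mu> {x\<in>space \<mu>. \<exists>n\<ge>rate F i z. 3/4 * real_of_rat (pos_rat i) < \<bar>birkhoff_sum T f n x / real n - (\<integral>x. f x \<partial>\<mu>)\<bar>}
      < real_of_rat (pos_rat j)"
proof -
  define n prog r m where "n = pfst z" and "prog = pfst (psnd z)" and "r = pfst (psnd (psnd z))" and "m = psnd (psnd (psnd z))"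
  define k u where "k = F n" and "u = shift_code k"
  define p w v where "p = pfst (run u prog)" and "w = pfst (psnd (run u prog))" and "v = psnd (psnd (run u prog))"
  have run: "run u prog = pair p (pair w v)" by (simp add: p_def w_def v_def)
  define H where "H = defect_code u p w r"
  define \<rho> where "\<rho> = real_of_rat (nat_to_rat_surj r)"
  define \<theta> where "\<theta> = real_of_rat (pos_rat i) * min 1 (real_of_rat (pos_rat j)) / 4"
  have p: "0 < p" and acc: "real p * (1/2) ^ n + (approx_integral H m + integral_error H m) < real p * \<theta>"
    using z unfolding acceptable_def Let_def
    by (simp_all add: n_def prog_def r_def m_def k_def u_def p_def w_def H_def \<theta>_def)
  have u_nonneg: "0 \<le> ideal_fun s u x" for x unfolding u_def by (rule shift_nonneg)
  have S_int: "integrable \<mu> (birkhoff_sum T (ideal_fun s u) p)" by (intro integrable_birkhoff integrable_ideal_fun)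
  define h where "h x = f x + (real (ideal_bound k) + \<rho> / real p) - ideal_fun s u x
      + birkhoff_sum T (ideal_fun s u) p x / real p" for x
  have h: "\<bar>h x\<bar> \<le> \<bar>ideal_fun s k x - f x\<bar> + (\<bar>birkhoff_sum T (ideal_fun s u) p x - ideal_fun s w x\<bar> + \<bar>ideal_fun s w x + \<rho>\<bar>) / real p" for x
  proof -
    have "h x = - (ideal_fun s k x - f x) + ((birkhoff_sum T (ideal_fun s u) p x - ideal_fun s w x) + (ideal_fun s w x + \<rho>)) / real p"
      by (simp add: h_def u_def ideal_fun_shift add_divide_distrib[symmetric])
    also have "\<bar>\<dots>\<bar> \<le> \<bar>- (ideal_fun s k x - f x)\<bar> + \<bar>((birkhoff_sum T (ideal_fun s u) p x - ideal_fun s w x) + (ideal_fun s w x + \<rho>)) / real p\<bar>"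
      by (rule abs_triangle_ineq)
    also have "\<dots> \<le> \<bar>ideal_fun s k x - f x\<bar> + (\<bar>birkhoff_sum T (ideal_fun s u) p x - ideal_fun s w x\<bar> + \<bar>ideal_fun s w x + \<rho>\<bar>) / real p"
      unfolding abs_minus_cancel abs_divide abs_of_nat
      by (intro add_left_mono divide_right_mono abs_triangle_ineq) simp
    finally show ?thesis .
  qed
  have "(\<integral>x. \<bar>h x\<bar> \<partial>\<mu>) \<le> (\<integral>x. \<bar>ideal_fun s k x - f x\<bar> + (\<bar>birkhoff_sum T (ideal_fun s u) p x - ideal_fun s w x\<bar> + \<bar>ideal_fun s w x + \<rho>\<bar>) / real p \<partial>\<mu>)"
    using f S_int by (intro integral_mono h) (auto simp: h_def integrable_ideal_fun)
  also have "\<dots> = L1_dist \<mu> (ideal_fun s k) f + (\<integral>x. ideal_fun s H x \<partial>\<mu>) / real p"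
    using f S_int by (simp add: L1_dist_def integrable_ideal_fun H_def integral_defect birkhoff_error[OF u_nonneg run] \<rho>_def)
  also have "\<dots> \<le> (1/2) ^ n + (approx_integral H m + integral_error H m) / real p"
    using F[of n] approx_integral[of H m] unfolding k_def by (intro add_mono divide_right_mono) auto
  also have "\<dots> < \<theta>"
    using acc p by (simp add: field_simps)
  finally have small: "(\<integral>x. \<bar>h x\<bar> \<partial>\<mu>) < real_of_rat (pos_rat i) * min 1 (real_of_rat (pos_rat j)) / 4"
    by (simp add: \<theta>_def)
  have N: "8 * real p * (2 * real (ideal_bound k)) \<le> real (rate F i z) * real_of_rat (pos_rat i)"
  proof -
    have "1 \<le> real (Suc (psnd i)) * real_of_rat (pos_rat i)"
      unfolding real_pos_rat by simp
    then have "16 * real p * real (ideal_bound k) * 1 \<le> 16 * real p * real (ideal_bound k) * (real (Suc (psnd i)) * real_of_rat (pos_rat i))"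
      by (intro mult_left_mono) auto
    also have "\<dots> \<le> real (rate F i z) * real_of_rat (pos_rat i)"
      unfolding mult.assoc[symmetric] using pos_rat_pos[of i]
      by (intro mult_right_mono) (simp_all add: rate_def p_def u_def k_def n_def prog_def algebra_simps)
    finally show ?thesis by simp
  qed
  note * = deviation_bound[OF f _ _ p _ pos_rat_pos pos_rat_pos small _ N,
      where u = "ideal_fun s u" and a = "real (ideal_bound k) + \<rho> / real p"]
  show "{x\<in>space \<mu>. \<exists>n\<ge>rate F i z. 3/4 * real_of_rat (pos_rat i) < \<bar>birkhoff_sum T f n x / real n - (\<integral>x. f x \<partial>\<mu>)\<bar>} \<in> sets \<mu>"
    by (rule *(1)) (auto simp: shift_le u_def h_def rate_def)
  show "measure \<mu> {x\<in>space \<mu>. \<exists>n\<ge>rate F i z. 3/4 * real_of_rat (pos_rat i) < \<bar>birkhoff_sum T f n x / real n - (\<integral>x. f x \<partial>\<mu>)\<bar>}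
      < real_of_rat (pos_rat j)"
    by (rule *(2)) (auto simp: shift_le u_def h_def rate_def)
qed

text \<open>
  The search ends because averages of some length are close to a constant in the mean, that constant
  can be replaced by a nearby rational, and Birkhoff sums are approximated from below by programs.
\<close>

lemma acceptable_exists: "\<exists>z. acceptable F i j z"
proof -
  define \<theta> where "\<theta> = real_of_rat (pos_rat i) * min 1 (real_of_rat (pos_rat j)) / 4"
  have \<theta>: "0 < \<theta>" by (simp add: \<theta>_def pos_rat_pos del: zero_less_of_rat_iff)
  obtain n where n: "(1/2) ^ n < \<theta> / 4" using real_arch_pow_inv[of "\<theta> / 4" "1/2"] \<theta> by auto
  define u where "u = shift_code (F n)"
  have u_nonneg: "0 \<le> ideal_fun s u x" for x unfolding u_def by (rule shift_nonneg)
  define c where "c = (\<integral>x. ideal_fun s u x \<partial>\<mu>)"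
  have "(\<lambda>n. \<integral>x. \<bar>birkhoff_sum T (ideal_fun s u) n x / real n - c\<bar> \<partial>\<mu>) \<longlonglongrightarrow> 0"
    unfolding c_def by (rule L1_birkhoff_tendsto) (auto intro: abs_ideal_fun_le)
  then have "eventually (\<lambda>n. (\<integral>x. \<bar>birkhoff_sum T (ideal_fun s u) n x / real n - c\<bar> \<partial>\<mu>) < \<theta> / 4) sequentially"
    by (rule order_tendstoD(2)) (use \<theta> in simp)
  then obtain p0 where p0: "\<And>p. p0 \<le> p \<Longrightarrow> (\<integral>x. \<bar>birkhoff_sum T (ideal_fun s u) p x / real p - c\<bar> \<partial>\<mu>) < \<theta> / 4"
    unfolding eventually_sequentially by blast
  define p where "p = Suc p0"
  have p: "0 < p" and mean: "(\<integral>x. \<bar>birkhoff_sum T (ideal_fun s u) p x / real p - c\<bar> \<partial>\<mu>) < \<theta> / 4"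
    using p0[of p] by (simp_all add: p_def)
  have p\<theta>: "0 < real p * \<theta>" using p \<theta> by simp
  obtain r where r: "- real p * c < real_of_rat (nat_to_rat_surj r)" "real_of_rat (nat_to_rat_surj r) < - real p * c + real p * \<theta> / 8"
    using rat_between[of "- real p * c" "- real p * c + real p * \<theta> / 8"] p\<theta> by auto
  define \<rho> where "\<rho> = real_of_rat (nat_to_rat_surj r)"
  obtain prog w where run: "run u prog = pair p (pair w zero_code)"
    and w: "real p * c - (\<integral>x. ideal_fun s w x \<partial>\<mu>) < real p * \<theta> / 16"
    using program_approximates[OF u_nonneg, of "real p * \<theta> / 16" p] p\<theta> unfolding c_def by auto
  define H where "H = defect_code u p w r"
  have S_int: "integrable \<mu> (birkhoff_sum T (ideal_fun s u) p)" by (intro integrable_birkhoff integrable_ideal_fun)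
  have "\<bar>ideal_fun s w x + \<rho>\<bar> \<le> \<bar>birkhoff_sum T (ideal_fun s u) p x - ideal_fun s w x\<bar>
      + (real p * \<bar>birkhoff_sum T (ideal_fun s u) p x / real p - c\<bar> + real p * \<theta> / 8)" for x
  proof -
    have "real p * \<bar>birkhoff_sum T (ideal_fun s u) p x / real p - c\<bar> = \<bar>birkhoff_sum T (ideal_fun s u) p x - real p * c\<bar>"
      using p by (simp add: abs_mult[of "real p", simplified, symmetric] right_diff_distrib)
    then show ?thesis using r unfolding \<rho>_def[symmetric] by (simp add: abs_if split: if_splits)
  qed
  then have "(\<integral>x. \<bar>ideal_fun s w x + \<rho>\<bar> \<partial>\<mu>) \<le> (\<integral>x. \<bar>birkhoff_sum T (ideal_fun s u) p x - ideal_fun s w x\<bar>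
      + (real p * \<bar>birkhoff_sum T (ideal_fun s u) p x / real p - c\<bar> + real p * \<theta> / 8) \<partial>\<mu>)"
    using S_int by (intro integral_mono) (auto simp: integrable_ideal_fun)
  also have "\<dots> = (real p * c - (\<integral>x. ideal_fun s w x \<partial>\<mu>))
      + (real p * (\<integral>x. \<bar>birkhoff_sum T (ideal_fun s u) p x / real p - c\<bar> \<partial>\<mu>) + real p * \<theta> / 8)"
    using S_int by (simp add: integrable_ideal_fun birkhoff_error[OF u_nonneg run] c_def prob_space[unfolded space_\<mu>])
  finally have "(\<integral>x. \<bar>ideal_fun s w x + \<rho>\<bar> \<partial>\<mu>) \<le> (real p * c - (\<integral>x. ideal_fun s w x \<partial>\<mu>))
      + (real p * (\<integral>x. \<bar>birkhoff_sum T (ideal_fun s u) p x / real p - c\<bar> \<partial>\<mu>) + real p * \<theta> / 8)" .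
  moreover have "real p * (\<integral>x. \<bar>birkhoff_sum T (ideal_fun s u) p x / real p - c\<bar> \<partial>\<mu>) < real p * (\<theta> / 4)"
    using mean p by (intro mult_strict_left_mono) auto
  ultimately have H: "(\<integral>x. ideal_fun s H x \<partial>\<mu>) < real p * \<theta> / 2"
    using w unfolding H_def integral_defect c_def[symmetric] \<rho>_def[symmetric] by simp
  have "eventually (\<lambda>m. integral_error H m < real p * \<theta> / 8) sequentially"
    by (rule order_tendstoD(2)[OF integral_error_tendsto]) (use p\<theta> in simp)
  then obtain m where m: "integral_error H m < real p * \<theta> / 8" by (auto simp: eventually_sequentially)
  have "real p * (1/2) ^ n < real p * (\<theta> / 4)" using n p by (intro mult_strict_left_mono) auto
  then have "real p * (1/2) ^ n + (approx_integral H m + integral_error H m) < real p * \<theta>"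
    using approx_integral[of H m] H m by (simp add: abs_le_iff)
  then have "acceptable F i j (pair n (pair prog (pair r m)))"
    unfolding acceptable_def Let_def
    by (simp add: u_def[symmetric] run p H_def[symmetric] \<theta>_def)
  then show ?thesis by blast
qed

text \<open>
  A rate is a function of rationals, but a search depends on their numbers, and a rational has many.
  The search is therefore performed with the least numbers of the two tolerances.
\<close>

lemma computable_rate_exists:
  fixes f :: "'a \<Rightarrow> real"
  assumes F_rec: "total_recursive F"
    and f: "integrable \<mu> f" and F: "\<And>n. L1_dist \<mu> (ideal_fun s (F n)) f \<le> (1/2) ^ n"
  shows "\<exists>N. computable_rate N \<and> (\<forall>\<epsilon>>0. \<forall>\<delta>>0.
    {x\<in>space \<mu>. \<exists>n\<ge>N \<epsilon> \<delta>. 3/4 * real_of_rat \<epsilon> < \<bar>birkhoff_sum T f n x / real n - (\<integral>x. f x \<partial>\<mu>)\<bar>} \<in> sets \<mu>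
    \<and> 0 < N \<epsilon> \<delta>
    \<and> measure \<mu> {x\<in>space \<mu>. \<exists>n\<ge>N \<epsilon> \<delta>. 3/4 * real_of_rat \<epsilon> < \<bar>birkhoff_sum T f n x / real n - (\<integral>x. f x \<partial>\<mu>)\<bar>}
      < real_of_rat \<delta>)"
proof -
  define R where "R i j = rate F i (LEAST z. acceptable F i j z)" for i j
  define code where "code q = (LEAST i. pos_rat i = q)" for q
  have code: "pos_rat (code q) = q" if q: "0 < q" for q
  proof -
    have "\<exists>i. pos_rat i = q" using range_pos_rat q by (metis mem_Collect_eq rangeE)
    then show ?thesis unfolding code_def by (rule LeastI_ex)
  qed
  have code_rec: "total_recursive (\<lambda>i. code (pos_rat (G i)))" if "total_recursive G" for G
  proof -
    have "decidable (\<lambda>z. real_of_rat (pos_rat (psnd z)) = real_of_rat (pos_rat (pfst z)))"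
      by (intro recursive_intros)
    then have "total_recursive (\<lambda>i. LEAST k. real_of_rat (pos_rat k) = real_of_rat (pos_rat i))"
      by (rule total_recursive_Least) blast
    from total_recursive_comp[OF this that] show ?thesis by (simp add: code_def of_rat_eq_iff)
  qed
  have "decidable (\<lambda>y. acceptable F (pfst (pfst y)) (psnd (pfst y)) (psnd y))"
    by (intro decidable_acceptable recursive_intros F_rec)
  then have "total_recursive (\<lambda>x. LEAST z. acceptable F (pfst x) (psnd x) z)"
    by (rule total_recursive_Least) (rule acceptable_exists)
  then have "total_recursive (\<lambda>x. R (pfst x) (psnd x))"
    unfolding R_def by (intro total_recursive_rate recursive_intros F_rec)
  from total_recursive_comp[OF this total_recursive_pair[OF code_rec[OF total_recursive_pfst[OF total_recursive_id]]
        code_rec[OF total_recursive_psnd[OF total_recursive_id]]]]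
  have "total_recursive (\<lambda>x. R (code (pos_rat (pfst x))) (code (pos_rat (psnd x))))" by simp
  from recursive_at_uncurry2[of "\<lambda>i j. R (code (pos_rat i)) (code (pos_rat j))", OF this]
  obtain g where "recursive_fn 2 g"
    and g: "\<And>xs. length xs = 2 \<Longrightarrow> g xs = R (code (pos_rat (xs ! 0))) (code (pos_rat (xs ! 1)))"
    by (auto simp: recursive_at_def)
  then have "computable_rate (\<lambda>\<epsilon> \<delta>. R (code \<epsilon>) (code \<delta>))"
    unfolding computable_rate_def using g[of "[_, _]"] by (intro exI[of _ g]) simp
  moreover have "acceptable F i j (LEAST z. acceptable F i j z)" for i j
    using acceptable_exists by (rule LeastI_ex)
  note R = acceptable_rate[OF f F this, folded R_def]
  have "{x\<in>space \<mu>. \<exists>n\<ge>R (code \<epsilon>) (code \<delta>). 3/4 * real_of_rat \<epsilon> < \<bar>birkhoff_sum T f n x / real n - (\<integral>x. f x \<partial>\<mu>)\<bar>} \<in> sets \<mu>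
      \<and> measure \<mu> {x\<in>space \<mu>. \<exists>n\<ge>R (code \<epsilon>) (code \<delta>). 3/4 * real_of_rat \<epsilon> < \<bar>birkhoff_sum T f n x / real n - (\<integral>x. f x \<partial>\<mu>)\<bar>}
      < real_of_rat \<delta>" if "0 < \<epsilon>" "0 < \<delta>" for \<epsilon> \<delta>
    using R[of "code \<epsilon>" "code \<delta>"] unfolding code[OF that(1)] code[OF that(2)] by blast
  moreover have "0 < R i j" for i j by (simp add: R_def rate_def)
  ultimately show ?thesis by (intro exI[of _ "\<lambda>\<epsilon> \<delta>. R (code \<epsilon>) (code \<delta>)"]) blast
qed

end

section \<open>The effective ergodic theorem\<close>

lemma open_ideal_ball: "open (ideal_ball s k)"
  by (simp add: ideal_ball_def split_beta)

lemma ereal_integrable_finite: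
  assumes "ereal_integrable M f"
  shows "AE x in M. \<bar>f x\<bar> \<noteq> \<infinity>" and "integrable M (\<lambda>x. real_of_ereal (f x))"
proof -
  have [measurable]: "f \<in> borel_measurable M" using assms by (simp add: ereal_integrable_def)
  have fin: "(\<integral>\<^sup>+x. e2ennreal \<bar>f x\<bar> \<partial>M) < \<infinity>" using assms by (simp add: ereal_integrable_def)
  have "AE x in M. e2ennreal \<bar>f x\<bar> \<noteq> \<infinity>"
    by (rule nn_integral_noteq_infinite) (use fin in auto)
  then show "AE x in M. \<bar>f x\<bar> \<noteq> \<infinity>"
    by eventually_elim auto
  have le: "ennreal (norm (real_of_ereal y)) \<le> e2ennreal \<bar>y\<bar>" for y :: ereal
    by (cases y) auto
  show "integrable M (\<lambda>x. real_of_ereal (f x))"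
  proof (rule integrableI_bounded)
    have "(\<integral>\<^sup>+x. ennreal (norm (real_of_ereal (f x))) \<partial>M) \<le> (\<integral>\<^sup>+x. e2ennreal \<bar>f x\<bar> \<partial>M)"
      by (intro nn_integral_mono le)
    then show "(\<integral>\<^sup>+x. ennreal (norm (real_of_ereal (f x))) \<partial>M) < \<infinity>" using fin by (rule le_less_trans)
  qed measurable
qed

text \<open>
  The orbit of almost every point avoids the infinite values of the function, and there the extended
  real averages are ordinary ones.
\<close>

lemma ergodic_average_eq:
  assumes "\<And>i. \<bar>f ((T ^^ i) x)\<bar> \<noteq> \<infinity>" "0 < n"
  shows "ergodic_average T f n x = ereal (birkhoff_sum T (\<lambda>x. real_of_ereal (f x)) n x / real n)"
proof -
  have "(\<Sum>i<n. f ((T ^^ i) x)) = (\<Sum>i<n. ereal (real_of_ereal (f ((T ^^ i) x))))"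
    using assms(1) by (intro sum.cong) (auto simp: ereal_real)
  then show ?thesis using assms(2) by (simp add: ergodic_average_def birkhoff_sum_def)
qed

lemma (in measure_preserving_map) ergodic_average_measurable [measurable]:
  assumes [measurable]: "f \<in> borel_measurable M"
  shows "ergodic_average T f n \<in> borel_measurable M"
proof -
  have "(\<lambda>x. f ((T ^^ i) x)) \<in> borel_measurable M" for i
    by (rule measurable_compose[OF funpow_measurable]) fact
  then show ?thesis unfolding ergodic_average_def[abs_def] by measurable
qed

text \<open>
  A supremum can reach \<open>a\<close> without being attained, but then some term exceeds any \<open>b < a\<close>.
\<close>

lemma (in measure_preserving_map) sup_deviation_le:
  assumes f: "f \<in> borel_measurable M" and fin: "AE x in M. \<bar>f x\<bar> \<noteq> \<infinity>"
    and B: "{x\<in>space M. \<exists>k\<ge>N. b < \<bar>birkhoff_sum T (\<lambda>x. real_of_ereal (f x)) k x / real k - c\<bar>} \<in> sets M"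
    and b: "b < a" and N: "0 < N" "N \<le> n"
  shows "measure M {x\<in>space M. ereal a \<le> \<bar>(SUP k\<in>{n..}. \<bar>ergodic_average T f k x - ereal c\<bar>) - 0\<bar>}
    \<le> measure M {x\<in>space M. \<exists>k\<ge>N. b < \<bar>birkhoff_sum T (\<lambda>x. real_of_ereal (f x)) k x / real k - c\<bar>}"
proof (rule finite_measure_mono_AE[OF _ B])
  have "AE x in M. \<forall>i. \<bar>f ((T ^^ i) x)\<bar> \<noteq> \<infinity>"
    unfolding AE_all_countable by (intro allI AE_funpow fin)
  then show "AE x in M. x \<in> {x\<in>space M. ereal a \<le> \<bar>(SUP k\<in>{n..}. \<bar>ergodic_average T f k x - ereal c\<bar>) - 0\<bar>}
      \<longrightarrow> x \<in> {x\<in>space M. \<exists>k\<ge>N. b < \<bar>birkhoff_sum T (\<lambda>x. real_of_ereal (f x)) k x / real k - c\<bar>}"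
  proof eventually_elim
    case (elim x)
    show ?case
    proof safe
      define G where "G k = \<bar>ergodic_average T f k x - ereal c\<bar>" for k
      assume "x \<in> space M" and "ereal a \<le> \<bar>(SUP k\<in>{n..}. \<bar>ergodic_average T f k x - ereal c\<bar>) - 0\<bar>"
      then have "ereal a \<le> \<bar>SUP k\<in>{n..}. G k\<bar>" by (simp add: G_def)
      moreover have "0 \<le> (SUP k\<in>{n..}. G k)" by (rule SUP_upper2[of n]) (auto simp: G_def)
      ultimately have "ereal a \<le> (SUP k\<in>{n..}. G k)" by simp
      moreover have "ereal b < ereal a" using b by simp
      ultimately have "ereal b < (SUP k\<in>{n..}. G k)" by (rule less_le_trans[rotated])
      then obtain k where k: "n \<le> k" "ereal b < G k" by (auto simp: less_SUP_iff)
      then have "G k = ereal \<bar>birkhoff_sum T (\<lambda>x. real_of_ereal (f x)) k x / real k - c\<bar>"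
        using N ergodic_average_eq[of f T x k] elim by (simp add: G_def)
      then show "\<exists>k\<ge>N. b < \<bar>birkhoff_sum T (\<lambda>x. real_of_ereal (f x)) k x / real k - c\<bar>"
        using k N by (intro exI[of _ k]) auto
    qed
  qed
qed

text \<open>
  The set \<open>D\<close> is measurable as a countable intersection of open sets, which turns its measure one into
  a statement about almost every point; otherwise the algorithms are those of the hypotheses.
\<close>

lemma computable_map_exists:
  fixes s :: "nat \<Rightarrow> 'a::{metric_space, second_countable_topology}"
  assumes cps: "computable_probability_space s \<mu>" and aec: "ae_computable s \<mu> s T" and erg: "ergodic \<mu> T"
  shows "\<exists>d \<nu> D e. computable_map s \<mu> d \<nu> T D e"
proof -
  have cms: "computable_metric_space s" and meas: "bounded (UNIV :: 'a set)" "prob_space \<mu>" "sets \<mu> = sets borel"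
      "computable_point W1 (ideal_measure s) \<mu>"
    using cps by (auto simp: computable_probability_space_def computable_measure_def)
  interpret prob_space \<mu> by fact
  have space: "space \<mu> = UNIV" using sets_eq_imp_space_eq[OF meas(3)] by simp
  obtain g where g: "recursive_fn 3 g"
    "\<And>i j n. \<bar>real_of_rat (nat_to_rat_surj (g [i, j, n])) - dist (s i) (s j)\<bar> < (1/2) ^ n"
    and dense: "closure (range s) = UNIV"
    using cms by (auto simp: computable_metric_space_def)
  obtain m where m: "recursive_fn 1 m" "\<And>n. W1 (ideal_measure s (m [n])) \<mu> \<le> (1/2) ^ n"
    using meas(4) by (auto simp: computable_point_def)
  obtain D where D: "effective_Gdelta s D" "measure \<mu> D = 1" "computable_on s s D T"
    using aec by (auto simp: ae_computable_def)
  obtain V where V: "uniformly_effective_open s V" "D = (\<Inter>i. V i)"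
    using D(1) by (auto simp: effective_Gdelta_def)
  obtain U where U: "uniformly_effective_open s U" "\<And>i. T -` ideal_ball s i \<inter> D = U i \<inter> D"
    using D(3) by (auto simp: computable_on_def)
  obtain e where e: "recursive_fn 2 e" "\<And>i. U i = \<Union>{ideal_ball s k | k. \<exists>n. e [i, n] = Suc k}"
    using U(1) by (auto simp: uniformly_effective_open_def)
  have at: "recursive_at 3 g" "recursive_at 1 m" "recursive_at 2 e"
    using g(1) m(1) e(1) by (auto simp: recursive_at_def)
  have m_rec: "total_recursive (\<lambda>n. m [n])"
  proof -
    have "m [xs ! 0] = m xs" if "length xs = 1" for xs using that by (cases xs) auto
    then show ?thesis unfolding total_recursive_def using at(2) by (subst recursive_at_cong) auto
  qed
  have D_sets: "D \<in> sets \<mu>"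
  proof -
    have "open (V i)" for i
    proof -
      obtain e' where "V i = \<Union>{ideal_ball s k | k. \<exists>n. e' [i, n] = Suc k}"
        using V(1) by (auto simp: uniformly_effective_open_def)
      then show ?thesis by (auto intro!: open_Union open_ideal_ball)
    qed
    then have "D \<in> sets borel" unfolding V(2) by (intro sets.countable_INT) auto
    then show ?thesis by (simp add: meas(3))
  qed
  have "computable_map s \<mu> (\<lambda>i j n. real_of_rat (nat_to_rat_surj (g [i, j, n]))) (\<lambda>n. m [n]) T D (\<lambda>i n. e [i, n])"
  proof
    show "closure (range s) = UNIV" by fact
    show "bounded (UNIV :: 'a set)" by fact
    show "T \<in> measurable \<mu> \<mu>" "distr \<mu> \<mu> T = \<mu>"
      using erg by (auto simp: ergodic_def measure_preserving_def)
    show "prob A = 0 \<or> prob A = 1" if "A \<in> sets \<mu>" "T -` A \<inter> space \<mu> = A" for A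
      using erg that by (auto simp: ergodic_def)
    show "AE x in \<mu>. x \<in> D" using D(2) by (simp add: prob_eq_1 D_sets)
    show "rat_recursive (\<lambda>x. real_of_rat (nat_to_rat_surj (g [F x, G x, H x])))"
      if "total_recursive F" "total_recursive G" "total_recursive H" for F G H
      by (intro recursive_intros total_recursive_of_at3 at that)
    show "total_recursive (\<lambda>x. e [F x, G x])" if "total_recursive F" "total_recursive G" for F G
      by (intro total_recursive_of_at2 at that)
    show "T -` ideal_ball s i \<inter> D = \<Union>{ideal_ball s k | k. \<exists>n. e [i, n] = Suc k} \<inter> D" for i
      using U(2)[of i] by (simp only: e(2))
    show "\<bar>real_of_rat (nat_to_rat_surj (g [i, j, n])) - dist (s i) (s j)\<bar> \<le> (1/2) ^ n" for i j n
      using g(2)[of i j n] by simp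
  qed (use meas m(2) m_rec in auto)
  then show ?thesis by blast
qed

theorem theoremA:
  fixes s :: "nat \<Rightarrow> 'a::{metric_space, second_countable_topology}"
    and \<mu> :: "'a measure"
    and T :: "'a \<Rightarrow> 'a"
    and f :: "'a \<Rightarrow> ereal"
  assumes "computable_probability_space s \<mu>"
    and "ae_computable s \<mu> s T"
    and "measure_preserving \<mu> T"
    and "ergodic \<mu> T"
    and "L1_computable s \<mu> f"
  shows "effectively_converges_almost_surely \<mu> (ergodic_average T f) (\<lambda>_. ereal (ereal_integral \<mu> f))"
proof -
  obtain d \<nu> D e where "computable_map s \<mu> d \<nu> T D e"
    using computable_map_exists[OF assms(1,2,4)] by blast
  then interpret computable_map s \<mu> d \<nu> T D e .
  define f' where "f' x = real_of_ereal (f x)" for x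
  have f_int: "ereal_integrable \<mu> f" using assms(5) by (simp add: L1_computable_def)
  then have f_meas [measurable]: "f \<in> borel_measurable \<mu>" by (simp add: ereal_integrable_def)
  have f'_int: "integrable \<mu> f'" using ereal_integrable_finite(2)[OF f_int] by (simp add: f'_def[abs_def])
  obtain F where F: "recursive_fn 1 F" "\<And>n. L1_dist \<mu> (ideal_fun s (F [n])) f' \<le> (1/2) ^ n"
    using assms(5) by (auto simp: L1_computable_def computable_point_def f'_def[abs_def])
  have "total_recursive (\<lambda>n. F [n])"
  proof -
    have "F [xs ! 0] = F xs" if "length xs = 1" for xs using that by (cases xs) auto
    then show ?thesis unfolding total_recursive_def recursive_at_def using F(1) by auto
  qed
  from computable_rate_exists[OF this f'_int F(2)]
  obtain N where N: "computable_rate N"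
    and rate: "\<And>\<epsilon> \<delta>. 0 < \<epsilon> \<Longrightarrow> 0 < \<delta> \<Longrightarrow>
      {x\<in>space \<mu>. \<exists>n\<ge>N \<epsilon> \<delta>. 3/4 * real_of_rat \<epsilon> < \<bar>birkhoff_sum T f' n x / real n - (\<integral>x. f' x \<partial>\<mu>)\<bar>} \<in> sets \<mu>
      \<and> 0 < N \<epsilon> \<delta>
      \<and> measure \<mu> {x\<in>space \<mu>. \<exists>n\<ge>N \<epsilon> \<delta>. 3/4 * real_of_rat \<epsilon> < \<bar>birkhoff_sum T f' n x / real n - (\<integral>x. f' x \<partial>\<mu>)\<bar>}
        < real_of_rat \<delta>" by blast
  have mean: "ereal_integral \<mu> f = (\<integral>x. f' x \<partial>\<mu>)" by (simp add: ereal_integral_def f'_def)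
  have "measure \<mu> {x\<in>space \<mu>. ereal (real_of_rat \<epsilon>)
      \<le> \<bar>(SUP k\<in>{n..}. \<bar>ergodic_average T f k x - ereal (ereal_integral \<mu> f)\<bar>) - 0\<bar>} < real_of_rat \<delta>"
    if "0 < \<epsilon>" "0 < \<delta>" "N \<epsilon> \<delta> \<le> n" for \<epsilon> \<delta> n
  proof -
    have "3/4 * real_of_rat \<epsilon> < real_of_rat \<epsilon>" using that(1) by simp
    from sup_deviation_le[OF f_meas ereal_integrable_finite(1)[OF f_int], folded f'_def, OF _ this]
    show ?thesis unfolding mean
      using rate[OF that(1,2)] that(3) by (blast intro: le_less_trans)
  qed
  then show ?thesis
    unfolding effectively_converges_almost_surely_def effectively_converges_in_probability_def
    using N by (intro conjI allI exI[of _ N]) auto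
qed

end
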